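(* Let $b\colon\mathbb{T}\to\mathbb{R}$ satisfy Assumption 1 (stated in the context), let $h_0>0$, $\iota\colon\mathbb{T}\to\{1,-1\}$ and $\varphi\colon[0,h_0]\to[0,\infty)$ be as in the context, so that $\varphi$ is continuous and strictly increasing, $\varphi(0)=0$, and $|b(y+\iota(y)h)-b(y)|\ge\varphi(h)$ for all $y\in\mathbb{T}$ and $h\in[0,h_0]$. Let $$T_\nu=\inf\{t\ge 0:\ t\,\varphi(\sqrt{\nu t})=1\}.$$ Then the shear flow $u(x,y)=(b(y),0)$ on $\mathbb{T}^2$ is dissipation enhancing with rate function $\lambda(\nu)=T_\nu^{-1}$.
   Context: $\mathbb{T}=\mathbb{R}/\mathbb{Z}$, $\mathbb{T}^2\cong[0,1)^2$. Dissipation enhancing: for $b\colon\mathbb{T}\to\mathbb{R}$, the flow $u(x,y)=(b(y),0)$ is dissipation enhancing with rate function $\lambda\colon(0,1)\to(0,\infty)$ if $\lim_{\nu\to0}\nu/\lambda(\nu)=0$ and there exist constants $C,c>0$ such that for all $f_0\in L^2(\mathbb{T}^2)$ with $\int_{\mathbb{T}}f_0(x,y)\,dx=0$ for all $y\in\mathbb{T}$, the solution of $\partial_tf+b(y)\partial_xf=\nu\Delta f$, $f|_{t=0}=f_0$ on $\mathbb{T}^2$ satisfies $\|f(t)\|_{L^2}\le Ce^{-c\lambda(\nu)t}\|f_0\|_{L^2}$. Assumption 1: $b\colon\mathbb{T}\to\mathbb{R}$ is continuous, smooth away from a discrete set of points $\{\bar y_i\}_{i=1}^N\subseteq\mathbb{T}$,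 and possesses at most finitely many critical points $\{y_i\}_{i=1}^M\subseteq\mathbb{T}$. Moreover: (a) For each $1\le i\le N$ the one-sided limits $\lim_{y\to\bar y_i^{\pm}}|b'(y)|$ both exist and are valued in $(0,\infty]$. In the case that a one-sided limit is infinite, its convergence is eventually monotone and there is $C>0$ such that, for small positive $h$, the function $F(h)=b(\bar y_i\pm h)-b(\bar y_i)$ satisfies $|F(h)|\le Ch|F'(h)|$ and $|F''(h)|\le C|F'(h)|/h$. (b) There exists $C\ge1$ such that if $b'$ vanishes to infinite order at some $y_i$ (i.e. $b^{(k)}(y_i)=0$ for all $k\ge 1$), then the convergence of both one-sided limits $\lim_{y\to y_i^{\pm}}|b'(y)|=0$ is eventually monotone, and $F(h)=b(y_i+h)-b(y_i)$ satisfies $\limsup_{h\to0}\frac{\sqrt{|F(h)|}}{|h|\,|F'(Ch)|}<\infty$. Choice of $h_0,\iota,\varphi$: let $S=\{\bar y_1,\dots,\bar y_N,y_1,\dots,y_M\}$. Since $S$ is finite there is $h_0>0$ such that for every $y\in\mathbb{T}$ there is a choice $\iota(y)\in\{1,-1\}$ such that no element of $S$ lies strictly between $y$ and $y+\iota(y)h_0$. Then $h\mapsto|b(y+\iota(y)h)-b(y)|$ is strictly increasing on $[0,h_0]$ for each $y$, and there is a strictly increasing function $\varphi\in C([0,h_0];[0,\infty))$ with $\varphi(0)=0$ and $|b(y+\iota(y)h)-b(y)|\ge\varphi(h)$ for all $y\in\mathbb{T}$, $h\in[0,h_0]$; $\varphi$ denotes such a function.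
   Formalization: In the definition of T_ν, φ is continued by the constant φ(h_0) beyond h_0, because for ν > h_0²φ(h_0) the set in the infimum is empty and λ(ν) would not be positive; T_ν is unchanged whenever that set is nonempty. The data f_0 are taken real-valued. *)

theory Defs
  imports "HOL-Analysis.Analysis"
begin

text \<open>
  The circle is the quotient of the reals by the integers. Functions on it are 1-periodic functions
  on the reals, subsets are subsets of \<open>[0,1)\<close> (so a real \<open>y\<close> represents a point of \<open>Y\<close> iff
  \<open>frac y \<in> Y\<close>), and integration is over \<open>[0,1)\<close>.
\<close>

definition periodic1 :: "(real \<Rightarrow> 'a) \<Rightarrow> bool" where
  "periodic1 g \<longleftrightarrow> (\<forall>y. g (y + 1) = g y)"

definition circle :: "real measure" where
  "circle = restrict_space lborel {0..<1}"

definition torus :: "(real \<times> real) measure" where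
  "torus = circle \<Otimes>\<^sub>M circle"

definition in_L2 :: "(real \<times> real \<Rightarrow> real) \<Rightarrow> bool" where
  "in_L2 g \<longleftrightarrow> g \<in> borel_measurable torus \<and> integrable torus (\<lambda>p. (g p)\<^sup>2)"

definition norm_L2 :: "(real \<times> real \<Rightarrow> real) \<Rightarrow> real" where
  "norm_L2 g = sqrt (\<integral>p. (g p)\<^sup>2 \<partial>torus)"


section \<open>The advection-diffusion equation\<close>

text \<open>
  \<open>smooth_partials D\<close>: \<open>D 0 0\<close> is a smooth function on the two-dimensional torus and \<open>D m n\<close> is its
  partial derivative of order \<open>m\<close> in \<open>x\<close> and \<open>n\<close> in \<open>y\<close>.
\<close>

definition smooth_partials :: "(nat \<Rightarrow> nat \<Rightarrow> real \<times> real \<Rightarrow> real) \<Rightarrow> bool" where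
  "smooth_partials D \<longleftrightarrow>
     (\<forall>x y. D 0 0 (x + 1, y) = D 0 0 (x, y) \<and> D 0 0 (x, y + 1) = D 0 0 (x, y)) \<and>
     (\<forall>m n. continuous_on UNIV (D m n) \<and>
        (\<forall>x y. ((\<lambda>s. D m n (s, y)) has_real_derivative D (Suc m) n (x, y)) (at x) \<and>
               ((\<lambda>s. D m n (x, s)) has_real_derivative D m (Suc n) (x, y)) (at y)))"

text \<open>
  Solutions of \<open>\<partial>\<^sub>t f + b(y) \<partial>\<^sub>x f = \<nu> \<Delta> f\<close>, \<open>f(0) = f\<^sub>0\<close>, with \<open>f \<in> C([0,\<infinity>); L\<^sup>2)\<close>. The equation holds in
  the sense of distributions, integrated in time: for smooth \<open>\<psi>\<close> and \<open>t \<ge> 0\<close>,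
  \<open>\<langle>f(t), \<psi>\<rangle> - \<langle>f\<^sub>0, \<psi>\<rangle> = \<integral>\<^sub>0\<^sup>t \<langle>f(s), b \<partial>\<^sub>x\<psi> + \<nu> \<Delta>\<psi>\<rangle> ds\<close>.
  For continuous \<open>b\<close> and \<open>\<nu> > 0\<close> there is exactly one such \<open>f\<close>, up to null sets at each time.
\<close>

definition advection_diffusion_solution ::
  "(real \<Rightarrow> real) \<Rightarrow> real \<Rightarrow> (real \<times> real \<Rightarrow> real) \<Rightarrow> (real \<Rightarrow> real \<times> real \<Rightarrow> real) \<Rightarrow> bool" where
  "advection_diffusion_solution b \<nu> f0 f \<longleftrightarrow>
     (\<forall>t\<ge>0. in_L2 (f t)) \<and>
     (\<forall>t\<ge>0. ((\<lambda>s. norm_L2 (\<lambda>p. f s p - f t p)) \<longlongrightarrow> 0) (at t within {0..})) \<and>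
     (AE p in torus. f 0 p = f0 p) \<and>
     (\<forall>D. smooth_partials D \<longrightarrow> (\<forall>t\<ge>0.
        ((\<lambda>s. \<integral>p. f s p * (b (snd p) * D 1 0 p + \<nu> * (D 2 0 p + D 0 2 p)) \<partial>torus)
          has_integral
         ((\<integral>p. f t p * D 0 0 p \<partial>torus) - (\<integral>p. f0 p * D 0 0 p \<partial>torus))) {0..t}))"

definition dissipation_enhancing :: "(real \<Rightarrow> real) \<Rightarrow> (real \<Rightarrow> real) \<Rightarrow> bool" where
  "dissipation_enhancing b rate \<longleftrightarrow>
     (\<forall>\<nu>\<in>{0<..<1}. rate \<nu> > 0) \<and>
     ((\<lambda>\<nu>. \<nu> / rate \<nu>) \<longlongrightarrow> 0) (at_right 0) \<and>
     (\<exists>C>0. \<exists>c>0. \<forall>\<nu>\<in>{0<..<1}. \<forall>f0 f.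
        in_L2 f0 \<and> (AE y in circle. (\<integral>x. f0 (x, y) \<partial>circle) = 0) \<and>
        advection_diffusion_solution b \<nu> f0 f \<longrightarrow>
        (\<forall>t\<ge>0. norm_L2 (f t) \<le> C * exp (- c * rate \<nu> * t) * norm_L2 f0))"


section \<open>The shear profile\<close>

definition critical_point :: "(real \<Rightarrow> real) \<Rightarrow> real \<Rightarrow> bool" where
  "critical_point b y \<longleftrightarrow> (b has_real_derivative 0) (at y)"

definition monotone_lim :: "(real \<Rightarrow> real) \<Rightarrow> real filter \<Rightarrow> bool" where
  "monotone_lim g G \<longleftrightarrow>
     filterlim g G (at_right 0) \<and>
     (\<exists>\<epsilon>>0. mono_on {0<..<\<epsilon>} g \<or> antimono_on {0<..<\<epsilon>} g)"

text \<open>The sign \<open>\<sigma>\<close> selects the right (\<open>1\<close>) or left (\<open>-1\<close>) side of a point.\<close>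

definition admissible_singularity :: "(real \<Rightarrow> real) \<Rightarrow> real \<Rightarrow> bool" where
  "admissible_singularity b y \<longleftrightarrow> (\<forall>\<sigma>\<in>{1, -1}.
     (\<exists>L>0. ((\<lambda>h. \<bar>deriv b (y + \<sigma> * h)\<bar>) \<longlongrightarrow> L) (at_right 0)) \<or>
     (monotone_lim (\<lambda>h. \<bar>deriv b (y + \<sigma> * h)\<bar>) at_top \<and>
      (let F = (\<lambda>h. b (y + \<sigma> * h) - b y) in
       \<exists>C>0. \<forall>\<^sub>F h in at_right 0.
         \<bar>F h\<bar> \<le> C * h * \<bar>deriv F h\<bar> \<and> \<bar>deriv (deriv F) h\<bar> \<le> C * \<bar>deriv F h\<bar> / h)))"

definition admissible_flat_point :: "real \<Rightarrow> (real \<Rightarrow> real) \<Rightarrow> real \<Rightarrow> bool" where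
  "admissible_flat_point C b y \<longleftrightarrow>
     (\<forall>\<sigma>\<in>{1, -1}. monotone_lim (\<lambda>h. \<bar>deriv b (y + \<sigma> * h)\<bar>) (nhds 0)) \<and>
     (let F = (\<lambda>h. b (y + h) - b y) in
      Limsup (at 0) (\<lambda>h. ereal (sqrt \<bar>F h\<bar> / (\<bar>h\<bar> * \<bar>deriv F (C * h)\<bar>))) < \<infinity>)"

text \<open>\<open>Y\<close> is the set of points away from which \<open>b\<close> is smooth.\<close>

definition admissible_profile :: "(real \<Rightarrow> real) \<Rightarrow> real set \<Rightarrow> bool" where
  "admissible_profile b Y \<longleftrightarrow>
     periodic1 b \<and> continuous_on UNIV b \<and>
     finite Y \<and> Y \<subseteq> {0..<1} \<and>
     (\<forall>k y. frac y \<notin> Y \<longrightarrow> (deriv ^^ k) b differentiable (at y)) \<and>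
     finite {y \<in> {0..<1}. critical_point b y} \<and>
     (\<forall>y\<in>Y. admissible_singularity b y) \<and>
     (\<exists>C\<ge>1. \<forall>y. critical_point b y \<and> (\<forall>k\<ge>1. (deriv ^^ k) b y = 0) \<longrightarrow>
        admissible_flat_point C b y)"

definition admissible_direction ::
  "(real \<Rightarrow> real) \<Rightarrow> real set \<Rightarrow> real \<Rightarrow> (real \<Rightarrow> real) \<Rightarrow> bool" where
  "admissible_direction b Y h0 \<iota> \<longleftrightarrow>
     periodic1 \<iota> \<and>
     (\<forall>y. \<iota> y \<in> {1, -1} \<and>
        (\<forall>h\<in>{0<..<h0}. frac (y + \<iota> y * h) \<notin> Y \<and> \<not> critical_point b (y + \<iota> y * h)))"

text \<open>
  The time \<open>T\<^sub>\<nu> = inf {t \<ge> 0. t \<phi>(\<surd>(\<nu> t)) = 1}\<close>. As \<open>\<phi>\<close> lives on \<open>[0,h0]\<close>, that set is empty for \<open>\<nu>\<close>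
  above \<open>h0\<^sup>2 \<phi>(h0)\<close>; to have a finite \<open>T\<^sub>\<nu>\<close> for every \<open>\<nu>\<close>, \<open>\<phi>\<close> is continued by the constant
  \<open>\<phi>(h0)\<close>. This changes nothing when the original set is nonempty.
\<close>

definition enhanced_time :: "real \<Rightarrow> (real \<Rightarrow> real) \<Rightarrow> real \<Rightarrow> real" where
  "enhanced_time h0 \<phi> \<nu> = Inf {t. t \<ge> 0 \<and> t * \<phi> (min h0 (sqrt (\<nu> * t))) = 1}"

lemma enhanced_time_eq:
  assumes "h0 > 0" "strict_mono_on {0..h0} \<phi>" "\<phi> 0 = 0" "\<nu> > 0"
    and nonempty: "{t. t \<ge> 0 \<and> sqrt (\<nu> * t) \<le> h0 \<and> t * \<phi> (sqrt (\<nu> * t)) = 1} \<noteq> {}"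
  shows "enhanced_time h0 \<phi> \<nu> =
    Inf {t. t \<ge> 0 \<and> sqrt (\<nu> * t) \<le> h0 \<and> t * \<phi> (sqrt (\<nu> * t)) = 1}"
proof -
  have "\<phi> 0 < \<phi> h0"
    using assms(1) by (intro strict_mono_onD[OF assms(2)]) auto
  then have pos: "\<phi> h0 > 0" using assms(3) by simp
  obtain u where u: "u \<ge> 0" "sqrt (\<nu> * u) \<le> h0" "u * \<phi> (sqrt (\<nu> * u)) = 1"
    using nonempty by blast
  have le: "\<phi> (sqrt (\<nu> * u)) \<le> \<phi> h0"
    using u assms by (intro monotone_onD[OF strict_mono_on_imp_mono_on[OF assms(2)]]) auto
  have "sqrt (\<nu> * t) \<le> h0" if t: "t * \<phi> (min h0 (sqrt (\<nu> * t))) = 1" for t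
  proof (rule ccontr)
    assume neg: "\<not> sqrt (\<nu> * t) \<le> h0"
    then have "sqrt (\<nu> * u) < sqrt (\<nu> * t)" using u(2) by linarith
    then have "\<nu> * u < \<nu> * t" by (simp only: real_sqrt_less_iff)
    then have "u < t" using assms(4) by (simp only: mult_less_cancel_left_pos)
    have "t * \<phi> h0 = 1" using t neg by (simp add: min_def)
    moreover have "1 \<le> u * \<phi> h0" using mult_left_mono[OF le u(1)] u(3) by simp
    moreover have "u * \<phi> h0 < t * \<phi> h0"
      using \<open>u < t\<close> pos by (rule mult_strict_right_mono)
    ultimately show False by linarith
  qed
  then have "{t. t \<ge> 0 \<and> t * \<phi> (min h0 (sqrt (\<nu> * t))) = 1} =
      {t. t \<ge> 0 \<and> sqrt (\<nu> * t) \<le> h0 \<and> t * \<phi> (sqrt (\<nu> * t)) = 1}"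
    by (intro Collect_cong) (metis min.absorb2)
  then show ?thesis unfolding enhanced_time_def by simp
qed

end

theory Submission
  imports Defs
begin

text \<open>
  In the Fourier variable \<open>k\<close> of \<open>x\<close> the equation becomes \<open>\<partial>\<^sub>t g + H g = 0\<close> on the circle, with
  \<open>H = - \<nu> \<partial>\<^sub>y\<^sup>2 + \<nu> \<kappa>\<^sup>2 + i \<kappa> b\<close>, \<open>\<kappa> = 2 \<pi> k \<noteq> 0\<close>. The key is the resolvent bound
  \<open>\<parallel>u\<parallel> \<le> K T\<^sub>\<nu> \<parallel>(H - i \<kappa> \<lambda>) u\<parallel>\<close>, uniform in \<open>\<lambda>\<close> and \<open>\<kappa>\<close>. Put \<open>h = \<surd>(\<nu> T\<^sub>\<nu>)\<close>, so that \<open>\<phi>(h) = 1 / T\<^sub>\<nu>\<close>.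
  Within distance \<open>5 h\<close> of any point there is one where \<open>\<bar>b - \<lambda>\<bar> \<ge> \<phi>(h) / 2\<close> and whose distance from
  \<open>{b = \<lambda>}\<close> is at least \<open>h\<close>; hence \<open>\<parallel>u\<parallel>\<^sup>2\<close> is controlled by \<open>h\<^sup>2 \<parallel>u'\<parallel>\<^sup>2\<close> and \<open>T\<^sub>\<nu> \<integral> \<sigma> (b - \<lambda>) \<bar>u\<bar>\<^sup>2\<close>, where
  \<open>\<sigma> = sgn (b - \<lambda>) min (1, dist(\<cdot>, {b = \<lambda>}) / h)\<close> is \<open>1/h\<close>-Lipschitz. The first term is estimated by the
  real part of \<open>\<langle>(H - i \<kappa> \<lambda>) u, u\<rangle>\<close>, the second by the imaginary part of \<open>\<langle>(H - i \<kappa> \<lambda>) u, \<sigma> u\<rangle>\<close>. If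
  \<open>6 h > h0\<close>, then \<open>\<nu>\<close> is at least a multiple of \<open>1 / T\<^sub>\<nu>\<close> and \<open>\<nu> \<kappa>\<^sup>2 \<ge> \<nu>\<close> suffices.

  The bound turns into decay by multiplying \<open>g\<close> with the window \<open>sin (\<pi> (t - s) / \<tau>)\<close> on \<open>[s, s + \<tau>]\<close>
  and expanding in a Fourier series in time: Parseval's identity gives
  \<open>\<parallel>g(s + \<tau>)\<parallel> \<le> (2 \<pi> K T\<^sub>\<nu> / \<tau>) \<parallel>g(s)\<parallel>\<close>, a contraction for \<open>\<tau> = 4 \<pi> K T\<^sub>\<nu>\<close>. As solutions are only weak, all of
  this is done for truncated Fourier series in \<open>y\<close>, whose commutator with \<open>b\<close> tends to \<open>0\<close> in \<open>L\<^sup>2\<close>.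
\<close>

text \<open>A weak solution is only known to lie in L^2 at each time, so for g itself H g is not a
  function and no energy identity is available. On the frequencies up to L everything is a
  trigonometric polynomial in y, but multiplication by \<open>b\<close> leaves that space. The
  resulting defect is never differentiated: it enters as an additional L^2 source and disappears by
  dominated convergence. The order of limits is fixed: the time modes are summed completely while L
  stays fixed, and only then does L tend to infinity.

  Uniformity in \<lambda> is what the window demands. Its n-th time mode meets the resolvent at
  \<lambda> = - n / (\<tau> k), where n runs through all integers and \<tau> depends on \<nu>. In
  effect this is a quantitative Gearhart-Pruess argument: a resolvent bound along one vertical line
  gives decay of the orbit, with explicit constants and without constructing a semigroup. Uniformity
  in \<kappa> lets the x-modes be treated separately and summed by Parseval at the end. Contraction
  over one window controls all times because the mass of a mode is nonincreasing.\<close>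

definition fchar :: "int \<Rightarrow> real \<Rightarrow> complex" where
  "fchar l x = cis (2 * pi * of_int l * x)"

definition fcoef :: "(real \<Rightarrow> complex) \<Rightarrow> int \<Rightarrow> complex" where
  "fcoef h l = (\<integral>x. h x * cnj (fchar l x) \<partial>circle)"

definition square_integrable :: "(real \<Rightarrow> complex) \<Rightarrow> bool" where
  "square_integrable h \<longleftrightarrow> h \<in> borel_measurable circle \<and> integrable circle (\<lambda>x. (cmod (h x))\<^sup>2)"

abbreviation sqnorm :: "(real \<Rightarrow> complex) \<Rightarrow> real" where
  "sqnorm h \<equiv> \<integral>x. (cmod (h x))\<^sup>2 \<partial>circle"

definition trig_poly :: "int set \<Rightarrow> (int \<Rightarrow> complex) \<Rightarrow> real \<Rightarrow> complex" where
  "trig_poly S a x = (\<Sum>l\<in>S. a l * fchar l x)"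

definition freqs :: "nat \<Rightarrow> int set" where
  "freqs L = {- int L..int L}"

subsection \<open>Integration over the circle\<close>

lemma space_circle [simp]: "space circle = {0..<1}"
  by (simp add: circle_def space_restrict_space)

lemma sets_circle: "sets circle = sets (restrict_space borel {0..<1::real})"
  unfolding circle_def by (rule sets_restrict_space_cong) simp

interpretation circle: finite_measure circle
  by (rule finite_measureI) (simp add: circle_def emeasure_restrict_space space_restrict_space)

lemma measure_circle [simp]: "measure circle {0..<1} = 1"
  by (simp add: circle_def measure_restrict_space)

lemma borel_measurable_circle: "f \<in> borel_measurable borel \<Longrightarrow> f \<in> borel_measurable circle"
  unfolding circle_def by (intro measurable_restrict_space1) simp

lemma measurable_circle_continuous:
  fixes f :: "real \<Rightarrow> 'b::topological_space"
  assumes "continuous_on {0..1} f"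
  shows "f \<in> borel_measurable circle"
proof -
  have "f \<in> borel_measurable (restrict_space borel {0..<1})"
    by (rule borel_measurable_continuous_on_restrict) (rule continuous_on_subset[OF assms], auto)
  then show ?thesis
    by (simp add: sets_circle cong: measurable_cong_sets)
qed

lemma integrable_circle_bounded:
  fixes f :: "real \<Rightarrow> 'b::{banach, second_countable_topology}"
  assumes "f \<in> borel_measurable circle" "\<And>x. x \<in> {0..<1} \<Longrightarrow> norm (f x) \<le> B"
  shows "integrable circle f"
  by (rule circle.integrable_const_bound[of _ B]) (use assms in \<open>auto intro!: AE_I2\<close>)

lemma integrable_circle_continuous:
  fixes f :: "real \<Rightarrow> 'b::{banach, second_countable_topology}"
  assumes "continuous_on {0..1} f"
  shows "integrable circle f"
proof -
  have "compact (f ` {0..1})"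
    by (intro compact_continuous_image assms) simp
  then obtain B where B: "\<And>z. z \<in> f ` {0..1} \<Longrightarrow> norm z \<le> B"
    using compact_imp_bounded bounded_iff by metis
  show ?thesis
    by (rule integrable_circle_bounded[of _ B]) (use assms B measurable_circle_continuous in auto)
qed

lemma integral_circle_eq:
  fixes f :: "real \<Rightarrow> 'b::euclidean_space"
  assumes "continuous_on {0..1} f"
  shows "(\<integral>x. f x \<partial>circle) = integral {0..1} f"
proof -
  have s: "set_integrable lborel {0..1} f"
    by (rule borel_integrable_atLeastAtMost') (rule assms)
  have "(\<integral>x. f x \<partial>circle) = (LINT x:{0..<1}|lborel. f x)"
    unfolding circle_def by (subst integral_restrict_space) (auto simp: set_lebesgue_integral_def)
  also have "\<dots> = (LINT x:{0..1}|lborel. f x)"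
  proof (unfold set_lebesgue_integral_def, rule integral_cong_AE)
    have "AE x in lborel. x \<noteq> (1::real)" by (rule AE_lborel_singleton)
    then show "AE x in lborel. indicator {0..<1} x *\<^sub>R f x = indicator {0..1} x *\<^sub>R f x"
      by eventually_elim (auto simp: indicator_def)
    show 1: "(\<lambda>x. indicator {0..1} x *\<^sub>R f x) \<in> borel_measurable lborel"
      using s by (simp add: set_integrable_def borel_measurable_integrable)
    have "(\<lambda>x. indicator {0..<1} x *\<^sub>R (indicator {0..1} x *\<^sub>R f x)) \<in> borel_measurable lborel"
      by (intro borel_measurable_scaleR 1) auto
    also have "(\<lambda>x. indicator {0..<1} x *\<^sub>R (indicator {0..1} x *\<^sub>R f x)) = (\<lambda>x. indicator {0..<1} x *\<^sub>R f x)"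
      by (auto simp: indicator_def fun_eq_iff)
    finally show "(\<lambda>x. indicator {0..<1} x *\<^sub>R f x) \<in> borel_measurable lborel" .
  qed
  also have "\<dots> = integral {0..1} f"
    by (rule set_borel_integral_eq_integral[OF s])
  finally show ?thesis .
qed

lemma integral_circle_derivative:
  fixes f :: "real \<Rightarrow> 'b::euclidean_space"
  assumes "continuous_on {0..1} f'"
    and "\<And>x. x \<in> {0..1} \<Longrightarrow> (f has_vector_derivative f' x) (at x within {0..1})"
  shows "(\<integral>x. f' x \<partial>circle) = f 1 - f 0"
  using fundamental_theorem_of_calculus[of 0 1 f f'] assms
  by (simp add: integral_circle_eq integral_unique)

text \<open>With an antiderivative P on the whole line, the integral over the shifted period is P (1
  + a) - P a, whose derivative in a is p (1 + a) - p a = 0.\<close>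

lemma integral_circle_shift:
  fixes p :: "real \<Rightarrow> 'b::euclidean_space"
  assumes c: "continuous_on UNIV p" and per: "periodic1 p"
  shows "(\<integral>y. p (y + a) \<partial>circle) = (\<integral>y. p y \<partial>circle)"
proof -
  define P where "P x = (if x \<ge> 0 then integral {0..x} p else - integral {x..0} p)" for x
  have P: "(P has_vector_derivative p x) (at x)" for x
  proof -
    \<comment> \<open>A base point to the left of both 0 and x makes P, near x, an indefinite
      integral up to a constant, whatever the sign of x.\<close>
    define A where "A = - \<bar>x\<bar> - 1"
    define Q where "Q u = integral {A..u} p" for u
    have int: "p integrable_on {u..v}" for u v
      by (rule integrable_continuous_real) (rule continuous_on_subset[OF c], auto)
    have QP: "P u = Q u - integral {A..0} p" if "u \<in> {A<..<\<bar>x\<bar>+1}" for u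
    proof (cases "u \<ge> 0")
      case True
      then have "integral {A..0} p + integral {0..u} p = integral {A..u} p"
        by (intro Henstock_Kurzweil_Integration.integral_combine int) (auto simp: A_def)
      with True show ?thesis by (simp add: P_def Q_def algebra_simps)
    next
      case False
      then have "integral {A..u} p + integral {u..0} p = integral {A..0} p"
        using that by (intro Henstock_Kurzweil_Integration.integral_combine int) (auto simp: A_def)
      with False show ?thesis by (simp add: P_def Q_def algebra_simps)
    qed
    have "(Q has_vector_derivative p x) (at x within {A..\<bar>x\<bar>+1})"
      unfolding Q_def by (rule integral_has_vector_derivative)
        (auto intro: continuous_on_subset[OF c] simp: A_def)
    then have "(Q has_vector_derivative p x) (at x)"
      by (subst (asm) at_within_interior) (auto simp: A_def)
    then have "((\<lambda>u. Q u - integral {A..0} p) has_vector_derivative p x) (at x)"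
      by (auto intro!: derivative_eq_intros)
    then show ?thesis
      by (rule has_vector_derivative_transform_within_open[where S="{A<..<\<bar>x\<bar>+1}"])
        (use QP in \<open>auto simp: A_def\<close>)
  qed
  have sh: "(\<integral>y. p (y + a) \<partial>circle) = P (1 + a) - P a" for a
  proof -
    have "((\<lambda>y. P (y + a)) has_vector_derivative p (y + a)) (at y within {0..1})" for y
    proof -
      have "((P \<circ> (\<lambda>y. y + a)) has_vector_derivative (1 *\<^sub>R p (y + a))) (at y)"
        by (rule vector_diff_chain_at) (auto intro!: derivative_eq_intros P)
      then show ?thesis
        by (simp add: o_def has_vector_derivative_at_within)
    qed
    then have "(\<integral>y. p (y + a) \<partial>circle) = P (1 + a) - P (0 + a)"
      by (intro integral_circle_derivative continuous_intros continuous_on_compose2[OF c]) auto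
    then show ?thesis by simp
  qed
  have "((\<lambda>a. P (1 + a) - P a) has_vector_derivative 0) (at a within UNIV)" for a
  proof -
    have "((P \<circ> (\<lambda>y. 1 + y)) has_vector_derivative (1 *\<^sub>R p (1 + a))) (at a)"
      by (rule vector_diff_chain_at) (auto intro!: derivative_eq_intros P)
    then have "((\<lambda>a. P (1 + a)) has_vector_derivative p (1 + a)) (at a)"
      by (simp add: o_def)
    from has_vector_derivative_diff[OF this P]
    show ?thesis using per unfolding periodic1_def by (metis add.commute diff_self)
  qed
  then have "P (1 + a) - P a = P (1 + 0) - P 0"
    by (intro has_derivative_zero_unique[of UNIV]) (auto simp: has_vector_derivative_def)
  then show ?thesis
    using sh[of a] sh[of 0] by simp
qed

subsection \<open>Characters\<close>

lemma cmod_fchar [simp]: "cmod (fchar l x) = 1"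
  by (simp add: fchar_def)

lemma fchar_add: "fchar (l + m) x = fchar l x * fchar m x"
  by (simp add: fchar_def cis_mult algebra_simps)

lemma fchar_zero [simp]: "fchar 0 x = 1" "fchar l 0 = 1"
  by (simp_all add: fchar_def)

lemma cnj_fchar: "cnj (fchar l x) = fchar (- l) x"
  by (simp add: fchar_def cis_cnj)

lemma fchar_shift: "fchar l (x + a) = fchar l x * fchar l a"
  by (simp add: fchar_def cis_mult algebra_simps)

lemma fchar_1 [simp]: "fchar l 1 = 1"
  unfolding fchar_def by (simp add: cis_multiple_2pi)

lemma periodic1_fchar: "periodic1 (fchar l)"
  by (simp add: periodic1_def fchar_shift)

lemma has_vector_derivative_fchar:
  "(fchar l has_vector_derivative (2 * pi * \<i> * of_int l * fchar l x)) (at x within A)"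
  unfolding fchar_def has_vector_derivative_def
  by (auto intro!: derivative_eq_intros simp: fun_eq_iff scaleR_conv_of_real algebra_simps)

lemma continuous_on_fchar [continuous_intros]:
  "continuous_on A g \<Longrightarrow> continuous_on A (\<lambda>x. fchar l (g x))"
  unfolding fchar_def cis_conv_exp by (intro continuous_intros)

lemma integral_fchar: "(\<integral>x. fchar l x \<partial>circle) = (if l = 0 then 1 else 0)"
proof (cases "l = 0")
  case True
  then show ?thesis by simp
next
  case False
  have "(\<integral>x. 2 * pi * \<i> * of_int l * fchar l x \<partial>circle) = fchar l 1 - fchar l 0"
    by (intro integral_circle_derivative continuous_intros has_vector_derivative_fchar)
  then show ?thesis using False by simp
qed

lemma fchar_orthonormal:
  "(\<integral>x. fchar l x * cnj (fchar m x) \<partial>circle) = (if l = m then 1 else 0)"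
proof -
  have "fchar l x * cnj (fchar m x) = fchar (l - m) x" for x
    by (simp add: cnj_fchar flip: fchar_add)
  then show ?thesis by (simp add: integral_fchar)
qed

subsection \<open>Square-integrable functions\<close>

lemma norm_add_sq_le:
  fixes a b :: "'a::real_normed_vector"
  assumes "\<epsilon> > 0"
  shows "(norm (a + b))\<^sup>2 \<le> (1 + \<epsilon>) * (norm a)\<^sup>2 + (1 + 1 / \<epsilon>) * (norm b)\<^sup>2"
proof -
  have "(norm (a + b))\<^sup>2 \<le> (norm a + norm b)\<^sup>2"
    by (intro power_mono norm_triangle_ineq) auto
  moreover have "0 \<le> (\<epsilon> * norm a - norm b)\<^sup>2 / \<epsilon>"
    using assms by simp
  moreover have "(\<epsilon> * norm a - norm b)\<^sup>2 / \<epsilon> = \<epsilon> * (norm a)\<^sup>2 - 2 * norm a * norm b + (norm b)\<^sup>2 / \<epsilon>"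
    using assms by (simp add: field_simps power2_eq_square)
  ultimately show ?thesis by (simp add: power2_sum algebra_simps)
qed

lemma norm_diff_sq_le2:
  fixes a b :: "'a::real_normed_vector"
  shows "(norm (a - b))\<^sup>2 \<le> 2 * (norm a)\<^sup>2 + 2 * (norm b)\<^sup>2"
  using norm_add_sq_le[of 1 a "- b"] by simp

lemma norm_add_sq_le2:
  fixes a b :: "'a::real_normed_vector"
  shows "(norm (a + b))\<^sup>2 \<le> 2 * (norm a)\<^sup>2 + 2 * (norm b)\<^sup>2"
  using norm_add_sq_le[of 1 a b] by simp

lemma norm_mult_le_sum_sq:
  fixes a b :: "'a::real_normed_algebra_1"
  shows "norm (a * b) \<le> (norm a)\<^sup>2 + (norm b)\<^sup>2"
proof -
  have "0 \<le> (norm a - norm b)\<^sup>2" by simp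
  then have "norm a * norm b \<le> (norm a)\<^sup>2 + (norm b)\<^sup>2"
    unfolding power2_diff using mult_nonneg_nonneg[OF norm_ge_zero[of a] norm_ge_zero[of b]] by linarith
  then show ?thesis
    using norm_mult_ineq[of a b] by linarith
qed

lemma square_integrableI_bounded:
  assumes "h \<in> borel_measurable circle" "\<And>x. x \<in> {0..<1} \<Longrightarrow> cmod (h x) \<le> B"
  shows "square_integrable h"
  unfolding square_integrable_def
  by (intro conjI assms integrable_circle_bounded[of _ "B\<^sup>2"])
    (use assms in \<open>auto intro!: power_mono borel_measurable_power borel_measurable_norm\<close>)

lemma square_integrable_continuous:
  "continuous_on {0..1} h \<Longrightarrow> square_integrable h"
  unfolding square_integrable_def
  by (intro conjI measurable_circle_continuous integrable_circle_continuous continuous_intros)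

lemma square_integrable_measurable: "square_integrable h \<Longrightarrow> h \<in> borel_measurable circle"
  by (simp add: square_integrable_def)

lemma square_integrable_mult_integrable:
  assumes "square_integrable f" "square_integrable g"
  shows "integrable circle (\<lambda>x. f x * g x)"
proof (rule Bochner_Integration.integrable_bound)
  show "integrable circle (\<lambda>x. (cmod (f x))\<^sup>2 + (cmod (g x))\<^sup>2)"
    using assms by (auto simp: square_integrable_def)
  show "(\<lambda>x. f x * g x) \<in> borel_measurable circle"
    using assms by (auto simp: square_integrable_def)
  show "AE x in circle. norm (f x * g x) \<le> norm ((cmod (f x))\<^sup>2 + (cmod (g x))\<^sup>2)"
    using norm_mult_le_sum_sq by (intro AE_I2) simp
qed

lemma square_integrable_add:
  assumes "square_integrable f" "square_integrable g"
  shows "square_integrable (\<lambda>x. f x + g x)"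
  unfolding square_integrable_def
proof
  show m: "(\<lambda>x. f x + g x) \<in> borel_measurable circle"
    using assms by (auto simp: square_integrable_def)
  show "integrable circle (\<lambda>x. (cmod (f x + g x))\<^sup>2)"
  proof (rule Bochner_Integration.integrable_bound)
    show "integrable circle (\<lambda>x. 2 * (cmod (f x))\<^sup>2 + 2 * (cmod (g x))\<^sup>2)"
      using assms by (auto simp: square_integrable_def)
    show "(\<lambda>x. (cmod (f x + g x))\<^sup>2) \<in> borel_measurable circle"
      using m by simp
    show "AE x in circle. norm ((cmod (f x + g x))\<^sup>2) \<le> norm (2 * (cmod (f x))\<^sup>2 + 2 * (cmod (g x))\<^sup>2)"
      using norm_add_sq_le2 by (intro AE_I2) simp
  qed
qed

lemma square_integrable_mult_bounded:
  assumes "square_integrable f" "m \<in> borel_measurable circle" "\<And>x. x \<in> {0..<1} \<Longrightarrow> cmod (m x) \<le> B"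
  shows "square_integrable (\<lambda>x. m x * f x)"
  unfolding square_integrable_def
proof
  show m: "(\<lambda>x. m x * f x) \<in> borel_measurable circle"
    using assms by (auto simp: square_integrable_def)
  show "integrable circle (\<lambda>x. (cmod (m x * f x))\<^sup>2)"
  proof (rule Bochner_Integration.integrable_bound)
    show "integrable circle (\<lambda>x. B\<^sup>2 * (cmod (f x))\<^sup>2)"
      using assms by (auto simp: square_integrable_def)
    show "(\<lambda>x. (cmod (m x * f x))\<^sup>2) \<in> borel_measurable circle"
      using m by simp
    show "AE x in circle. norm ((cmod (m x * f x))\<^sup>2) \<le> norm (B\<^sup>2 * (cmod (f x))\<^sup>2)"
      by (intro AE_I2) (use assms(3) in \<open>auto simp: norm_mult power_mult_distrib intro!: mult_right_mono power_mono\<close>)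
  qed
qed

lemma square_integrable_cmult:
  "square_integrable f \<Longrightarrow> square_integrable (\<lambda>x. c * f x)"
  by (rule square_integrable_mult_bounded[of f _ "cmod c"]) auto

lemma square_integrable_diff:
  assumes "square_integrable f" "square_integrable g"
  shows "square_integrable (\<lambda>x. f x - g x)"
  using square_integrable_add[OF assms(1) square_integrable_cmult[OF assms(2), of "-1"]] by simp

lemma square_integrable_cnj: "square_integrable f \<Longrightarrow> square_integrable (\<lambda>x. cnj (f x))"
  unfolding square_integrable_def
  by (auto intro: borel_measurable_continuous_on[OF continuous_on_cnj[OF continuous_on_id]])

lemma square_integrable_norm: "square_integrable f \<Longrightarrow> integrable circle (\<lambda>x. (cmod (f x))\<^sup>2)"
  by (simp add: square_integrable_def)

lemma square_integrable_fchar: "square_integrable (fchar l)"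
  by (intro square_integrable_continuous continuous_intros)

lemma square_integrable_cnj_fchar: "square_integrable (\<lambda>x. cnj (fchar l x))"
  by (intro square_integrable_continuous continuous_intros)

lemma integrable_fcoef:
  "square_integrable h \<Longrightarrow> integrable circle (\<lambda>x. h x * cnj (fchar l x))"
  by (intro square_integrable_mult_integrable square_integrable_cnj_fchar)

subsection \<open>Trigonometric polynomials and Bessel's inequality\<close>

lemma continuous_on_trig_poly [continuous_intros]:
  "continuous_on A g \<Longrightarrow> continuous_on A (\<lambda>x. trig_poly S a (g x))"
  unfolding trig_poly_def by (intro continuous_intros)

lemma square_integrable_trig_poly: "square_integrable (trig_poly S a)"
  by (intro square_integrable_continuous continuous_intros)

lemma fcoef_trig_poly:
  assumes "finite S"
  shows "fcoef (trig_poly S a) l = (if l \<in> S then a l else 0)"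
proof -
  have "fcoef (trig_poly S a) l = (\<integral>x. (\<Sum>m\<in>S. a m * (fchar m x * cnj (fchar l x))) \<partial>circle)"
    by (simp add: fcoef_def trig_poly_def sum_distrib_right mult.assoc)
  also have "\<dots> = (\<Sum>m\<in>S. a m * (if m = l then 1 else 0))"
    by (subst Bochner_Integration.integral_sum)
      (auto simp: fchar_orthonormal intro!: integrable_mult_right integrable_fcoef square_integrable_fchar sum.cong)
  also have "\<dots> = (if l \<in> S then a l else 0)"
    using assms by (simp add: if_distrib cong: if_cong)
  finally show ?thesis .
qed

lemma integral_mult_cnj_trig_poly:
  assumes "square_integrable h"
  shows "(\<integral>x. h x * cnj (trig_poly S a x) \<partial>circle) = (\<Sum>l\<in>S. cnj (a l) * fcoef h l)"
proof -
  have "(\<integral>x. h x * cnj (trig_poly S a x) \<partial>circle)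
      = (\<integral>x. (\<Sum>l\<in>S. cnj (a l) * (h x * cnj (fchar l x))) \<partial>circle)"
    by (simp add: trig_poly_def sum_distrib_left mult_ac)
  also have "\<dots> = (\<Sum>l\<in>S. cnj (a l) * fcoef h l)"
    by (subst Bochner_Integration.integral_sum)
      (auto simp: fcoef_def intro!: integrable_mult_right integrable_fcoef assms)
  finally show ?thesis .
qed

lemma integral_trig_poly_sq:
  assumes "finite S"
  shows "sqnorm (trig_poly S a) = (\<Sum>l\<in>S. (cmod (a l))\<^sup>2)"
proof -
  have "complex_of_real (sqnorm (trig_poly S a))
      = (\<integral>x. trig_poly S a x * cnj (trig_poly S a x) \<partial>circle)"
    by (simp only: integral_complex_of_real complex_norm_square[symmetric])
  also have "\<dots> = (\<Sum>l\<in>S. cnj (a l) * a l)"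
    by (subst integral_mult_cnj_trig_poly) (auto simp: square_integrable_trig_poly fcoef_trig_poly assms)
  also have "\<dots> = complex_of_real (\<Sum>l\<in>S. (cmod (a l))\<^sup>2)"
    by (simp add: mult.commute flip: complex_norm_square)
  finally show ?thesis by (simp only: of_real_eq_iff)
qed

text \<open>Completing the square in each coefficient. For \<open>a = fcoef h\<close> the last sum
  vanishes, which yields Bessel's inequality; for any other \<open>a\<close> it is the excess over
  the best approximation, which is what completeness exploits.\<close>

lemma integral_diff_trig_poly_sq:
  assumes h: "square_integrable h" and S: "finite S"
  shows "sqnorm (\<lambda>x. h x - trig_poly S a x) =
    sqnorm h - (\<Sum>l\<in>S. (cmod (fcoef h l))\<^sup>2) + (\<Sum>l\<in>S. (cmod (fcoef h l - a l))\<^sup>2)"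
proof -
  let ?T = "trig_poly S a"
  have i: "integrable circle (\<lambda>x. h x * cnj (?T x))" "integrable circle (\<lambda>x. (cmod (h x))\<^sup>2)"
     "integrable circle (\<lambda>x. (cmod (?T x))\<^sup>2)"
    by (intro square_integrable_mult_integrable square_integrable_norm h square_integrable_cnj square_integrable_trig_poly)+
  have iR: "integrable circle (\<lambda>x. Re (h x * cnj (?T x)))"
    using i(1) by (rule integrable_Re)
  define P where "P x = Re (h x * cnj (?T x))" for x
  have P: "integrable circle P" "integral\<^sup>L circle P = Re (\<integral>x. h x * cnj (?T x) \<partial>circle)"
    unfolding P_def using iR integral_Re[OF i(1)] by auto
  have "(cmod (h x - ?T x))\<^sup>2 = (cmod (h x))\<^sup>2 - 2 * P x + (cmod (?T x))\<^sup>2" for x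
    unfolding cmod_power2 P_def by (simp add: algebra_simps power2_eq_square)
  then have "sqnorm (\<lambda>x. h x - ?T x) = sqnorm h
      - 2 * Re (\<integral>x. h x * cnj (?T x) \<partial>circle) + (\<Sum>l\<in>S. (cmod (a l))\<^sup>2)"
    using i P by (simp add: integral_trig_poly_sq[OF S])
  also have "\<dots> = sqnorm h + (\<Sum>l\<in>S. (cmod (a l))\<^sup>2 - 2 * Re (cnj (a l) * fcoef h l))"
    by (simp add: integral_mult_cnj_trig_poly[OF h] sum_subtractf sum_distrib_left)
  also have "(\<Sum>l\<in>S. (cmod (a l))\<^sup>2 - 2 * Re (cnj (a l) * fcoef h l))
      = (\<Sum>l\<in>S. (cmod (fcoef h l - a l))\<^sup>2 - (cmod (fcoef h l))\<^sup>2)"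
    unfolding cmod_power2 by (intro sum.cong) (simp_all add: algebra_simps power2_eq_square)
  finally show ?thesis by (simp add: sum_subtractf)
qed

lemma bessel:
  assumes "square_integrable h" "finite S"
  shows "(\<Sum>l\<in>S. (cmod (fcoef h l))\<^sup>2) \<le> sqnorm h"
proof -
  have "0 \<le> sqnorm (\<lambda>x. h x - trig_poly S (fcoef h) x)"
    by simp
  then show ?thesis
    by (simp add: integral_diff_trig_poly_sq[OF assms])
qed

lemma finite_freqs [simp]: "finite (freqs L)"
  by (simp add: freqs_def)

lemma finite_subset_freqs:
  assumes "finite S"
  shows "\<exists>L. S \<subseteq> freqs L"
proof -
  have "\<forall>l\<in>S. nat \<bar>l\<bar> \<le> Max ((\<lambda>l. nat \<bar>l\<bar>) ` S)"
    using assms by auto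
  then have "S \<subseteq> freqs (Max ((\<lambda>l. nat \<bar>l\<bar>) ` S))"
    by (force simp: freqs_def)
  then show ?thesis ..
qed

lemma freqs_mono: "L \<le> M \<Longrightarrow> freqs L \<subseteq> freqs M"
  by (auto simp: freqs_def)

subsection \<open>Completeness of the trigonometric system\<close>

definition is_trig :: "(real \<Rightarrow> complex) \<Rightarrow> bool" where
  "is_trig h \<longleftrightarrow> (\<exists>S a. finite S \<and> h = trig_poly S a)"

lemma trig_poly_extend:
  assumes "finite S'" "S \<subseteq> S'"
  shows "trig_poly S a = trig_poly S' (\<lambda>l. if l \<in> S then a l else 0)"
proof
  show "trig_poly S a x = trig_poly S' (\<lambda>l. if l \<in> S then a l else 0) x" for x
    unfolding trig_poly_def by (rule sum.mono_neutral_cong_left) (use assms in auto)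
qed

lemma is_trig_add:
  assumes "is_trig f" "is_trig g" shows "is_trig (\<lambda>x. f x + g x)"
proof -
  obtain S a S' a' where *: "finite S" "f = trig_poly S a" "finite S'" "g = trig_poly S' a'"
    using assms unfolding is_trig_def by blast
  have "(\<lambda>x. f x + g x) = trig_poly (S \<union> S') (\<lambda>l. (if l \<in> S then a l else 0) + (if l \<in> S' then a' l else 0))"
    using trig_poly_extend[of "S \<union> S'" S a] trig_poly_extend[of "S \<union> S'" S' a'] *
    by (auto simp: trig_poly_def fun_eq_iff sum.distrib distrib_right)
  then show ?thesis unfolding is_trig_def using * by blast
qed

lemma is_trig_fchar: "is_trig (\<lambda>x. c * fchar l x)"
  unfolding is_trig_def by (rule exI[of _ "{l}"], rule exI[of _ "\<lambda>_. c"]) (auto simp: trig_poly_def)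

lemma is_trig_const: "is_trig (\<lambda>x. c)"
  using is_trig_fchar[of c 0] by simp

lemma is_trig_sum: "finite S \<Longrightarrow> (\<And>l. l \<in> S \<Longrightarrow> is_trig (f l)) \<Longrightarrow> is_trig (\<lambda>x. \<Sum>l\<in>S. f l x)"
  by (induction S rule: finite_induct) (auto intro: is_trig_add is_trig_const)

lemma is_trig_mult:
  assumes "is_trig f" "is_trig g" shows "is_trig (\<lambda>x. f x * g x)"
proof -
  obtain S a S' a' where *: "finite S" "f = trig_poly S a" "finite S'" "g = trig_poly S' a'"
    using assms unfolding is_trig_def by blast
  have "(\<lambda>x. f x * g x) = (\<lambda>x. \<Sum>l\<in>S. \<Sum>m\<in>S'. (a l * a' m) * fchar (l + m) x)"
    unfolding * trig_poly_def sum_product fchar_add by (simp add: mult_ac)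
  moreover have "is_trig (\<lambda>x. \<Sum>l\<in>S. \<Sum>m\<in>S'. (a l * a' m) * fchar (l + m) x)"
    using * by (intro is_trig_sum is_trig_fchar) auto
  ultimately show ?thesis by simp
qed

lemma is_trig_square_integrable: "is_trig f \<Longrightarrow> square_integrable f"
  unfolding is_trig_def using square_integrable_trig_poly by auto

text \<open>A real-linear functional on the plane is a combination of z and its conjugate, and on
  the unit circle these are \<open>fchar 1\<close> and \<open>fchar (-1)\<close>; sums and products
  stay within trigonometric polynomials.\<close>

lemma is_trig_real_polynomial:
  assumes "real_polynomial_function p"
  shows "is_trig (\<lambda>x. of_real (p (fchar 1 x)))"
  using assms
proof (induction rule: real_polynomial_function.induct)
  case (linear f)
  interpret f: bounded_linear f by fact
  have "complex_of_real (f z) = ((f 1 - \<i> * f \<i>) / 2) * z + ((f 1 + \<i> * f \<i>) / 2) * cnj z" for z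
  proof -
    have "z = Re z *\<^sub>R 1 + Im z *\<^sub>R \<i>"
      by (simp add: complex_eq_iff)
    then have "f z = f (Re z *\<^sub>R 1 + Im z *\<^sub>R \<i>)"
      by (rule arg_cong)
    also have "\<dots> = Re z * f 1 + Im z * f \<i>"
      by (simp add: f.add f.scaleR)
    finally show ?thesis
      by (simp add: complex_eq_iff field_simps)
  qed
  from this[of "fchar 1 x" for x] have eq: "(\<lambda>x. complex_of_real (f (fchar 1 x))) =
      (\<lambda>x. ((f 1 - \<i> * f \<i>) / 2) * fchar 1 x + ((f 1 + \<i> * f \<i>) / 2) * fchar (-1) x)"
    unfolding cnj_fchar by (rule ext)
  show ?case
    unfolding eq by (rule is_trig_add[OF is_trig_fchar is_trig_fchar])
qed (auto intro: is_trig_const is_trig_add is_trig_mult)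

text \<open>Stone-Weierstrass on the unit circle in the plane: \<open>g 0 = g 1\<close> is exactly
  what lets \<open>g\<close> factor through \<open>fchar 1\<close>.\<close>

lemma uniform_trig_approx:
  fixes g :: "real \<Rightarrow> real"
  assumes g: "continuous_on {0..1} g" "g 0 = g 1" and \<epsilon>: "\<epsilon> > 0"
  shows "\<exists>T. is_trig T \<and> (\<forall>x\<in>{0..1}. cmod (of_real (g x) - T x) < \<epsilon>)"
proof -
  let ?q = "fchar 1"
  define K where "K = ?q ` {0..1}"
  define q' where "q' z = (SOME x. x \<in> {0..1} \<and> ?q x = z)" for z
  have q': "q' z \<in> {0..1} \<and> ?q (q' z) = z" if "z \<in> K" for z
    unfolding q'_def by (rule someI_ex) (use that in \<open>auto simp: K_def\<close>)
  define G where "G z = g (q' z)" for z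
  \<comment> \<open>Two parameters with the same image either coincide or are the two ends of the
    interval.\<close>
  have inj: "g x = g y" if "x \<in> {0..1}" "y \<in> {0..1}" "?q x = ?q y" for x y
  proof -
    have "cis (2 * pi * (x - y)) = 1"
      using that(3) unfolding fchar_def by (simp add: right_diff_distrib cis_divide[symmetric])
    then obtain n :: int where "2 * pi * (x - y) = of_int n * 2 * pi"
      unfolding complex_eq_iff cis.simps one_complex.simps cos_one_2pi_int by blast
    then have "x - y = of_int n" by simp
    moreover have "\<bar>x - y\<bar> \<le> 1" using that by auto
    ultimately have "x - y = 0 \<or> x - y = 1 \<or> x - y = -1"
      by (cases "n = 0"; cases "n = 1"; cases "n = -1") auto
    then show ?thesis
      using that g(2) by (smt (verit) atLeastAtMost_iff)
  qed
  have Gq: "G (?q x) = g x" if "x \<in> {0..1}" for x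
    unfolding G_def using q'[of "?q x"] that by (intro inj) (auto simp: K_def)
  have "compact K"
    unfolding K_def by (intro compact_continuous_image continuous_intros) simp
  \<comment> \<open>\<open>?q\<close> maps compact sets to compact sets, so preimages under
    \<open>G\<close> are images of closed subsets of the interval; no continuous inverse of
    \<open>?q\<close> is involved.\<close>
  have "closed (G -` B \<inter> K)" if "closed B" for B
  proof -
    have "G -` B \<inter> K = ?q ` ({0..1} \<inter> g -` B)"
      unfolding K_def using Gq by auto
    moreover have "compact ({0..1} \<inter> g -` B)"
    proof -
      have "closed ({0..1} \<inter> g -` B)"
        using continuous_closed_preimage[OF g(1) _ that] by simp
      then have "compact ({0..1} \<inter> ({0..1} \<inter> g -` B))"
        by (intro compact_Int_closed) auto
      then show ?thesis by (simp add: Int_assoc[symmetric])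
    qed
    ultimately show ?thesis
      by (auto intro!: compact_imp_closed compact_continuous_image continuous_intros)
  qed
  then have "continuous_on K G"
    using \<open>compact K\<close> by (subst continuous_on_closed_vimage) (auto intro: compact_imp_closed)
  then obtain p where p: "real_polynomial_function p" "\<And>z. z \<in> K \<Longrightarrow> \<bar>G z - p z\<bar> < \<epsilon>"
    using Stone_Weierstrass_real_polynomial_function[OF \<open>compact K\<close> _ \<epsilon>] by metis
  have "cmod (of_real (g x) - of_real (p (?q x))) < \<epsilon>" if "x \<in> {0..1}" for x
    using p(2)[of "?q x"] Gq[OF that] that by (auto simp: K_def simp flip: of_real_diff)
  with is_trig_real_polynomial[OF p(1)] show ?thesis by blast
qed

definition trig_approximable :: "(real \<Rightarrow> complex) \<Rightarrow> bool" where
  "trig_approximable h \<longleftrightarrow> (\<forall>\<epsilon>>0. \<exists>T. is_trig T \<and> sqnorm (\<lambda>x. h x - T x) < \<epsilon>)"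

lemma integral_sq_diff_triangle:
  assumes "square_integrable f" "square_integrable g" "square_integrable h"
  shows "sqnorm (\<lambda>x. f x - h x)
    \<le> 2 * sqnorm (\<lambda>x. f x - g x) + 2 * sqnorm (\<lambda>x. g x - h x)"
proof -
  have i: "integrable circle (\<lambda>x. (cmod (f x - h x))\<^sup>2)" "integrable circle (\<lambda>x. (cmod (f x - g x))\<^sup>2)"
     "integrable circle (\<lambda>x. (cmod (g x - h x))\<^sup>2)"
    by (intro square_integrable_norm square_integrable_diff assms)+
  have "sqnorm (\<lambda>x. f x - h x) \<le>
      (\<integral>x. 2 * (cmod (f x - g x))\<^sup>2 + 2 * (cmod (g x - h x))\<^sup>2 \<partial>circle)"
    using i norm_add_sq_le2[of "f x - g x" "g x - h x" for x] by (intro integral_mono) auto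
  then show ?thesis using i by simp
qed

lemma trig_approximable_limit:
  assumes h: "square_integrable h"
    and H: "\<And>n. square_integrable (H n)" "\<And>n::nat. trig_approximable (H n)"
    and lim: "(\<lambda>n. \<integral>x. (cmod (h x - H n x))\<^sup>2 \<partial>circle) \<longlonglongrightarrow> 0"
  shows "trig_approximable h"
  unfolding trig_approximable_def
proof (intro allI impI)
  fix \<epsilon> :: real assume "\<epsilon> > 0"
  then obtain n where n: "sqnorm (\<lambda>x. h x - H n x) < \<epsilon> / 4"
    using order_tendstoD(2)[OF lim, of "\<epsilon> / 4"] by (auto simp: eventually_sequentially)
  obtain T where T: "is_trig T" "sqnorm (\<lambda>x. H n x - T x) < \<epsilon> / 4"
    using H(2)[of n] \<open>\<epsilon> > 0\<close> unfolding trig_approximable_def by (metis divide_pos_pos zero_less_numeral)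
  have "sqnorm (\<lambda>x. h x - T x) < \<epsilon>"
    using integral_sq_diff_triangle[OF h H(1)[of n] is_trig_square_integrable[OF T(1)]] n T(2) by simp
  with T(1) show "\<exists>T. is_trig T \<and> sqnorm (\<lambda>x. h x - T x) < \<epsilon>" by blast
qed

lemma trig_approximable_add:
  assumes "square_integrable f" "square_integrable g" "trig_approximable f" "trig_approximable g"
  shows "trig_approximable (\<lambda>x. f x + c * g x)"
  unfolding trig_approximable_def
proof (intro allI impI)
  fix \<epsilon> :: real assume e: "\<epsilon> > 0"
  define d where "d = 4 * (1 + (cmod c)\<^sup>2)"
  have d: "d > 0" unfolding d_def by (smt (verit) zero_le_power2)
  obtain T1 where T1: "is_trig T1" "sqnorm (\<lambda>x. f x - T1 x) < \<epsilon> / d"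
    using assms(3) e d unfolding trig_approximable_def by (metis divide_pos_pos)
  obtain T2 where T2: "is_trig T2" "sqnorm (\<lambda>x. g x - T2 x) < \<epsilon> / d"
    using assms(4) e d unfolding trig_approximable_def by (metis divide_pos_pos)
  let ?T = "\<lambda>x. T1 x + c * T2 x"
  have T: "is_trig ?T"
    by (intro is_trig_add is_trig_mult T1 T2 is_trig_const)
  note sq = is_trig_square_integrable[OF T1(1)] is_trig_square_integrable[OF T2(1)]
  have i: "integrable circle (\<lambda>x. (cmod (f x + c * g x - ?T x))\<^sup>2)" "integrable circle (\<lambda>x. (cmod (f x - T1 x))\<^sup>2)"
     "integrable circle (\<lambda>x. (cmod (g x - T2 x))\<^sup>2)"
    by (intro square_integrable_norm square_integrable_diff square_integrable_add square_integrable_cmult assms sq)+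
  have "sqnorm (\<lambda>x. f x + c * g x - ?T x) \<le>
      (\<integral>x. 2 * (cmod (f x - T1 x))\<^sup>2 + 2 * ((cmod c)\<^sup>2 * (cmod (g x - T2 x))\<^sup>2) \<partial>circle)"
  proof (intro integral_mono)
    fix x
    have *: "f x + c * g x - ?T x = (f x - T1 x) + c * (g x - T2 x)" by (simp add: algebra_simps)
    show "(cmod (f x + c * g x - ?T x))\<^sup>2 \<le> 2 * (cmod (f x - T1 x))\<^sup>2 + 2 * ((cmod c)\<^sup>2 * (cmod (g x - T2 x))\<^sup>2)"
      unfolding * using norm_add_sq_le2[of "f x - T1 x" "c * (g x - T2 x)"] by (simp add: norm_mult power_mult_distrib)
  qed (use i in auto)
  also have "\<dots> = 2 * sqnorm (\<lambda>x. f x - T1 x) + 2 * (cmod c)\<^sup>2 * sqnorm (\<lambda>x. g x - T2 x)"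
    using i by simp
  also have "\<dots> \<le> 2 * (\<epsilon> / d) + 2 * (cmod c)\<^sup>2 * (\<epsilon> / d)"
    using T1(2) T2(2) by (intro add_mono mult_left_mono) auto
  also have "\<dots> = (d / 2) * (\<epsilon> / d)"
    by (simp add: d_def algebra_simps add_divide_distrib)
  also have "\<dots> = \<epsilon> / 2"
    using d by simp
  also have "\<dots> < \<epsilon>" using e by simp
  finally show "\<exists>T. is_trig T \<and> sqnorm (\<lambda>x. f x + c * g x - T x) < \<epsilon>"
    using T by blast
qed

lemma trig_approximable_continuous:
  fixes g :: "real \<Rightarrow> real"
  assumes g: "continuous_on {0..1} g" "g 0 = g 1"
  shows "trig_approximable (\<lambda>x. of_real (g x))"
  unfolding trig_approximable_def
proof (intro allI impI)
  fix \<epsilon> :: real assume e: "\<epsilon> > 0"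
  obtain T where T: "is_trig T" "\<And>x. x \<in> {0..1} \<Longrightarrow> cmod (of_real (g x) - T x) < sqrt (\<epsilon> / 2)"
    using uniform_trig_approx[OF g, of "sqrt (\<epsilon> / 2)"] e by auto
  have "square_integrable (\<lambda>x. of_real (g x) - T x)"
    by (intro square_integrable_diff square_integrable_continuous is_trig_square_integrable T continuous_intros g)
  then have "sqnorm (\<lambda>x. of_real (g x) - T x) \<le> (\<integral>x. \<epsilon> / 2 \<partial>circle)"
  proof (intro integral_mono square_integrable_norm)
    fix x assume "x \<in> space circle"
    then have "(cmod (of_real (g x) - T x))\<^sup>2 \<le> (sqrt (\<epsilon> / 2))\<^sup>2"
      by (intro power_mono less_imp_le[OF T(2)]) auto
    then show "(cmod (of_real (g x) - T x))\<^sup>2 \<le> \<epsilon> / 2" using e by simp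
  qed auto
  also have "\<dots> < \<epsilon>" using e by simp
  finally show "\<exists>T. is_trig T \<and> sqnorm (\<lambda>x. of_real (g x) - T x) < \<epsilon>"
    using T(1) by blast
qed

text \<open>A measurable function is an almost everywhere limit of continuous ones; clamping these
  to [-B, B] supplies the dominating constant.\<close>

lemma trig_approximable_bounded:
  fixes h :: "real \<Rightarrow> real"
  assumes h: "h \<in> borel_measurable circle" and B: "\<And>x. x \<in> {0..<1} \<Longrightarrow> \<bar>h x\<bar> \<le> B"
  shows "trig_approximable (\<lambda>x. of_real (h x))"
proof -
  have B0: "B \<ge> 0" using B[of 0] by auto
  define H where "H x = indicator {0..<1} x *\<^sub>R h x" for x
  have "H \<in> borel_measurable lborel"
    using h unfolding circle_def H_def by (subst (asm) borel_measurable_restrict_space_iff) auto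
  then have "H measurable_on UNIV"
    by (intro lebesgue_measurable_imp_measurable_on_real measurable_completion) auto
  then obtain N g where N: "negligible N" and g: "\<And>n. continuous_on UNIV (g n)"
    and lim: "\<And>x. x \<notin> N \<Longrightarrow> (\<lambda>n. g n x) \<longlonglongrightarrow> H x"
    unfolding measurable_on_def by auto
  \<comment> \<open>The factor vanishes at 0 and 1, which makes the approximants periodic, and it is
    eventually 1 at each interior point.\<close>
  define \<eta> where "\<eta> n x = min 1 (real n * min x (1 - x))" for n and x :: real
  define G where "G n x = \<eta> n x * max (- B) (min B (g n x))" for n x
  have G: "continuous_on {0..1} (G n)" "G n 0 = G n 1" for n
    unfolding G_def \<eta>_def
    by (intro continuous_intros continuous_on_subset[OF g]) (auto simp: min_def)
  have Gb: "\<bar>G n x\<bar> \<le> B" if "x \<in> {0..<1}" for n x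
  proof -
    have "0 \<le> \<eta> n x" "\<eta> n x \<le> 1" using that by (auto simp: \<eta>_def)
    moreover have "\<bar>max (- B) (min B (g n x))\<bar> \<le> B" using B0 by auto
    ultimately have "\<bar>\<eta> n x\<bar> * \<bar>max (- B) (min B (g n x))\<bar> \<le> 1 * B"
      by (intro mult_mono) auto
    then show ?thesis by (simp add: G_def abs_mult)
  qed
  have Glim: "(\<lambda>n. G n x) \<longlonglongrightarrow> h x" if x: "x \<notin> N" "x \<in> {0<..<1}" for x
  proof -
    have "min x (1 - x) > 0" using x by auto
    then obtain n0 where n0: "1 < real n0 * min x (1 - x)"
      using ex_less_of_nat_mult by blast
    have "\<eta> n x = 1" if "n \<ge> n0" for n
    proof -
      have "real n0 * min x (1 - x) \<le> real n * min x (1 - x)"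
        using that \<open>min x (1 - x) > 0\<close> by (intro mult_right_mono) auto
      with n0 show ?thesis by (simp add: \<eta>_def)
    qed
    then have "(\<lambda>n. \<eta> n x) \<longlonglongrightarrow> 1"
      by (intro tendsto_eventually) (auto simp: eventually_sequentially)
    moreover have "(\<lambda>n. max (- B) (min B (g n x))) \<longlonglongrightarrow> max (- B) (min B (H x))"
      by (intro tendsto_intros lim x)
    moreover have "max (- B) (min B (H x)) = h x"
      using B[of x] x by (auto simp: H_def)
    ultimately show ?thesis
      unfolding G_def using tendsto_mult by fastforce
  qed
  have ae: "AE x in circle. x \<notin> N \<and> x \<in> {0<..<1}"
  proof -
    have "AE x in lebesgue. x \<notin> N"
      using N by (auto simp: negligible_iff_null_sets intro: AE_not_in)
    then have "AE x in lborel. x \<notin> N"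
      by (simp add: AE_completion_iff)
    moreover have "AE x in lborel. x \<noteq> (0::real)" by (rule AE_lborel_singleton)
    ultimately show ?thesis
      unfolding circle_def by (subst AE_restrict_space_iff) auto
  qed
  have hs: "square_integrable (\<lambda>x. of_real (h x))"
    by (rule square_integrableI_bounded[of _ B]) (use h B in auto)
  show ?thesis
  proof (rule trig_approximable_limit[OF hs])
    show gs: "square_integrable (\<lambda>x. of_real (G n x))" "trig_approximable (\<lambda>x. of_real (G n x))" for n
      by (intro square_integrable_continuous trig_approximable_continuous continuous_intros G)+
    have "(\<lambda>n. \<integral>x. (cmod (of_real (h x) - of_real (G n x)))\<^sup>2 \<partial>circle) \<longlonglongrightarrow> (\<integral>x. 0 \<partial>circle)"
    proof (rule integral_dominated_convergence[where w="\<lambda>_. (2 * B)\<^sup>2"])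
      show "(\<lambda>x. (cmod (of_real (h x) - of_real (G n x)))\<^sup>2) \<in> borel_measurable circle" for n
        using square_integrable_norm[OF square_integrable_diff[OF hs gs(1)]] by (rule borel_measurable_integrable)
      show "AE x in circle. (\<lambda>n. (cmod (of_real (h x) - of_real (G n x)))\<^sup>2) \<longlonglongrightarrow> 0"
        using ae
      proof eventually_elim
        case (elim x)
        have "(\<lambda>n. (cmod (of_real (h x) - of_real (G n x)))\<^sup>2) \<longlonglongrightarrow> (cmod (of_real (h x) - of_real (h x)))\<^sup>2"
          by (intro tendsto_intros Glim) (use elim in auto)
        then show ?case by simp
      qed
      show "AE x in circle. norm ((cmod (of_real (h x) - of_real (G n x)))\<^sup>2) \<le> (2 * B)\<^sup>2" for n
      proof (intro AE_I2)
        fix x assume x: "x \<in> space circle"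
        have "\<bar>h x - G n x\<bar> \<le> 2 * B" using B[of x] Gb[of x n] x by auto
        then have "\<bar>h x - G n x\<bar>\<^sup>2 \<le> (2 * B)\<^sup>2" by (intro power_mono) auto
        then show "norm ((cmod (of_real (h x) - of_real (G n x)))\<^sup>2) \<le> (2 * B)\<^sup>2"
          by (simp flip: of_real_diff)
      qed
    qed auto
    then show "(\<lambda>n. \<integral>x. (cmod (of_real (h x) - of_real (G n x)))\<^sup>2 \<partial>circle) \<longlonglongrightarrow> 0" by simp
  qed
qed

lemma trig_approximable_real:
  fixes h :: "real \<Rightarrow> real"
  assumes hs: "square_integrable (\<lambda>x. of_real (h x))"
  shows "trig_approximable (\<lambda>x. of_real (h x))"
proof -
  have h: "h \<in> borel_measurable circle"
    using measurable_compose[OF square_integrable_measurable[OF hs] borel_measurable_Re] by simp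
  define H where "H n x = max (- real n) (min (real n) (h x))" for n x
  have Hs: "square_integrable (\<lambda>x. of_real (H n x))" for n
    by (rule square_integrableI_bounded[of _ n]) (use h in \<open>auto simp: H_def\<close>)
  show ?thesis
  proof (rule trig_approximable_limit[OF hs Hs])
    show "trig_approximable (\<lambda>x. of_real (H n x))" for n
      by (rule trig_approximable_bounded[of _ n]) (use h in \<open>auto simp: H_def\<close>)
    have "(\<lambda>n. \<integral>x. (cmod (of_real (h x) - of_real (H n x)))\<^sup>2 \<partial>circle) \<longlonglongrightarrow> (\<integral>x. 0 \<partial>circle)"
    proof (rule integral_dominated_convergence[where w="\<lambda>x. (cmod (of_real (h x)))\<^sup>2"])
      show "(\<lambda>x. (cmod (of_real (h x) - of_real (H n x)))\<^sup>2) \<in> borel_measurable circle" for n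
        using square_integrable_norm[OF square_integrable_diff[OF hs Hs]] by (rule borel_measurable_integrable)
      show "integrable circle (\<lambda>x. (cmod (of_real (h x)))\<^sup>2)"
        by (rule square_integrable_norm[OF hs])
      show "AE x in circle. (\<lambda>n. (cmod (of_real (h x) - of_real (H n x)))\<^sup>2) \<longlonglongrightarrow> 0"
      proof (intro AE_I2)
        fix x
        obtain n0 where "\<bar>h x\<bar> \<le> real n0" using real_arch_simple by blast
        then have "H n x = h x" if "n \<ge> n0" for n
          using that unfolding H_def by auto
        then show "(\<lambda>n. (cmod (of_real (h x) - of_real (H n x)))\<^sup>2) \<longlonglongrightarrow> 0"
          by (intro tendsto_eventually eventually_sequentiallyI[of n0]) auto
      qed
      show "AE x in circle. norm ((cmod (of_real (h x) - of_real (H n x)))\<^sup>2) \<le> (cmod (of_real (h x)))\<^sup>2" for n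
      proof (intro AE_I2)
        fix x
        have "\<bar>h x - H n x\<bar> \<le> \<bar>h x\<bar>" unfolding H_def by auto
        then have "\<bar>h x - H n x\<bar>\<^sup>2 \<le> \<bar>h x\<bar>\<^sup>2" by (intro power_mono) auto
        then show "norm ((cmod (of_real (h x) - of_real (H n x)))\<^sup>2) \<le> (cmod (of_real (h x)))\<^sup>2"
          by (simp flip: of_real_diff)
      qed
    qed auto
    then show "(\<lambda>n. \<integral>x. (cmod (of_real (h x) - of_real (H n x)))\<^sup>2 \<partial>circle) \<longlonglongrightarrow> 0" by simp
  qed
qed

lemma trig_approximable:
  assumes h: "square_integrable h"
  shows "trig_approximable h"
proof -
  have m: "h \<in> borel_measurable circle" and i: "integrable circle (\<lambda>x. (cmod (h x))\<^sup>2)"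
    using h by (auto simp: square_integrable_def)
  have s: "square_integrable (\<lambda>x. of_real (p (h x)))"
    if "p = Re \<or> p = Im" for p
  proof -
    have pm: "p \<in> borel_measurable borel"
      using that by auto
    then have m': "(\<lambda>x. p (h x)) \<in> borel_measurable circle"
      by (rule measurable_compose[OF m])
    have le: "\<bar>p z\<bar> \<le> cmod z" for z
      using that abs_Re_le_cmod abs_Im_le_cmod by auto
    have sq: "(p z)\<^sup>2 \<le> (cmod z)\<^sup>2" for z
      using power_mono[OF le abs_ge_zero, of z 2] by simp
    show ?thesis
      unfolding square_integrable_def
    proof
      show "integrable circle (\<lambda>x. (cmod (of_real (p (h x))))\<^sup>2)"
        by (rule Bochner_Integration.integrable_bound[OF i])
          (use m' sq in \<open>auto intro!: AE_I2\<close>)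
    qed (use m' in auto)
  qed
  have "trig_approximable (\<lambda>x. of_real (Re (h x)) + \<i> * of_real (Im (h x)))"
    by (intro trig_approximable_add trig_approximable_real s) auto
  then show ?thesis
    by (simp add: complex_eq[symmetric])
qed

text \<open>Partial sums are best approximations among polynomials with the same frequencies, so an
  approximant with frequencies in \<open>freqs L\<close> bounds the error for every later
  index.\<close>

lemma fourier_partial_sums:
  assumes h: "square_integrable h"
  shows "(\<lambda>L. \<integral>x. (cmod (h x - trig_poly (freqs L) (fcoef h) x))\<^sup>2 \<partial>circle) \<longlonglongrightarrow> 0"
proof (rule LIMSEQ_I)
  fix \<epsilon> :: real assume "\<epsilon> > 0"
  then obtain S a where S: "finite S" "sqnorm (\<lambda>x. h x - trig_poly S a x) < \<epsilon>"
    using trig_approximable[OF h] unfolding trig_approximable_def is_trig_def by blast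
  obtain L where L: "S \<subseteq> freqs L" using finite_subset_freqs[OF S(1)] by blast
  have "norm (sqnorm (\<lambda>x. h x - trig_poly (freqs M) (fcoef h) x) - 0) < \<epsilon>" if "M \<ge> L" for M
  proof -
    have "S \<subseteq> freqs M" using L freqs_mono[OF that] by blast
    then have "trig_poly S a = trig_poly (freqs M) (\<lambda>l. if l \<in> S then a l else 0)"
      by (intro trig_poly_extend) auto
    with S(2) have "sqnorm (\<lambda>x. h x - trig_poly (freqs M) (\<lambda>l. if l \<in> S then a l else 0) x) < \<epsilon>"
      by simp
    moreover have "(\<Sum>l\<in>freqs M. (cmod (fcoef h l - (if l \<in> S then a l else 0)))\<^sup>2) \<ge> 0"
      by (intro sum_nonneg) auto
    ultimately have "sqnorm h - (\<Sum>l\<in>freqs M. (cmod (fcoef h l))\<^sup>2) < \<epsilon>"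
      unfolding integral_diff_trig_poly_sq[OF h finite_freqs] by linarith
    moreover have "0 \<le> sqnorm (\<lambda>x. h x - trig_poly (freqs M) (fcoef h) x)"
      by simp
    ultimately show ?thesis
      unfolding integral_diff_trig_poly_sq[OF h finite_freqs] by simp
  qed
  then show "\<exists>no. \<forall>n\<ge>no. norm (sqnorm (\<lambda>x. h x - trig_poly (freqs n) (fcoef h) x) - 0) < \<epsilon>"
    by blast
qed

lemma parseval:
  assumes h: "square_integrable h"
  shows "(\<lambda>L. \<Sum>l\<in>freqs L. (cmod (fcoef h l))\<^sup>2) \<longlonglongrightarrow> sqnorm h"
proof -
  have "(\<lambda>L. sqnorm h - sqnorm (\<lambda>x. h x - trig_poly (freqs L) (fcoef h) x))
      \<longlonglongrightarrow> sqnorm h - 0"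
    by (intro tendsto_intros fourier_partial_sums h)
  then show ?thesis
    by (simp add: integral_diff_trig_poly_sq[OF h])
qed

subsection \<open>Sign changes of the shear profile\<close>

lemma periodic1_bounded:
  fixes g :: "real \<Rightarrow> 'a::real_normed_vector"
  assumes per: "periodic1 g" and c: "continuous_on UNIV g"
  obtains B where "\<And>y. norm (g y) \<le> B"
proof -
  have "compact (g ` {0..1})"
    by (intro compact_continuous_image continuous_on_subset[OF c]) auto
  then obtain B where B: "\<And>z. z \<in> g ` {0..1} \<Longrightarrow> norm z \<le> B"
    using compact_imp_bounded bounded_iff by metis
  have nat: "g (y + real n) = g y" for y n
  proof (induction n)
    case (Suc n)
    have "g (y + real (Suc n)) = g ((y + real n) + 1)"
      by (simp add: algebra_simps)
    with Suc show ?case using per by (simp add: periodic1_def)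
  qed simp
  have "g (y + of_int k) = g y" for y k
  proof (cases "k \<ge> 0")
    case True then show ?thesis using nat[of y "nat k"] by simp
  next
    case False then show ?thesis using nat[of "y + of_int k" "nat (- k)"] by simp
  qed
  from this[of "frac y" "\<lfloor>y\<rfloor>" for y] have "g y = g (frac y)" for y
    by (simp add: frac_def)
  moreover have "frac y \<in> {0..1}" for y :: real
    using frac_ge_0[of y] frac_lt_1[of y] by simp
  ultimately have "norm (g y) \<le> B" for y
    using B by (metis imageI)
  then show ?thesis using that by blast
qed

text \<open>The rise by p between 2h and 4h keeps at least one of these ends away from 0. Either D
  \<le> - p / 2 at 2h, and D is negative on (0, 2h), or D > p / 2 at 4h, and D is positive on (4h,
  6h). The two intervals have radius h and centres h and 5h.\<close>

lemma increasing_avoids_level: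
  fixes D :: "real \<Rightarrow> real"
  assumes mono: "strict_mono_on {0..6 * h} D" and h: "h > 0"
    and gap: "D (4 * h) - D (2 * h) \<ge> p" "p > 0"
  shows "\<exists>j\<in>{1, 5}. \<bar>D (j * h)\<bar> \<ge> p / 2 \<and> (\<forall>r. \<bar>r - j * h\<bar> < h \<longrightarrow> D r \<noteq> 0)"
proof (cases "D (2 * h) + p / 2 \<le> 0")
  case True
  have "D (1 * h) < D (2 * h)"
    using h by (intro strict_mono_onD[OF mono]) auto
  moreover have "D r < D (2 * h)" if "\<bar>r - 1 * h\<bar> < h" for r
    using h that by (intro strict_mono_onD[OF mono]) (auto simp: abs_less_iff)
  ultimately have "\<bar>D (1 * h)\<bar> \<ge> p / 2 \<and> (\<forall>r. \<bar>r - 1 * h\<bar> < h \<longrightarrow> D r \<noteq> 0)"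
    using True gap by force
  then show ?thesis by blast
next
  case False
  have "D (4 * h) < D (5 * h)"
    using h by (intro strict_mono_onD[OF mono]) auto
  moreover have "D (4 * h) < D r" if "\<bar>r - 5 * h\<bar> < h" for r
    using h that by (intro strict_mono_onD[OF mono]) (auto simp: abs_less_iff)
  ultimately have "\<bar>D (5 * h)\<bar> \<ge> p / 2 \<and> (\<forall>r. \<bar>r - 5 * h\<bar> < h \<longrightarrow> D r \<noteq> 0)"
    using False gap by force
  then show ?thesis by blast
qed

text \<open>The offsets 1 and 5 with both signs, since \<open>\<iota> y\<close> decides the
  direction. A fixed finite set allows a sum over all offsets where a choice of one depending on y
  would have to be measurable.\<close>

definition shifts :: "real set" where "shifts = {1, -1, 5, -5}"

text \<open>
  The increment condition at \<open>y + 3 \<iota>(y) h\<close>, whichever direction it points in, gives the monotone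
  function \<open>b\<close> an increment of at least \<open>p\<close> between \<open>y + 2 \<iota>(y) h\<close> and \<open>y + 4 \<iota>(y) h\<close>.
\<close>

lemma near_large_values:
  fixes b \<iota> :: "real \<Rightarrow> real"
  assumes c: "continuous_on UNIV b"
    and \<iota>: "\<And>y. \<iota> y \<in> {1, -1}"
    and inj: "\<And>y. inj_on (\<lambda>r. b (y + \<iota> y * r)) {0..6 * h}"
    and incr: "\<And>y. \<bar>b (y + \<iota> y * h) - b y\<bar> \<ge> p"
    and pos: "h > 0" "p > 0"
  shows "\<exists>j\<in>shifts. \<bar>b (y + j * h) - lam\<bar> \<ge> p / 2 \<and> (\<forall>z. b z = lam \<longrightarrow> \<bar>y + j * h - z\<bar> \<ge> h)"
proof -
  define B where "B r = b (y + \<iota> y * r)" for r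
  have "continuous_on {0..6 * h} B"
    unfolding B_def by (intro continuous_on_compose2[OF c] continuous_intros) auto
  moreover have "inj_on B {0..6 * h}"
    using inj[of y] unfolding B_def .
  ultimately have "strict_mono_on {0..6 * h} B \<or> strict_antimono_on {0..6 * h} B"
    using injective_eq_monotone_map[of "{0..6 * h}" B] is_interval_cc by blast
  then obtain s :: real where s: "s \<in> {1, -1}" and mono: "strict_mono_on {0..6 * h} (\<lambda>r. s * (B r - lam))"
  proof
    assume "strict_mono_on {0..6 * h} B"
    then show thesis by (intro that[of 1]) (auto simp: monotone_on_def)
  next
    assume "strict_antimono_on {0..6 * h} B"
    then show thesis by (intro that[of "-1"]) (auto simp: monotone_on_def)
  qed
  have i: "\<iota> z = 1 \<or> \<iota> z = -1" for z using \<iota>[of z] by auto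
  have less: "s * B (2 * h) < s * B (3 * h)" "s * B (3 * h) < s * B (4 * h)"
    using strict_mono_onD[OF mono, of "2 * h" "3 * h"] strict_mono_onD[OF mono, of "3 * h" "4 * h"] pos
    by (auto simp: algebra_simps)
  have "\<bar>B (4 * h) - B (3 * h)\<bar> \<ge> p \<or> \<bar>B (2 * h) - B (3 * h)\<bar> \<ge> p"
  proof -
    define w where "w = y + \<iota> y * (3 * h)"
    have "w + \<iota> w * h = y + \<iota> y * (4 * h) \<or> w + \<iota> w * h = y + \<iota> y * (2 * h)"
      using i[of y] i[of w] by (auto simp: w_def)
    then have "b (w + \<iota> w * h) = B (4 * h) \<or> b (w + \<iota> w * h) = B (2 * h)"
      by (auto simp: B_def)
    moreover have "b w = B (3 * h)" by (simp add: B_def w_def)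
    ultimately show ?thesis
      using incr[of w] by auto
  qed
  then have gap: "s * (B (4 * h) - lam) - s * (B (2 * h) - lam) \<ge> p"
    using less s by (auto simp: algebra_simps abs_if split: if_splits)
  obtain j where j: "j \<in> {1, 5}" "\<bar>s * (B (j * h) - lam)\<bar> \<ge> p / 2"
     "\<And>r. \<bar>r - j * h\<bar> < h \<Longrightarrow> s * (B r - lam) \<noteq> 0"
    using increasing_avoids_level[OF mono pos(1) gap pos(2)] by blast
  have "\<iota> y * j \<in> shifts" using i[of y] j(1) by (auto simp: shifts_def)
  moreover have "\<bar>b (y + (\<iota> y * j) * h) - lam\<bar> \<ge> p / 2"
    using j(2) s by (auto simp: B_def abs_mult mult.assoc)
  moreover have "\<bar>y + (\<iota> y * j) * h - z\<bar> \<ge> h" if "b z = lam" for z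
  proof (rule ccontr)
    assume *: "\<not> ?thesis"
    have "B (\<iota> y * (z - y)) = b z" using i[of y] by (auto simp: B_def)
    moreover have "\<bar>\<iota> y * (z - y) - j * h\<bar> < h" using * i[of y] by auto
    ultimately show False using j(3) that by simp
  qed
  ultimately show ?thesis by blast
qed

text \<open>The sign of b - lam changes only across a zero, where the distance factor vanishes.
  Multiplying the two therefore keeps the Lipschitz constant 1 / h of the distance factor.\<close>

lemma sign_cutoff:
  fixes b :: "real \<Rightarrow> real"
  assumes c: "continuous_on UNIV b" and per: "periodic1 b" and h: "h > 0"
  obtains \<sigma> :: "real \<Rightarrow> real" where "periodic1 \<sigma>" "\<And>y. \<bar>\<sigma> y\<bar> \<le> 1"
    "\<And>y z. \<bar>\<sigma> y - \<sigma> z\<bar> \<le> \<bar>y - z\<bar> / h" "\<And>y. \<sigma> y * (b y - lam) \<ge> 0"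
    "\<And>y. (\<And>z. b z = lam \<Longrightarrow> \<bar>y - z\<bar> \<ge> h) \<Longrightarrow> \<sigma> y * (b y - lam) = \<bar>b y - lam\<bar>"
proof -
  define Z where "Z = {z. b z = lam}"
  have zero: "\<exists>z\<in>Z. min x y \<le> z \<and> z \<le> max x y" if "b x < lam" "lam < b y" for x y
  proof (cases "x \<le> y")
    case True
    then show ?thesis
      using that IVT'[of b x lam y] continuous_on_subset[OF c] by (force simp: Z_def)
  next
    case False
    then show ?thesis
      using that IVT2'[of b x lam y] continuous_on_subset[OF c] by (force simp: Z_def)
  qed
  show ?thesis
  \<comment> \<open>Without zeros \<open>infdist\<close> would be 0 by convention and the cutoff
    would vanish, whereas the last property then asks for a full sign; a constant serves.\<close>
  proof (cases "Z = {}")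
    case True
    then have "(\<forall>y. b y < lam) \<or> (\<forall>y. lam < b y)"
      using zero unfolding Z_def by (metis (mono_tags) empty_iff linorder_neqE_linordered_idom mem_Collect_eq)
    then show ?thesis
    proof
      assume "\<forall>y. b y < lam"
      then show ?thesis using h by (intro that[of "\<lambda>_. -1"]) (auto simp: periodic1_def less_imp_le)
    next
      assume "\<forall>y. lam < b y"
      then show ?thesis using h by (intro that[of "\<lambda>_. 1"]) (auto simp: periodic1_def less_imp_le)
    qed
  next
    case False
    define d where "d y = min 1 (infdist y Z / h)" for y
    define \<sigma> where "\<sigma> y = sgn (b y - lam) * d y" for y
    have d: "0 \<le> d y" "d y \<le> 1" for y
      using h infdist_nonneg[of y Z] by (auto simp: d_def)
    have dZ: "d y \<le> \<bar>y - z\<bar> / h" if "z \<in> Z" for y z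
      using infdist_le[OF that, of y] h by (auto simp: d_def dist_real_def divide_right_mono min.coboundedI2)
    have dd: "\<bar>d y - d z\<bar> \<le> \<bar>y - z\<bar> / h" for y z
    proof -
      have "\<bar>d y - d z\<bar> \<le> \<bar>infdist y Z / h - infdist z Z / h\<bar>"
        by (auto simp: d_def)
      also have "\<dots> = \<bar>infdist y Z - infdist z Z\<bar> / h"
        using h by (simp add: diff_divide_distrib[symmetric])
      also have "\<dots> \<le> \<bar>y - z\<bar> / h"
        using infdist_triangle_abs[of y Z z] h by (simp add: dist_real_def divide_right_mono)
      finally show ?thesis .
    qed
    \<comment> \<open>A zero lies between points of opposite sign, and the distances of the two
      points to it add up exactly to their mutual distance.\<close>
    have opp: "d x + d y \<le> \<bar>x - y\<bar> / h" if xy: "b x < lam" "lam < b y" for x y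
    proof -
      obtain z where z: "z \<in> Z" "min x y \<le> z" "z \<le> max x y" using zero[OF xy] by blast
      have "d x + d y \<le> (\<bar>x - z\<bar> + \<bar>y - z\<bar>) / h"
        using dZ[OF z(1), of x] dZ[OF z(1), of y] by (simp add: add_divide_distrib)
      also have "\<bar>x - z\<bar> + \<bar>y - z\<bar> = \<bar>x - y\<bar>" using z by (auto simp: min_def max_def split: if_splits)
      finally show ?thesis .
    qed
    have dz: "d y = 0" if "b y = lam" for y
      using dZ[of y y] that d(1)[of y] by (simp add: Z_def)
    show ?thesis
    proof (rule that[of \<sigma>])
      show "periodic1 \<sigma>"
      proof -
        have Zp: "z + 1 \<in> Z \<longleftrightarrow> z \<in> Z" for z using per by (auto simp: Z_def periodic1_def)
        have "infdist (y + 1) Z = infdist y Z" for y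
        proof -
          have "(\<lambda>a. dist (y + 1) a) ` Z = (\<lambda>a. dist y a) ` Z"
          proof (intro equalityI subsetI)
            fix t assume "t \<in> (\<lambda>a. dist (y + 1) a) ` Z"
            then obtain a where "a \<in> Z" "t = dist (y + 1) a" by blast
            then show "t \<in> (\<lambda>a. dist y a) ` Z"
              using Zp[of "a - 1"] by (intro image_eqI[of _ _ "a - 1"]) (auto simp: dist_real_def)
          next
            fix t assume "t \<in> (\<lambda>a. dist y a) ` Z"
            then obtain a where "a \<in> Z" "t = dist y a" by blast
            then show "t \<in> (\<lambda>a. dist (y + 1) a) ` Z"
              using Zp[of a] by (intro image_eqI[of _ _ "a + 1"]) (auto simp: dist_real_def)
          qed
          then show ?thesis using False by (simp add: infdist_def)
        qed
        then show ?thesis using per by (simp add: periodic1_def \<sigma>_def d_def)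
      qed
      show "\<bar>\<sigma> y\<bar> \<le> 1" for y
        using d[of y] by (auto simp: \<sigma>_def abs_mult sgn_if)
      show "\<sigma> y * (b y - lam) \<ge> 0" for y
      proof -
        have "\<sigma> y * (b y - lam) = d y * \<bar>b y - lam\<bar>"
          by (auto simp: \<sigma>_def sgn_if abs_if)
        then show ?thesis using d by simp
      qed
      show "\<bar>\<sigma> y - \<sigma> z\<bar> \<le> \<bar>y - z\<bar> / h" for y z
      proof -
        consider "b y < lam" "lam < b z" | "lam < b y" "b z < lam"
          | "b y \<le> lam" "b z \<le> lam" | "lam \<le> b y" "lam \<le> b z" by linarith
        then show ?thesis
        proof cases
          case 1 then show ?thesis using opp[of y z] d[of y] d[of z] by (auto simp: \<sigma>_def)
        next
          case 2 then show ?thesis using opp[of z y] d[of y] d[of z] by (auto simp: \<sigma>_def abs_minus_commute)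
        next
          case 3 then show ?thesis using dd[of y z] dz[of y] dz[of z] by (cases "b y = lam"; cases "b z = lam") (auto simp: \<sigma>_def)
        next
          case 4 then show ?thesis using dd[of y z] dz[of y] dz[of z] by (cases "b y = lam"; cases "b z = lam") (auto simp: \<sigma>_def)
        qed
      qed
      show "\<sigma> y * (b y - lam) = \<bar>b y - lam\<bar>" if "\<And>z. b z = lam \<Longrightarrow> \<bar>y - z\<bar> \<ge> h" for y
      proof -
        have "infdist y Z \<ge> h"
          using False that by (auto simp: infdist_def Z_def dist_real_def intro!: cINF_greatest)
        then have "d y = 1" using h by (simp add: d_def)
        then show ?thesis by (auto simp: \<sigma>_def sgn_if abs_if)
      qed
    qed
  qed
qed

lemma lipschitz_imp_continuous:
  fixes \<sigma> :: "real \<Rightarrow> real"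
  assumes "\<And>y z. \<bar>\<sigma> y - \<sigma> z\<bar> \<le> K * \<bar>y - z\<bar>"
  shows "continuous_on A \<sigma>"
proof (rule continuous_on_subset[of UNIV])
  have "\<bar>K\<bar>-lipschitz_on UNIV \<sigma>"
  proof (rule lipschitz_onI)
    show "dist (\<sigma> y) (\<sigma> z) \<le> \<bar>K\<bar> * dist y z" for y z
      using assms[of y z] mult_right_mono[OF abs_ge_self[of K] abs_ge_zero[of "y - z"]] by (simp add: dist_real_def)
  qed auto
  then show "continuous_on UNIV \<sigma>" by (rule lipschitz_on_continuous_on)
qed auto

text \<open>
  Integration by parts against a merely Lipschitz \<open>\<sigma>\<close>: the difference quotients of \<open>q\<close> are moved to
  \<open>\<sigma>\<close> by translation invariance.
\<close>

lemma integral_lipschitz_by_parts: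
  fixes q q' \<sigma> :: "real \<Rightarrow> real"
  assumes q: "\<And>y. (q has_real_derivative q' y) (at y)" "continuous_on UNIV q'" "periodic1 q" "periodic1 q'"
    and \<sigma>: "periodic1 \<sigma>" "\<And>y. \<bar>\<sigma> y\<bar> \<le> 1" "\<And>y z. \<bar>\<sigma> y - \<sigma> z\<bar> \<le> K * \<bar>y - z\<bar>"
  shows "\<bar>\<integral>y. \<sigma> y * q' y \<partial>circle\<bar> \<le> K * (\<integral>y. \<bar>q y\<bar> \<partial>circle)"
proof -
  have qc: "continuous_on UNIV q"
    using q(1) by (intro continuous_at_imp_continuous_on ballI DERIV_isCont)
  have \<sigma>c: "continuous_on A \<sigma>" for A
    by (rule lipschitz_imp_continuous[OF \<sigma>(3)])
  have c: "continuous_on A (\<lambda>y. \<sigma> (y + a))" "continuous_on A (\<lambda>y. q (y + a))"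
    "continuous_on A \<sigma>" "continuous_on A q" "continuous_on A q'" for A a
    by (auto intro!: continuous_intros continuous_on_compose2[OF \<sigma>c[of UNIV]] continuous_on_compose2[OF qc]
        continuous_on_subset[OF qc] continuous_on_subset[OF q(2)] \<sigma>c)
  obtain B where B: "\<And>y. norm (q' y) \<le> B" using periodic1_bounded[OF q(4,2)] by blast
  define e where "e n = 1 / real (Suc n)" for n
  have e: "e n > 0" for n by (simp add: e_def)
  have e0: "e \<longlonglongrightarrow> 0" unfolding e_def by (rule LIMSEQ_inverse_real_of_nat[unfolded inverse_eq_divide])
  have lim: "(\<lambda>n. \<integral>y. \<sigma> y * ((q (y + e n) - q y) / e n) \<partial>circle) \<longlonglongrightarrow> (\<integral>y. \<sigma> y * q' y \<partial>circle)"
  proof (rule integral_dominated_convergence[where w="\<lambda>_. B"])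
    show "(\<lambda>y. \<sigma> y * q' y) \<in> borel_measurable circle"
      by (intro measurable_circle_continuous continuous_intros c)
    show "(\<lambda>y. \<sigma> y * ((q (y + e n) - q y) / e n)) \<in> borel_measurable circle" for n
      using e[of n] by (intro measurable_circle_continuous continuous_intros c) auto
    show "AE y in circle. (\<lambda>n. \<sigma> y * ((q (y + e n) - q y) / e n)) \<longlonglongrightarrow> \<sigma> y * q' y"
    proof (intro AE_I2 tendsto_intros)
      fix y
      have "((\<lambda>h. (q (y + h) - q y) / h) \<longlongrightarrow> q' y) (at 0)"
        using q(1)[of y] by (simp add: DERIV_def)
      moreover have "filterlim e (at 0) sequentially"
        using e0 e by (auto simp: filterlim_at intro!: always_eventually less_imp_neq[symmetric])
      ultimately show "(\<lambda>n. (q (y + e n) - q y) / e n) \<longlonglongrightarrow> q' y"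
        by (rule filterlim_compose)
    qed
    show "AE y in circle. norm (\<sigma> y * ((q (y + e n) - q y) / e n)) \<le> B" for n
    proof (intro AE_I2)
      fix y
      obtain z where z: "q (y + e n) - q y = (y + e n - y) * q' z"
        using MVT2[of y "y + e n" q q'] e[of n] q(1) by auto
      have "\<bar>\<sigma> y\<bar> * \<bar>q' z\<bar> \<le> 1 * B"
        using \<sigma>(2)[of y] B[of z] by (intro mult_mono) auto
      then show "norm (\<sigma> y * ((q (y + e n) - q y) / e n)) \<le> B"
        unfolding z using e[of n] by (simp add: abs_mult)
    qed
  qed auto
  have "\<bar>\<integral>y. \<sigma> y * ((q (y + e n) - q y) / e n) \<partial>circle\<bar> \<le> K * (\<integral>y. \<bar>q y\<bar> \<partial>circle)" for n
  proof -
    have p1: "periodic1 (\<lambda>y. \<sigma> (y - e n) * q y)"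
      using q(3) \<sigma>(1) unfolding periodic1_def by (metis add_diff_eq diff_add_eq)
    have "(\<integral>y. \<sigma> y * q (y + e n) \<partial>circle) = (\<integral>y. \<sigma> (y + e n - e n) * q (y + e n) \<partial>circle)"
      by simp
    also have "\<dots> = (\<integral>y. \<sigma> (y - e n) * q y \<partial>circle)"
      by (rule integral_circle_shift[OF _ p1])
        (intro continuous_intros c(4) c(1)[of _ "- e n", simplified])
    finally have sh: "(\<integral>y. \<sigma> y * q (y + e n) \<partial>circle) = (\<integral>y. \<sigma> (y - e n) * q y \<partial>circle)" .
    have ii: "integrable circle (\<lambda>y. \<sigma> y * q (y + e n))" "integrable circle (\<lambda>y. \<sigma> y * q y)"
      "integrable circle (\<lambda>y. \<sigma> (y - e n) * q y)" "integrable circle (\<lambda>y. \<bar>q y\<bar>)"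
      by (intro integrable_circle_continuous continuous_intros c c(1)[of _ "- e n", simplified])+
    have "(\<integral>y. \<sigma> y * ((q (y + e n) - q y) / e n) \<partial>circle) = (\<integral>y. (\<sigma> y * q (y + e n) - \<sigma> y * q y) / e n \<partial>circle)"
      by (simp add: algebra_simps)
    also have "\<dots> = ((\<integral>y. \<sigma> (y - e n) * q y \<partial>circle) - (\<integral>y. \<sigma> y * q y \<partial>circle)) / e n"
      using ii by (simp add: sh)
    also have "\<dots> = (\<integral>y. (\<sigma> (y - e n) * q y - \<sigma> y * q y) / e n \<partial>circle)"
      using ii by simp
    also have "\<bar>\<dots>\<bar> \<le> (\<integral>y. K * \<bar>q y\<bar> \<partial>circle)"
    proof (rule order_trans[OF integral_abs_bound integral_mono])
      show "integrable circle (\<lambda>y. \<bar>(\<sigma> (y - e n) * q y - \<sigma> y * q y) / e n\<bar>)"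
        using ii by simp
      fix y
      have "\<bar>\<sigma> (y - e n) - \<sigma> y\<bar> \<le> K * e n"
        using \<sigma>(3)[of "y - e n" y] e[of n] by simp
      then have "\<bar>\<sigma> (y - e n) - \<sigma> y\<bar> * \<bar>q y\<bar> / e n \<le> K * e n * \<bar>q y\<bar> / e n"
        using e[of n] by (intro divide_right_mono mult_right_mono) auto
      then show "\<bar>(\<sigma> (y - e n) * q y - \<sigma> y * q y) / e n\<bar> \<le> K * \<bar>q y\<bar>"
        using e[of n] by (simp add: abs_mult abs_divide left_diff_distrib[symmetric])
    qed (use ii in simp)
    finally show ?thesis by simp
  qed
  then show ?thesis
    by (intro LIMSEQ_le_const2[OF tendsto_rabs[OF lim]]) auto
qed

subsection \<open>The resolvent estimate\<close>

text \<open>The Fourier multiplier of d/dy, kept on the side of the coefficients so that u, u' and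
  u'' are trigonometric polynomials over one and the same frequency set.\<close>

definition trig_deriv :: "(int \<Rightarrow> complex) \<Rightarrow> int \<Rightarrow> complex" where
  "trig_deriv a l = 2 * pi * \<i> * of_int l * a l"

lemma has_vector_derivative_trig_poly:
  "(trig_poly S a has_vector_derivative trig_poly S (trig_deriv a) y) (at y within A)"
proof -
  have "((\<lambda>x. \<Sum>l\<in>S. a l * fchar l x) has_vector_derivative
      (\<Sum>l\<in>S. a l * (2 * pi * \<i> * of_int l * fchar l y))) (at y within A)"
    by (intro has_vector_derivative_sum has_vector_derivative_mult_right has_vector_derivative_fchar)
  then show ?thesis
    by (simp add: trig_poly_def[abs_def] trig_deriv_def mult_ac)
qed

lemma periodic1_trig_poly: "periodic1 (trig_poly S a)"
  using periodic1_fchar by (simp add: periodic1_def trig_poly_def)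

lemma cmod_cis_minus_1: "cmod (cis t - 1) \<le> \<bar>t\<bar>"
proof -
  have "(cmod (cis t - 1))\<^sup>2 = (cos t - 1)\<^sup>2 + (sin t)\<^sup>2"
    by (simp add: cmod_power2)
  also have "\<dots> = 2 - 2 * cos (2 * (t / 2))"
    using sin_cos_squared_add[of t] by (simp add: power2_eq_square algebra_simps)
  also have "\<dots> = (2 * sin (t / 2))\<^sup>2"
    unfolding cos_double_sin by (simp add: power2_eq_square)
  also have "\<dots> \<le> \<bar>t\<bar>\<^sup>2"
  proof -
    have "\<bar>sin (t / 2)\<bar> \<le> \<bar>t / 2\<bar>" by (rule abs_sin_x_le_abs_x)
    then have "\<bar>2 * sin (t / 2)\<bar> \<le> \<bar>t\<bar>" by (simp add: abs_mult)
    then have "\<bar>2 * sin (t / 2)\<bar>\<^sup>2 \<le> \<bar>t\<bar>\<^sup>2" by (intro power_mono) auto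
    then show ?thesis by simp
  qed
  finally show ?thesis by (rule power2_le_imp_le) simp
qed

text \<open>Translation multiplies the l-th coefficient by \<open>fchar l t\<close>; a chord is no
  longer than its arc, so the factor minus 1 is bounded by \<bar>t\<bar> times the modulus of the
  symbol of d/dy.\<close>

lemma integral_translate_trig_poly:
  assumes S: "finite S"
  shows "sqnorm (\<lambda>y. trig_poly S a (y + t) - trig_poly S a y)
    \<le> t\<^sup>2 * sqnorm (trig_poly S (trig_deriv a))"
proof -
  have "trig_poly S a (y + t) - trig_poly S a y = trig_poly S (\<lambda>l. a l * (fchar l t - 1)) y" for y
    by (simp add: trig_poly_def fchar_shift sum_subtractf[symmetric] algebra_simps)
  then have "sqnorm (\<lambda>y. trig_poly S a (y + t) - trig_poly S a y)
      = (\<Sum>l\<in>S. (cmod (a l * (fchar l t - 1)))\<^sup>2)"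
    by (simp add: integral_trig_poly_sq[OF S])
  also have "\<dots> \<le> (\<Sum>l\<in>S. t\<^sup>2 * (cmod (trig_deriv a l))\<^sup>2)"
  proof (rule sum_mono)
    fix l
    have "cmod (fchar l t - 1) \<le> \<bar>2 * pi * of_int l * t\<bar>"
      unfolding fchar_def by (rule cmod_cis_minus_1)
    then have "cmod (a l) * cmod (fchar l t - 1) \<le> cmod (a l) * \<bar>2 * pi * of_int l * t\<bar>"
      by (intro mult_left_mono) auto
    then have "(cmod (a l) * cmod (fchar l t - 1))\<^sup>2 \<le> (cmod (a l) * \<bar>2 * pi * of_int l * t\<bar>)\<^sup>2"
      by (intro power_mono) auto
    then show "(cmod (a l * (fchar l t - 1)))\<^sup>2 \<le> t\<^sup>2 * (cmod (trig_deriv a l))\<^sup>2"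
      by (simp add: norm_mult trig_deriv_def power_mult_distrib mult_ac)
  qed
  also have "\<dots> = t\<^sup>2 * sqnorm (trig_poly S (trig_deriv a))"
    by (simp add: integral_trig_poly_sq[OF S] sum_distrib_left)
  finally show ?thesis .
qed

text \<open>
  \<open>shear_resolvent b \<nu> \<kappa> lam S a\<close> is \<open>- \<nu> u'' + (\<nu> \<kappa>\<^sup>2 + i \<kappa> (b - lam)) u\<close> for \<open>u = trig_poly S a\<close>.
\<close>

definition shear_resolvent ::
  "(real \<Rightarrow> real) \<Rightarrow> real \<Rightarrow> real \<Rightarrow> real \<Rightarrow> int set \<Rightarrow> (int \<Rightarrow> complex) \<Rightarrow> real \<Rightarrow> complex" where
  "shear_resolvent b \<nu> \<kappa> lam S a y = - \<nu> * trig_poly S (trig_deriv (trig_deriv a)) y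
     + (\<nu> * \<kappa>\<^sup>2 + \<i> * \<kappa> * (b y - lam)) * trig_poly S a y"

lemma continuous_on_shear_resolvent:
  assumes "continuous_on UNIV b"
  shows "continuous_on A (shear_resolvent b \<nu> \<kappa> lam S a)"
  unfolding shear_resolvent_def
  by (intro continuous_intros continuous_on_subset[OF assms]) auto

text \<open>The real part of the pairing of R with u: the transport term is purely imaginary and
  drops out, and the second derivative pairs to the squared norm of u'.\<close>

lemma resolvent_energy:
  fixes a :: "int \<Rightarrow> complex" and \<kappa> lam :: real
  assumes b: "continuous_on UNIV b" and S: "finite S" and \<nu>: "\<nu> > 0"
  defines "u \<equiv> trig_poly S a" and "R \<equiv> shear_resolvent b \<nu> \<kappa> lam S a"
  shows "\<nu> * sqnorm (trig_poly S (trig_deriv a)) + \<nu> * \<kappa>\<^sup>2 * sqnorm u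
    \<le> (\<integral>y. cmod (R y) * cmod (u y) \<partial>circle)"
proof -
  let ?u2 = "trig_poly S (trig_deriv (trig_deriv a))"
  have c: "continuous_on A u" "continuous_on A R" "continuous_on A ?u2" for A
    unfolding u_def R_def by (intro continuous_intros continuous_on_shear_resolvent b)+
  have i: "integrable circle (\<lambda>y. ?u2 y * cnj (u y))" "integrable circle (\<lambda>y. (cmod (u y))\<^sup>2)"
    "integrable circle (\<lambda>y. Re (R y * cnj (u y)))" "integrable circle (\<lambda>y. cmod (R y) * cmod (u y))"
    by (intro integrable_circle_continuous continuous_intros c)+
  have "(\<integral>y. ?u2 y * cnj (u y) \<partial>circle) = (\<Sum>l\<in>S. cnj (a l) * trig_deriv (trig_deriv a) l)"
    unfolding u_def by (subst integral_mult_cnj_trig_poly) (auto simp: square_integrable_trig_poly fcoef_trig_poly S)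
  also have "\<dots> = - of_real (\<Sum>l\<in>S. (cmod (trig_deriv a l))\<^sup>2)"
    unfolding of_real_sum complex_norm_square sum_negf[symmetric]
    by (intro sum.cong) (simp_all add: trig_deriv_def)
  finally have u2: "Re (\<integral>y. ?u2 y * cnj (u y) \<partial>circle) = - sqnorm (trig_poly S (trig_deriv a))"
    by (simp add: integral_trig_poly_sq[OF S])
  define P where "P y = Re (?u2 y * cnj (u y))" for y
  have P: "integrable circle P" "integral\<^sup>L circle P = - sqnorm (trig_poly S (trig_deriv a))"
    unfolding P_def using integrable_Re[OF i(1)] integral_Re[OF i(1)] u2 by auto
  have "Re (R y * cnj (u y)) = - \<nu> * P y + \<nu> * \<kappa>\<^sup>2 * (cmod (u y))\<^sup>2" for y
    unfolding R_def shear_resolvent_def P_def u_def[symmetric] cmod_power2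
    by (simp add: algebra_simps power2_eq_square)
  then have "(\<integral>y. Re (R y * cnj (u y)) \<partial>circle) = \<nu> * sqnorm (trig_poly S (trig_deriv a))
      + \<nu> * \<kappa>\<^sup>2 * sqnorm u"
    using P i(2) by simp
  moreover have "(\<integral>y. Re (R y * cnj (u y)) \<partial>circle) \<le> (\<integral>y. cmod (R y) * cmod (u y) \<partial>circle)"
    by (intro integral_mono i) (metis complex_Re_le_cmod complex_mod_cnj norm_mult)
  ultimately show ?thesis by simp
qed

text \<open>Only the damping by diffusion in x enters here. Half of the left side of the energy
  estimate is absorbed by Young's inequality. This serves the regime in which the segments of length
  6h no longer fit into \<open>h0\<close>.\<close>

lemma resolvent_poincare:
  fixes a :: "int \<Rightarrow> complex" and \<kappa> lam :: real
  assumes b: "continuous_on UNIV b" and S: "finite S" and \<nu>: "\<nu> > 0" and \<kappa>: "\<bar>\<kappa>\<bar> \<ge> 1"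
  defines "u \<equiv> trig_poly S a" and "R \<equiv> shear_resolvent b \<nu> \<kappa> lam S a"
  shows "\<nu>\<^sup>2 * sqnorm u \<le> sqnorm R"
proof -
  have c: "continuous_on A u" "continuous_on A R" for A
    unfolding u_def R_def by (intro continuous_intros continuous_on_shear_resolvent b)+
  have i: "integrable circle (\<lambda>y. (cmod (u y))\<^sup>2)" "integrable circle (\<lambda>y. (cmod (R y))\<^sup>2)"
    "integrable circle (\<lambda>y. cmod (R y) * cmod (u y))"
    by (intro integrable_circle_continuous continuous_intros c)+
  let ?X = "\<integral>y. (cmod (u y))\<^sup>2 \<partial>circle"
  have "?X \<le> \<kappa>\<^sup>2 * ?X"
    using \<kappa> mult_right_mono[of 1 "\<kappa>\<^sup>2" ?X] one_le_power[of "\<bar>\<kappa>\<bar>" 2] by simp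
  then have "\<nu> * ?X \<le> \<nu> * (\<kappa>\<^sup>2 * ?X)"
    using \<nu> by (intro mult_left_mono) auto
  also have "\<dots> \<le> (\<integral>y. cmod (R y) * cmod (u y) \<partial>circle)"
    using resolvent_energy[OF b S \<nu>, of a \<kappa> lam] \<nu> unfolding u_def R_def
    by (smt (verit) mult.assoc mult_nonneg_nonneg Bochner_Integration.integral_nonneg zero_le_power2)
  also have "\<dots> \<le> (\<integral>y. \<nu> / 2 * (cmod (u y))\<^sup>2 + 1 / (2 * \<nu>) * (cmod (R y))\<^sup>2 \<partial>circle)"
  proof (intro integral_mono i)
    fix y
    have "0 \<le> (\<nu> * cmod (u y) - cmod (R y))\<^sup>2 / (2 * \<nu>)" using \<nu> by simp
    also have "\<dots> = \<nu> / 2 * (cmod (u y))\<^sup>2 + 1 / (2 * \<nu>) * (cmod (R y))\<^sup>2 - cmod (R y) * cmod (u y)"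
      using \<nu> by (simp add: power2_eq_square field_simps)
    finally show "cmod (R y) * cmod (u y) \<le> \<nu> / 2 * (cmod (u y))\<^sup>2 + 1 / (2 * \<nu>) * (cmod (R y))\<^sup>2" by simp
  qed (use i in auto)
  also have "\<dots> = \<nu> / 2 * ?X + 1 / (2 * \<nu>) * sqnorm R"
    using i by simp
  finally have "\<nu> / 2 * ?X \<le> 1 / (2 * \<nu>) * sqnorm R" by simp
  then have "2 * \<nu> * (\<nu> / 2 * ?X) \<le> 2 * \<nu> * (1 / (2 * \<nu>) * sqnorm R)"
    using \<nu> by (intro mult_left_mono) auto
  then show ?thesis using \<nu> by (simp add: power2_eq_square)
qed

lemma resolvent_weighted:
  fixes a :: "int \<Rightarrow> complex" and \<kappa> lam :: real
  assumes b: "continuous_on UNIV b" and S: "finite S" and \<nu>: "\<nu> > 0" and \<kappa>: "\<bar>\<kappa>\<bar> \<ge> 1" and h: "h > 0"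
    and \<sigma>: "periodic1 \<sigma>" "\<And>y. \<bar>\<sigma> y\<bar> \<le> 1" "\<And>y z. \<bar>\<sigma> y - \<sigma> z\<bar> \<le> \<bar>y - z\<bar> / h"
    and sgn: "\<And>y. \<sigma> y * (b y - lam) \<ge> 0"
  defines "u \<equiv> trig_poly S a" and "R \<equiv> shear_resolvent b \<nu> \<kappa> lam S a"
    and "u1 \<equiv> trig_poly S (trig_deriv a)"
  shows "(\<integral>y. \<sigma> y * (b y - lam) * (cmod (u y))\<^sup>2 \<partial>circle) \<le>
    (\<integral>y. cmod (R y) * cmod (u y) \<partial>circle) + \<nu> / h * (\<integral>y. cmod (u1 y) * cmod (u y) \<partial>circle)"
proof -
  define u2 where "u2 = trig_poly S (trig_deriv (trig_deriv a))"
  have \<sigma>': "\<bar>\<sigma> y - \<sigma> z\<bar> \<le> (1 / h) * \<bar>y - z\<bar>" for y z using \<sigma>(3)[of y z] by simp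
  have c: "continuous_on A u" "continuous_on A R" "continuous_on A u1" "continuous_on A u2"
     "continuous_on A b" "continuous_on A \<sigma>" for A
    unfolding u_def R_def u1_def u2_def
    by (auto intro!: continuous_intros continuous_on_shear_resolvent b lipschitz_imp_continuous[OF \<sigma>'] intro: continuous_on_subset[OF b])
  \<comment> \<open>The derivative of u' times the conjugate of u has the extra term \<bar>u'\<bar>
    squared, which is real; on imaginary parts, \<open>q'\<close> is therefore exactly the
    derivative of \<open>q\<close>.\<close>
  define q where "q y = Im (u1 y * cnj (u y))" for y
  define q' where "q' y = Im (u2 y * cnj (u y))" for y
  have dq: "(q has_real_derivative q' y) (at y)" for y
  proof -
    have "((\<lambda>y. u1 y * cnj (u y)) has_vector_derivative (u1 y * cnj (u1 y) + u2 y * cnj (u y))) (at y)"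
      unfolding u_def u1_def u2_def
      by (intro has_vector_derivative_mult has_vector_derivative_cnj has_vector_derivative_trig_poly)
    then have "(q has_real_derivative Im (u1 y * cnj (u1 y) + u2 y * cnj (u y))) (at y)"
      unfolding q_def by (rule has_field_derivative_Im)
    then show ?thesis by (simp add: q'_def)
  qed
  have per: "periodic1 q" "periodic1 q'"
    using periodic1_trig_poly unfolding q_def q'_def periodic1_def u_def u1_def u2_def by metis+
  have "\<bar>\<integral>y. \<sigma> y * q' y \<partial>circle\<bar> \<le> 1 / h * (\<integral>y. \<bar>q y\<bar> \<partial>circle)"
    by (rule integral_lipschitz_by_parts[OF dq _ per \<sigma>(1,2) \<sigma>'])
      (unfold q'_def, intro continuous_intros c)
  also have "\<dots> \<le> 1 / h * (\<integral>y. cmod (u1 y) * cmod (u y) \<partial>circle)"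
  proof (intro mult_left_mono integral_mono)
    show "\<bar>q y\<bar> \<le> cmod (u1 y) * cmod (u y)" for y
      unfolding q_def by (metis abs_Im_le_cmod complex_mod_cnj norm_mult)
    show "integrable circle (\<lambda>y. \<bar>q y\<bar>)" "integrable circle (\<lambda>y. cmod (u1 y) * cmod (u y))"
      unfolding q_def by (intro integrable_circle_continuous continuous_intros c)+
  qed (use h in auto)
  finally have q: "\<bar>\<integral>y. \<sigma> y * q' y \<partial>circle\<bar> \<le> 1 / h * (\<integral>y. cmod (u1 y) * cmod (u y) \<partial>circle)" .
  let ?W = "\<integral>y. \<sigma> y * (b y - lam) * (cmod (u y))\<^sup>2 \<partial>circle"
  have i: "integrable circle (\<lambda>y. \<sigma> y * (b y - lam) * (cmod (u y))\<^sup>2)" "integrable circle (\<lambda>y. \<sigma> y * q' y)"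
    "integrable circle (\<lambda>y. \<sigma> y * Im (R y * cnj (u y)))" "integrable circle (\<lambda>y. cmod (R y) * cmod (u y))"
    unfolding q'_def by (intro integrable_circle_continuous continuous_intros c)+
  have "\<sigma> y * Im (R y * cnj (u y)) = \<kappa> * (\<sigma> y * (b y - lam) * (cmod (u y))\<^sup>2) - \<nu> * (\<sigma> y * q' y)" for y
    unfolding R_def shear_resolvent_def q'_def u_def[symmetric] u2_def[symmetric] cmod_power2
    by (simp add: algebra_simps power2_eq_square)
  then have "\<kappa> * ?W = (\<integral>y. \<sigma> y * Im (R y * cnj (u y)) \<partial>circle) + \<nu> * (\<integral>y. \<sigma> y * q' y \<partial>circle)"
    using i by simp
  then have "\<bar>\<kappa> * ?W\<bar> \<le> \<bar>\<integral>y. \<sigma> y * Im (R y * cnj (u y)) \<partial>circle\<bar> + \<nu> * \<bar>\<integral>y. \<sigma> y * q' y \<partial>circle\<bar>"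
    using \<nu> abs_triangle_ineq[of "\<integral>y. \<sigma> y * Im (R y * cnj (u y)) \<partial>circle" "\<nu> * (\<integral>y. \<sigma> y * q' y \<partial>circle)"]
    by (simp add: abs_mult)
  also have "\<dots> \<le> (\<integral>y. cmod (R y) * cmod (u y) \<partial>circle) + \<nu> * (1 / h * (\<integral>y. cmod (u1 y) * cmod (u y) \<partial>circle))"
  proof (intro add_mono mult_left_mono q)
    show "\<bar>\<integral>y. \<sigma> y * Im (R y * cnj (u y)) \<partial>circle\<bar> \<le> (\<integral>y. cmod (R y) * cmod (u y) \<partial>circle)"
    proof (rule order_trans[OF integral_abs_bound integral_mono])
      fix y
      have "\<bar>\<sigma> y\<bar> * \<bar>Im (R y * cnj (u y))\<bar> \<le> 1 * cmod (R y * cnj (u y))"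
        by (intro mult_mono \<sigma> abs_Im_le_cmod) auto
      then show "\<bar>\<sigma> y * Im (R y * cnj (u y))\<bar> \<le> cmod (R y) * cmod (u y)"
        by (simp add: abs_mult norm_mult)
    qed (use i in auto)
  qed (use \<nu> in auto)
  finally have "\<bar>\<kappa> * ?W\<bar> \<le> (\<integral>y. cmod (R y) * cmod (u y) \<partial>circle) + \<nu> / h * (\<integral>y. cmod (u1 y) * cmod (u y) \<partial>circle)"
    by simp
  moreover have "?W \<ge> 0"
    using sgn by (intro Bochner_Integration.integral_nonneg) simp
  then have "?W \<le> \<bar>\<kappa> * ?W\<bar>"
    using \<kappa> mult_right_mono[of 1 "\<bar>\<kappa>\<bar>" ?W] by (simp add: abs_mult)
  ultimately show ?thesis by linarith
qed

text \<open>Each y is compared with a translate at which the weight is at least 1 / (2 T). Summing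
  over all shifts costs only a constant, since every summand is nonnegative and w integrates to the
  same value after any translation.\<close>

lemma resolvent_covering:
  fixes a :: "int \<Rightarrow> complex"
  assumes b: "continuous_on UNIV b" "periodic1 b" and S: "finite S" and T: "T > 0"
    and \<sigma>: "periodic1 \<sigma>" "continuous_on UNIV \<sigma>" "\<And>y. \<sigma> y * (b y - lam) \<ge> 0"
    and near: "\<And>y. \<exists>j\<in>shifts. \<sigma> (y + j * h) * (b (y + j * h) - lam) \<ge> 1 / (2 * T)"
  defines "u \<equiv> trig_poly S a" and "u1 \<equiv> trig_poly S (trig_deriv a)"
  shows "sqnorm u \<le>
    16 * T * (\<integral>y. \<sigma> y * (b y - lam) * (cmod (u y))\<^sup>2 \<partial>circle) + 104 * h\<^sup>2 * sqnorm u1"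
proof -
  define w where "w y = \<sigma> y * (b y - lam) * (cmod (u y))\<^sup>2" for y
  define v where "v j y = (cmod (u (y + j * h) - u y))\<^sup>2" for j y
  have uc: "continuous_on A (\<lambda>y. u (y + t))" for A t
    unfolding u_def by (intro continuous_intros)
  have wc: "continuous_on UNIV w"
    unfolding w_def using uc[of UNIV 0] by (intro continuous_intros b \<sigma>) simp
  have w0: "w y \<ge> 0" for y unfolding w_def using \<sigma>(3)[of y] by simp
  have wp: "periodic1 w"
    using b(2) \<sigma>(1) periodic1_trig_poly[of S a] by (simp add: w_def u_def periodic1_def)
  have i: "integrable circle (\<lambda>y. w (y + t))" "integrable circle (v j)" "integrable circle (\<lambda>y. (cmod (u y))\<^sup>2)" for t j
    unfolding v_def using uc[of _ 0]
    by (intro integrable_circle_continuous continuous_intros continuous_on_compose2[OF wc] uc; simp)+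
  have fin: "finite shifts" by (simp add: shifts_def)
  have pt: "(cmod (u y))\<^sup>2 \<le> (\<Sum>j\<in>shifts. 4 * T * w (y + j * h) + 2 * v j y)" for y
  proof -
    obtain j where j: "j \<in> shifts" "\<sigma> (y + j * h) * (b (y + j * h) - lam) \<ge> 1 / (2 * T)"
      using near by blast
    have "1 / (2 * T) * (cmod (u (y + j * h)))\<^sup>2 \<le> w (y + j * h)"
      unfolding w_def by (intro mult_right_mono j) simp
    then have "4 * T * (1 / (2 * T) * (cmod (u (y + j * h)))\<^sup>2) \<le> 4 * T * w (y + j * h)"
      using T by (intro mult_left_mono) auto
    then have "2 * (cmod (u (y + j * h)))\<^sup>2 \<le> 4 * T * w (y + j * h)"
      using T by simp
    moreover have "(cmod (u y))\<^sup>2 \<le> 2 * (cmod (u (y + j * h)))\<^sup>2 + 2 * v j y"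
      using norm_diff_sq_le2[of "u (y + j * h)" "u (y + j * h) - u y"] by (simp add: v_def)
    ultimately have "(cmod (u y))\<^sup>2 \<le> 4 * T * w (y + j * h) + 2 * v j y" by simp
    also have "\<dots> \<le> (\<Sum>j\<in>shifts. 4 * T * w (y + j * h) + 2 * v j y)"
    proof (rule member_le_sum[OF j(1) _ fin])
      show "0 \<le> 4 * T * w (y + j * h) + 2 * v j y" for j
        using w0 T by (simp add: v_def)
    qed
    finally show ?thesis .
  qed
  have "sqnorm u \<le> (\<integral>y. (\<Sum>j\<in>shifts. 4 * T * w (y + j * h) + 2 * v j y) \<partial>circle)"
    by (intro integral_mono pt i Bochner_Integration.integrable_sum Bochner_Integration.integrable_add
        integrable_mult_right)
  also have "\<dots> = (\<Sum>j\<in>shifts. \<integral>y. 4 * T * w (y + j * h) + 2 * v j y \<partial>circle)"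
    by (intro Bochner_Integration.integral_sum Bochner_Integration.integrable_add integrable_mult_right i)
  also have "\<dots> = (\<Sum>j\<in>shifts. 4 * T * integral\<^sup>L circle w + 2 * integral\<^sup>L circle (v j))"
    using i by (simp add: integral_circle_shift[OF wc wp])
  also have "\<dots> \<le> (\<Sum>j\<in>shifts. 4 * T * integral\<^sup>L circle w + 2 * ((j * h)\<^sup>2 * sqnorm u1))"
    unfolding v_def u_def u1_def
    by (intro sum_mono add_mono mult_left_mono integral_translate_trig_poly S) (use T in auto)
  \<comment> \<open>Four shifts contribute 4 * 4 = 16, and their squares give 2 * (1 + 1 + 25 + 25)
    = 104.\<close>
  also have "\<dots> = 16 * T * integral\<^sup>L circle w + 104 * h\<^sup>2 * sqnorm u1"
    by (simp add: shifts_def power_mult_distrib)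
  finally show ?thesis by (simp add: w_def[abs_def])
qed

text \<open>Covering, weighted and energy estimates are chained; every cross term is split by
  Young's inequality so that two quarters of X move to the left, which doubles the final
  constant.\<close>

lemma resolvent_bound:
  fixes a :: "int \<Rightarrow> complex" and \<kappa> lam :: real
  assumes b: "continuous_on UNIV b" "periodic1 b" and S: "finite S" and \<nu>: "\<nu> > 0" and \<kappa>: "\<bar>\<kappa>\<bar> \<ge> 1"
    and T: "T > 0" and h: "h > 0" "h\<^sup>2 = \<nu> * T"
    and near: "\<And>y lam. \<exists>j\<in>shifts. \<bar>b (y + j * h) - lam\<bar> \<ge> 1 / (2 * T) \<and> (\<forall>z. b z = lam \<longrightarrow> \<bar>y + j * h - z\<bar> \<ge> h)"
  defines "u \<equiv> trig_poly S a" and "R \<equiv> shear_resolvent b \<nu> \<kappa> lam S a"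
  shows "sqnorm u \<le> 282752 * T\<^sup>2 * sqnorm R"
proof -
  obtain \<sigma> :: "real \<Rightarrow> real" where \<sigma>: "periodic1 \<sigma>" "\<And>y. \<bar>\<sigma> y\<bar> \<le> 1"
    "\<And>y z. \<bar>\<sigma> y - \<sigma> z\<bar> \<le> \<bar>y - z\<bar> / h" "\<And>y. \<sigma> y * (b y - lam) \<ge> 0"
    "\<And>y. (\<And>z. b z = lam \<Longrightarrow> \<bar>y - z\<bar> \<ge> h) \<Longrightarrow> \<sigma> y * (b y - lam) = \<bar>b y - lam\<bar>"
    using sign_cutoff[OF b h(1), of lam] by metis
  have \<sigma>c: "continuous_on UNIV \<sigma>"
    by (rule lipschitz_imp_continuous[of _ "1 / h"]) (use \<sigma>(3) in simp)
  have near': "\<exists>j\<in>shifts. \<sigma> (y + j * h) * (b (y + j * h) - lam) \<ge> 1 / (2 * T)" for y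
    using near[of y lam] \<sigma>(5) by metis
  define u1 where "u1 = trig_poly S (trig_deriv a)"
  have c: "continuous_on A u" "continuous_on A R" "continuous_on A u1" for A
    unfolding u_def R_def u1_def by (intro continuous_intros continuous_on_shear_resolvent b)+
  have i: "integrable circle (\<lambda>y. (cmod (u y))\<^sup>2)" "integrable circle (\<lambda>y. (cmod (R y))\<^sup>2)"
    "integrable circle (\<lambda>y. (cmod (u1 y))\<^sup>2)"
    "integrable circle (\<lambda>y. cmod (R y) * cmod (u y))" "integrable circle (\<lambda>y. cmod (u1 y) * cmod (u y))"
    by (intro integrable_circle_continuous continuous_intros c)+
  define X D I J r where "X = sqnorm u" and "D = sqnorm u1"
    and "I = (\<integral>y. cmod (R y) * cmod (u y) \<partial>circle)" and "J = (\<integral>y. cmod (u1 y) * cmod (u y) \<partial>circle)"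
    and "r = sqnorm R"
  define W where "W = (\<integral>y. \<sigma> y * (b y - lam) * (cmod (u y))\<^sup>2 \<partial>circle)"
  have X: "X \<ge> 0" by (simp add: X_def)
  have "\<nu> * D + \<nu> * \<kappa>\<^sup>2 * X \<le> I"
    unfolding D_def X_def I_def u1_def u_def R_def by (rule resolvent_energy[OF b(1) S \<nu>])
  moreover have "0 \<le> \<nu> * \<kappa>\<^sup>2 * X" using \<nu> X by simp
  ultimately have DI: "\<nu> * D \<le> I" by linarith
  have hD: "h\<^sup>2 * D \<le> T * I"
    using mult_left_mono[OF DI, of T] T by (simp add: h(2) mult_ac)
  have W: "W \<le> I + \<nu> / h * J"
    unfolding W_def I_def J_def u1_def u_def R_def by (rule resolvent_weighted[OF b(1) S \<nu> \<kappa> h(1) \<sigma>(1-4)])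
  have "X \<le> 16 * T * W + 104 * h\<^sup>2 * D"
    unfolding X_def W_def D_def u1_def u_def by (rule resolvent_covering[OF b S T \<sigma>(1) \<sigma>c \<sigma>(4) near'])
  also have "\<dots> \<le> 16 * T * (I + \<nu> / h * J) + 104 * h\<^sup>2 * D"
    using W T by (intro add_mono mult_left_mono) auto
  also have "\<dots> = 16 * T * I + 16 * h * J + 104 * (h\<^sup>2 * D)"
  proof -
    \<comment> \<open>This is where the scale \<open>h\<^sup>2 = \<nu> * T\<close> balances: the
      cost of differentiating the cutoff becomes comparable with that of translating by h.\<close>
    have "T * (\<nu> / h) = h" using h by (simp add: field_simps power2_eq_square)
    then have "16 * T * (I + \<nu> / h * J) = 16 * T * I + 16 * h * J"
      by (metis (no_types, lifting) distrib_left mult.assoc mult.left_commute)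
    then show ?thesis by simp
  qed
  also have "16 * h * J \<le> 256 * (h\<^sup>2 * D) + X / 4"
  proof -
    have "16 * h * J = (\<integral>y. 16 * h * (cmod (u1 y) * cmod (u y)) \<partial>circle)"
      unfolding J_def by simp
    also have "\<dots> \<le> (\<integral>y. 256 * h\<^sup>2 * (cmod (u1 y))\<^sup>2 + 1 / 4 * (cmod (u y))\<^sup>2 \<partial>circle)"
    proof (intro integral_mono)
      fix y
      have "0 \<le> (16 * h * cmod (u1 y) - cmod (u y) / 2)\<^sup>2" by simp
      then show "16 * h * (cmod (u1 y) * cmod (u y)) \<le> 256 * h\<^sup>2 * (cmod (u1 y))\<^sup>2 + 1 / 4 * (cmod (u y))\<^sup>2"
        by (simp add: power2_eq_square algebra_simps)
    qed (use i in auto)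
    also have "\<dots> = 256 * (h\<^sup>2 * D) + X / 4"
      using i by (simp add: D_def X_def)
    finally show ?thesis .
  qed
  \<comment> \<open>376 = 16 + 104 + 256, once both multiples of \<open>h\<^sup>2 * D\<close> are
    bounded by T I. Below, 141376 is the square of 376, and 282752 is twice that.\<close>
  finally have "X \<le> 376 * (T * I) + X / 4"
    using hD by linarith
  also have "376 * (T * I) \<le> X / 4 + 141376 * T\<^sup>2 * r"
  proof -
    have "376 * (T * I) = (\<integral>y. 376 * T * (cmod (R y) * cmod (u y)) \<partial>circle)"
      unfolding I_def by simp
    also have "\<dots> \<le> (\<integral>y. 1 / 4 * (cmod (u y))\<^sup>2 + 141376 * T\<^sup>2 * (cmod (R y))\<^sup>2 \<partial>circle)"
    proof (intro integral_mono)
      fix y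
      have "0 \<le> (376 * T * cmod (R y) - cmod (u y) / 2)\<^sup>2" by simp
      then show "376 * T * (cmod (R y) * cmod (u y)) \<le> 1 / 4 * (cmod (u y))\<^sup>2 + 141376 * T\<^sup>2 * (cmod (R y))\<^sup>2"
        by (simp add: power2_eq_square algebra_simps)
    qed (use i in auto)
    also have "\<dots> = X / 4 + 141376 * T\<^sup>2 * r"
      using i by (simp add: r_def X_def)
    finally show ?thesis .
  qed
  finally show ?thesis
    unfolding X_def r_def by simp
qed

subsection \<open>Evolution of a single mode in the shear direction\<close>

lemma fcoef_add:
  "square_integrable f \<Longrightarrow> square_integrable g \<Longrightarrow> fcoef (\<lambda>x. f x + g x) l = fcoef f l + fcoef g l"
  by (simp add: fcoef_def distrib_right integrable_fcoef)

lemma fcoef_diff: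
  "square_integrable f \<Longrightarrow> square_integrable g \<Longrightarrow> fcoef (\<lambda>x. f x - g x) l = fcoef f l - fcoef g l"
  by (simp add: fcoef_def left_diff_distrib integrable_fcoef)

lemma fcoef_cmult: "fcoef (\<lambda>x. c * f x) l = c * fcoef f l"
  by (simp add: fcoef_def mult.assoc)

lemma fcoef_sum:
  assumes "\<And>i. i \<in> S \<Longrightarrow> square_integrable (f i)"
  shows "fcoef (\<lambda>x. \<Sum>i\<in>S. f i x) l = (\<Sum>i\<in>S. fcoef (f i) l)"
  unfolding fcoef_def sum_distrib_right
  by (rule Bochner_Integration.integral_sum) (intro integrable_fcoef assms)

lemma fcoef_bound:
  assumes "square_integrable h"
  shows "(cmod (fcoef h l))\<^sup>2 \<le> sqnorm h"
  using bessel[OF assms, of "{l}"] by simp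

lemma tendsto_zero_power2D:
  fixes f :: "'a \<Rightarrow> complex"
  assumes "((\<lambda>x. (cmod (f x))\<^sup>2) \<longlongrightarrow> 0) F"
  shows "(f \<longlongrightarrow> 0) F"
proof -
  have "((\<lambda>x. sqrt ((cmod (f x))\<^sup>2)) \<longlongrightarrow> sqrt 0) F"
    by (intro tendsto_intros assms)
  then show ?thesis by (simp add: tendsto_norm_zero_iff)
qed

text \<open>One x-mode of a weak solution, recorded through its Fourier coefficients in y. The
  coefficients of b g couple all frequencies l, so the system does not close on a finite set of
  them.\<close>

locale shear_mode =
  fixes b :: "real \<Rightarrow> real" and \<nu> :: real and k :: int and g :: "real \<Rightarrow> real \<Rightarrow> complex"
  assumes b_cont: "continuous_on UNIV b" and b_per: "periodic1 b" and \<nu>: "\<nu> > 0"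
    and sq: "\<And>t. t \<ge> 0 \<Longrightarrow> square_integrable (g t)"
    and cont: "\<And>t. t \<ge> 0 \<Longrightarrow> ((\<lambda>s. \<integral>y. (cmod (g s y - g t y))\<^sup>2 \<partial>circle) \<longlongrightarrow> 0) (at t within {0..})"
    and evolution: "\<And>l t. t \<ge> 0 \<Longrightarrow>
      ((\<lambda>s. - (4 * pi\<^sup>2 * \<nu> * (of_int k ^ 2 + of_int l ^ 2)) * fcoef (g s) l
         - 2 * pi * \<i> * of_int k * fcoef (\<lambda>y. b y * g s y) l)
       has_integral (fcoef (g t) l - fcoef (g 0) l)) {0..t}"
begin

definition c where "c l t = fcoef (g t) l"
definition d where "d l t = fcoef (\<lambda>y. b y * g t y) l"
definition c' where "c' l t = - (4 * pi\<^sup>2 * \<nu> * (of_int k ^ 2 + of_int l ^ 2)) * c l t - 2 * pi * \<i> * of_int k * d l t"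
definition mass where "mass t = sqnorm (g t)"
definition f where "f L t = trig_poly (freqs L) (\<lambda>l. c l t)"
text \<open>With P the projection onto \<open>freqs L\<close>, this is b (P g) - P (b g), the
  commutator of multiplication by b and P applied to g(t).\<close>

definition commutator where "commutator L t y = b y * f L t y - trig_poly (freqs L) (\<lambda>l. d l t) y"
definition err where "err L t = sqnorm (commutator L t)"
definition mass_trunc where "mass_trunc L t = (\<Sum>l\<in>freqs L. (cmod (c l t))\<^sup>2)"
definition bmax where "bmax = (SOME B. \<forall>y. \<bar>b y\<bar> \<le> B)"

lemma bmax: "\<bar>b y\<bar> \<le> bmax"
proof -
  have "\<exists>B. \<forall>y. \<bar>b y\<bar> \<le> B"
    using periodic1_bounded[OF b_per b_cont] by (metis real_norm_def)
  then show ?thesis unfolding bmax_def by (rule someI2_ex) blast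
qed

lemma sq_b:
  fixes h :: "real \<Rightarrow> complex"
  assumes "square_integrable h"
  shows "square_integrable (\<lambda>y. b y * h y)"
  by (rule square_integrable_mult_bounded[OF assms, of _ bmax])
    (use bmax in \<open>auto intro!: measurable_circle_continuous continuous_intros continuous_on_subset[OF b_cont]\<close>)

lemma integral_b_sq:
  fixes h :: "real \<Rightarrow> complex"
  assumes "square_integrable h"
  shows "sqnorm (\<lambda>y. b y * h y) \<le> bmax\<^sup>2 * sqnorm h"
proof -
  have "sqnorm (\<lambda>y. b y * h y) \<le> (\<integral>y. bmax\<^sup>2 * (cmod (h y))\<^sup>2 \<partial>circle)"
  proof (intro integral_mono square_integrable_norm sq_b assms integrable_mult_right)
    fix y
    have "\<bar>b y\<bar>\<^sup>2 \<le> bmax\<^sup>2" by (intro power_mono bmax) auto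
    then show "(cmod (b y * h y))\<^sup>2 \<le> bmax\<^sup>2 * (cmod (h y))\<^sup>2"
      by (simp add: norm_mult power_mult_distrib mult_right_mono)
  qed
  then show ?thesis by simp
qed

section \<open>Regularity in time of the coefficients and of the mass\<close>

lemma continuous_c: "continuous_on {0..} (c l)"
  unfolding continuous_on_def
proof
  fix t :: real assume t: "t \<in> {0..}"
  have "((\<lambda>s. (cmod (c l s - c l t))\<^sup>2) \<longlongrightarrow> 0) (at t within {0..})"
  proof (rule tendsto_sandwich[OF _ _ tendsto_const])
    show "((\<lambda>s. \<integral>y. (cmod (g s y - g t y))\<^sup>2 \<partial>circle) \<longlongrightarrow> 0) (at t within {0..})"
      using cont t by simp
    show "\<forall>\<^sub>F s in at t within {0..}. (cmod (c l s - c l t))\<^sup>2 \<le> sqnorm (\<lambda>y. g s y - g t y)"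
      unfolding eventually_at_filter c_def
      using fcoef_bound[OF square_integrable_diff[OF sq sq]] t
      by (auto intro!: always_eventually simp: fcoef_diff[OF sq sq])
  qed auto
  then have "((\<lambda>s. c l s - c l t) \<longlongrightarrow> 0) (at t within {0..})"
    by (rule tendsto_zero_power2D)
  then show "(c l \<longlongrightarrow> c l t) (at t within {0..})"
    by (simp add: LIM_zero_iff)
qed

lemma continuous_d: "continuous_on {0..} (d l)"
  unfolding continuous_on_def
proof
  fix t :: real assume t: "t \<in> {0..}"
  have "((\<lambda>s. (cmod (d l s - d l t))\<^sup>2) \<longlongrightarrow> 0) (at t within {0..})"
  proof (rule tendsto_sandwich[OF _ _ tendsto_const])
    show "((\<lambda>s. bmax\<^sup>2 * sqnorm (\<lambda>y. g s y - g t y)) \<longlongrightarrow> 0) (at t within {0..})"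
      using tendsto_mult_right_zero[OF cont, of t] t by simp
    have "(cmod (d l s - d l t))\<^sup>2 \<le> bmax\<^sup>2 * sqnorm (\<lambda>y. g s y - g t y)" if "s \<ge> 0" for s
    proof -
      have s: "square_integrable (g s)" "square_integrable (g t)" using sq that t by auto
      have "d l s - d l t = fcoef (\<lambda>y. b y * (g s y - g t y)) l"
        unfolding d_def using s by (simp add: right_diff_distrib fcoef_diff sq_b)
      then show ?thesis
        using fcoef_bound[OF sq_b[OF square_integrable_diff[OF s]], of l] integral_b_sq[OF square_integrable_diff[OF s]]
        by simp
    qed
    then show "\<forall>\<^sub>F s in at t within {0..}. (cmod (d l s - d l t))\<^sup>2 \<le> bmax\<^sup>2 * sqnorm (\<lambda>y. g s y - g t y)"
      unfolding eventually_at_filter by (auto intro!: always_eventually)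
  qed auto
  then have "((\<lambda>s. d l s - d l t) \<longlongrightarrow> 0) (at t within {0..})"
    by (rule tendsto_zero_power2D)
  then show "(d l \<longlongrightarrow> d l t) (at t within {0..})"
    by (simp add: LIM_zero_iff)
qed

lemma continuous_c': "continuous_on {0..} (c' l)"
  unfolding c'_def by (intro continuous_intros continuous_c continuous_d)

lemma mass_nonneg: "mass t \<ge> 0"
  by (simp add: mass_def)

lemma mass_compare:
  assumes "s \<ge> 0" "t \<ge> 0" "\<epsilon> > 0"
  shows "\<bar>mass s - mass t\<bar> \<le> \<epsilon> * mass t + (1 + 1 / \<epsilon>) * sqnorm (\<lambda>y. g s y - g t y)"
proof -
  let ?\<delta> = "\<integral>y. (cmod (g s y - g t y))\<^sup>2 \<partial>circle"
  have i: "integrable circle (\<lambda>y. (cmod (g s y))\<^sup>2)" "integrable circle (\<lambda>y. (cmod (g t y))\<^sup>2)"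
    "integrable circle (\<lambda>y. (cmod (g s y - g t y))\<^sup>2)"
    by (intro square_integrable_norm square_integrable_diff sq assms)+
  have pt: "\<bar>(norm u)\<^sup>2 - (norm v)\<^sup>2\<bar> \<le> \<epsilon> * (norm v)\<^sup>2 + (1 + 1 / \<epsilon>) * (norm (u - v))\<^sup>2" for u v :: complex
  proof -
    have "\<bar>norm u - norm v\<bar> \<le> norm (u - v)" by (rule norm_triangle_ineq3)
    then have "\<bar>norm u - norm v\<bar> * (norm u + norm v) \<le> norm (u - v) * (2 * norm v + norm (u - v))"
      using norm_triangle_ineq2[of u v] by (intro mult_mono) auto
    moreover have "\<bar>(norm u)\<^sup>2 - (norm v)\<^sup>2\<bar> = \<bar>norm u - norm v\<bar> * (norm u + norm v)"
    proof -
      have "(norm u)\<^sup>2 - (norm v)\<^sup>2 = (norm u - norm v) * (norm u + norm v)"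
        by (simp add: power2_eq_square algebra_simps)
      then show ?thesis by (simp add: abs_mult)
    qed
    moreover have "0 \<le> (\<epsilon> * norm v - norm (u - v))\<^sup>2 / \<epsilon>" using assms by simp
    moreover have "(\<epsilon> * norm v - norm (u - v))\<^sup>2 / \<epsilon> = \<epsilon> * (norm v)\<^sup>2 - 2 * norm v * norm (u - v) + 1 / \<epsilon> * (norm (u - v))\<^sup>2"
      using assms by (simp add: power2_eq_square field_simps)
    ultimately show ?thesis by (simp add: power2_eq_square algebra_simps)
  qed
  have "\<bar>mass s - mass t\<bar> = \<bar>\<integral>y. (cmod (g s y))\<^sup>2 - (cmod (g t y))\<^sup>2 \<partial>circle\<bar>"
    unfolding mass_def using i by simp
  also have "\<dots> \<le> (\<integral>y. \<epsilon> * (cmod (g t y))\<^sup>2 + (1 + 1 / \<epsilon>) * (cmod (g s y - g t y))\<^sup>2 \<partial>circle)"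
    by (rule order_trans[OF integral_abs_bound integral_mono]) (use i pt in auto)
  also have "\<dots> = \<epsilon> * mass t + (1 + 1 / \<epsilon>) * ?\<delta>"
    unfolding mass_def using i by simp
  finally show ?thesis .
qed

lemma continuous_mass: "continuous_on {0..} mass"
  unfolding continuous_on_def tendsto_iff dist_real_def
proof (intro ballI allI impI)
  fix t e :: real assume t: "t \<in> {0..}" and e: "e > 0"
  \<comment> \<open>The added 1 keeps the denominator positive when the mass is zero.\<close>
  define \<epsilon> where "\<epsilon> = e / (2 * (mass t + 1))"
  have pos: "\<epsilon> > 0" using e mass_nonneg[of t] by (simp add: \<epsilon>_def)
  have 1: "\<epsilon> * mass t \<le> e / 2"
    using e mass_nonneg[of t] by (simp add: \<epsilon>_def field_simps)
  have "((\<lambda>s. (1 + 1 / \<epsilon>) * sqnorm (\<lambda>y. g s y - g t y)) \<longlongrightarrow> 0) (at t within {0..})"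
    using tendsto_mult_right_zero[OF cont, of t] t by simp
  then have "\<forall>\<^sub>F s in at t within {0..}. (1 + 1 / \<epsilon>) * sqnorm (\<lambda>y. g s y - g t y) < e / 2"
    by (rule order_tendstoD(2)) (use e in simp)
  moreover have "\<forall>\<^sub>F s in at t within {0..}. s \<in> {0..}"
    by (simp add: eventually_at_filter)
  ultimately show "\<forall>\<^sub>F s in at t within {0..}. \<bar>mass s - mass t\<bar> < e"
  proof eventually_elim
    case (elim s)
    have "\<bar>mass s - mass t\<bar> \<le> \<epsilon> * mass t + (1 + 1 / \<epsilon>) * sqnorm (\<lambda>y. g s y - g t y)"
      by (rule mass_compare) (use elim(2) t pos in auto)
    then show ?case using elim(1) 1 by linarith
  qed
qed

text \<open>The integrand of the integrated equation is continuous in time, so each coefficient has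
  a classical derivative, one-sided at the ends of the interval.\<close>

lemma has_vector_derivative_c:
  assumes "t \<in> {0..T}"
  shows "(c l has_vector_derivative c' l t) (at t within {0..T})"
proof -
  have "((\<lambda>t. integral {0..t} (c' l)) has_vector_derivative c' l t) (at t within {0..T})"
    by (rule integral_has_vector_derivative[OF continuous_on_subset[OF continuous_c'] assms]) auto
  then have "((\<lambda>t. c l 0 + integral {0..t} (c' l)) has_vector_derivative c' l t) (at t within {0..T})"
    by (auto intro!: derivative_eq_intros)
  moreover have "c l s = c l 0 + integral {0..s} (c' l)" if "s \<in> {0..T}" for s
  proof -
    have "(c' l has_integral (c l s - c l 0)) {0..s}"
      using evolution[of s l] that unfolding c'_def c_def d_def by simp
    then show ?thesis by (simp add: integral_unique)
  qed
  ultimately show ?thesis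
    using assms by (metis (no_types, lifting) has_vector_derivative_transform)
qed

section \<open>Truncation in the frequencies of y and its error\<close>

lemma mass_trunc_eq: "mass_trunc L t = sqnorm (f L t)"
  by (simp add: mass_trunc_def f_def integral_trig_poly_sq)

lemma mass_trunc_le: "t \<ge> 0 \<Longrightarrow> mass_trunc L t \<le> mass t"
  unfolding mass_trunc_def c_def mass_def by (intro bessel sq finite_freqs)

lemma mass_trunc_nonneg: "mass_trunc L t \<ge> 0"
  unfolding mass_trunc_def by (intro sum_nonneg) auto

lemma mass_trunc_lim: "t \<ge> 0 \<Longrightarrow> (\<lambda>L. mass_trunc L t) \<longlonglongrightarrow> mass t"
  unfolding mass_trunc_def c_def mass_def by (intro parseval sq)

lemma continuous_mass_trunc: "continuous_on {0..} (mass_trunc L)"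
  unfolding mass_trunc_def by (intro continuous_intros continuous_c)

lemma continuous_f: "continuous_on A (f L t)"
  unfolding f_def by (intro continuous_intros)

lemma continuous_commutator: "continuous_on A (commutator L t)"
  unfolding commutator_def by (intro continuous_intros continuous_f continuous_on_subset[OF b_cont]) auto

lemma continuous_b_snd: "continuous_on A (\<lambda>p. b (snd p))"
  by (intro continuous_on_compose2[OF b_cont] continuous_intros) auto

lemma continuous_f_joint: "continuous_on ({0..} \<times> A) (\<lambda>p. f L (fst p) (snd p))"
  unfolding f_def trig_poly_def
  by (intro continuous_intros continuous_on_compose2[OF continuous_c]) auto

lemma continuous_commutator_joint: "continuous_on ({0..} \<times> A) (\<lambda>p. commutator L (fst p) (snd p))"
  unfolding commutator_def trig_poly_def
  by (intro continuous_intros continuous_f_joint continuous_b_snd continuous_on_compose2[OF continuous_d]) auto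

lemma err_nonneg: "err L t \<ge> 0"
  by (simp add: err_def)

text \<open>The commutator is the Fourier tail of b g minus b times the Fourier tail of g, so
  completeness for these two functions makes it small.\<close>

lemma err_le:
  assumes t: "t \<ge> 0"
  shows "err L t \<le> 2 * bmax\<^sup>2 * sqnorm (\<lambda>y. g t y - f L t y)
    + 2 * sqnorm (\<lambda>y. b y * g t y - trig_poly (freqs L) (\<lambda>l. d l t) y)"
proof -
  have s: "square_integrable (\<lambda>y. g t y - f L t y)"
    "square_integrable (\<lambda>y. b y * g t y - trig_poly (freqs L) (\<lambda>l. d l t) y)"
    using sq[OF t] sq_b[OF sq[OF t]]
    by (auto intro!: square_integrable_diff square_integrable_trig_poly simp: f_def)
  have "err L t \<le> (\<integral>y. 2 * (cmod (b y * (g t y - f L t y)))\<^sup>2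
      + 2 * (cmod (b y * g t y - trig_poly (freqs L) (\<lambda>l. d l t) y))\<^sup>2 \<partial>circle)"
    unfolding err_def
  proof (rule integral_mono)
    show "integrable circle (\<lambda>y. (cmod (commutator L t y))\<^sup>2)"
      by (intro integrable_circle_continuous continuous_intros continuous_commutator)
    fix y
    have "commutator L t y = (b y * g t y - trig_poly (freqs L) (\<lambda>l. d l t) y) - b y * (g t y - f L t y)"
      by (simp add: commutator_def algebra_simps)
    then show "(cmod (commutator L t y))\<^sup>2 \<le> 2 * (cmod (b y * (g t y - f L t y)))\<^sup>2
      + 2 * (cmod (b y * g t y - trig_poly (freqs L) (\<lambda>l. d l t) y))\<^sup>2"
      using norm_diff_sq_le2 by (metis add.commute)
  qed (use s sq_b[OF s(1)] in \<open>auto simp: square_integrable_norm simp del: norm_mult\<close>)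
  also have "\<dots> = 2 * sqnorm (\<lambda>y. b y * (g t y - f L t y))
     + 2 * sqnorm (\<lambda>y. b y * g t y - trig_poly (freqs L) (\<lambda>l. d l t) y)"
    using square_integrable_norm[OF s(2)] square_integrable_norm[OF sq_b[OF s(1)]] by simp
  finally show ?thesis
    using integral_b_sq[OF s(1)] by simp
qed

lemma err_lim:
  assumes t: "t \<ge> 0"
  shows "(\<lambda>L. err L t) \<longlonglongrightarrow> 0"
proof (rule tendsto_sandwich[OF _ _ tendsto_const])
  have "(\<lambda>L. 2 * bmax\<^sup>2 * sqnorm (\<lambda>y. g t y - f L t y)
    + 2 * sqnorm (\<lambda>y. b y * g t y - trig_poly (freqs L) (\<lambda>l. d l t) y)) \<longlonglongrightarrow> 2 * bmax\<^sup>2 * 0 + 2 * 0"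
    unfolding f_def c_def d_def
    using fourier_partial_sums[OF sq[OF t]] fourier_partial_sums[OF sq_b[OF sq[OF t]]]
    by (intro tendsto_intros) auto
  then show "(\<lambda>L. 2 * bmax\<^sup>2 * sqnorm (\<lambda>y. g t y - f L t y)
    + 2 * sqnorm (\<lambda>y. b y * g t y - trig_poly (freqs L) (\<lambda>l. d l t) y)) \<longlonglongrightarrow> 0" by simp
qed (auto intro!: always_eventually err_le t err_nonneg)

text \<open>Uniform in L: this is the dominating bound when the truncation is removed under time
  integrals.\<close>

lemma err_bound:
  assumes t: "t \<ge> 0"
  shows "err L t \<le> 4 * bmax\<^sup>2 * mass t"
proof -
  have "sqnorm (\<lambda>y. h y - trig_poly (freqs L) (fcoef h) y) \<le> sqnorm h"
    if "square_integrable h" for h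
    using integral_diff_trig_poly_sq[OF that finite_freqs, of L "fcoef h"]
      sum_nonneg[of "freqs L" "\<lambda>l. (cmod (fcoef h l))\<^sup>2"] by simp
  from this[OF sq[OF t]] this[OF sq_b[OF sq[OF t]]]
  have 1: "sqnorm (\<lambda>y. g t y - f L t y) \<le> mass t"
    and 2: "sqnorm (\<lambda>y. b y * g t y - trig_poly (freqs L) (\<lambda>l. d l t) y) \<le> bmax\<^sup>2 * mass t"
    using integral_b_sq[OF sq[OF t]] by (auto simp: f_def c_def[abs_def] d_def[abs_def] mass_def)
  have "2 * bmax\<^sup>2 * sqnorm (\<lambda>y. g t y - f L t y) \<le> 2 * bmax\<^sup>2 * mass t"
    using 1 by (intro mult_left_mono) auto
  with 2 err_le[OF t, of L] show ?thesis by simp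
qed

section \<open>Energy inequality and monotonicity of the mass\<close>

lemma continuous_circle_integral:
  fixes F :: "real \<Rightarrow> real \<Rightarrow> real"
  assumes "continuous_on (U \<times> {0..1}) (\<lambda>p. F (fst p) (snd p))"
  shows "continuous_on U (\<lambda>t. \<integral>y. F t y \<partial>circle)"
proof -
  have *: "continuous_on {0..1} (F t)" if "t \<in> U" for t
  proof -
    have "continuous_on {0..1} (\<lambda>y. F (fst (t, y)) (snd (t, y)))"
      by (rule continuous_on_compose2[OF assms]) (use that in \<open>auto intro!: continuous_intros\<close>)
    then show ?thesis by simp
  qed
  have "continuous_on U (\<lambda>t. integral (cbox 0 1) (F t))"
    by (rule integral_continuous_on_param) (use assms in \<open>simp add: case_prod_beta\<close>)
  then show ?thesis
    by (rule continuous_on_eq) (simp add: integral_circle_eq[OF *])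
qed

lemma continuous_err: "continuous_on {0..} (err L)"
  unfolding err_def
  by (intro continuous_circle_integral continuous_intros continuous_commutator_joint)

text \<open>Diffusion has a sign, and the integral of b \<bar>f\<bar> squared is real, so transport
  contributes only through the commutator. The parameter \<epsilon> is left free, with D independent
  of it, so that the commutator can be sent to 0 before \<epsilon>.\<close>

lemma mass_trunc_derivative:
  assumes t: "t \<in> {0..T}"
  shows "\<exists>D. (mass_trunc L has_vector_derivative D) (at t within {0..T}) \<and>
     (\<forall>\<epsilon>>0. D \<le> 4 * pi * \<bar>of_int k\<bar> * (\<epsilon> * mass t + err L t / \<epsilon>))"
proof -
  let ?S = "freqs L"
  define D where "D = (\<Sum>l\<in>?S. 2 * Re (c' l t * cnj (c l t)))"
  have "((\<lambda>t. Re (c l t * cnj (c l t))) has_vector_derivative Re (c l t * cnj (c' l t) + c' l t * cnj (c l t))) (at t within {0..T})" for l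
    by (intro bounded_linear.has_vector_derivative[OF bounded_linear_Re] has_vector_derivative_mult
        has_vector_derivative_cnj has_vector_derivative_c t)
  moreover have "Re (c l t * cnj (c' l t) + c' l t * cnj (c l t)) = 2 * Re (c' l t * cnj (c l t))" for l
    by simp
  moreover have "Re (c l t * cnj (c l t)) = (cmod (c l t))\<^sup>2" for l t
    by (simp only: complex_norm_square[symmetric] Re_complex_of_real)
  ultimately have "((\<lambda>t. (cmod (c l t))\<^sup>2) has_vector_derivative 2 * Re (c' l t * cnj (c l t))) (at t within {0..T})" for l
    by (simp only:)
  then have "(mass_trunc L has_vector_derivative D) (at t within {0..T})"
    unfolding D_def mass_trunc_def by (intro has_vector_derivative_sum)
  moreover have "D \<le> 4 * pi * \<bar>of_int k\<bar> * (\<epsilon> * mass t + err L t / \<epsilon>)" if \<epsilon>: "\<epsilon> > 0" for \<epsilon>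
  proof -
    have t0: "t \<ge> 0" using t by simp
    define Y where "Y = (\<integral>y. commutator L t y * cnj (f L t y) \<partial>circle)"
    have i: "integrable circle (\<lambda>y. of_real (b y * (cmod (f L t y))\<^sup>2) :: complex)"
      "integrable circle (\<lambda>y. commutator L t y * cnj (f L t y))"
      by (intro integrable_circle_continuous continuous_intros continuous_f continuous_commutator continuous_on_subset[OF b_cont]; simp)+
    have "(\<Sum>l\<in>?S. d l t * cnj (c l t)) = (\<integral>y. trig_poly ?S (\<lambda>l. d l t) y * cnj (f L t y) \<partial>circle)"
      unfolding f_def
      by (subst integral_mult_cnj_trig_poly[OF square_integrable_trig_poly])
        (auto simp: fcoef_trig_poly mult.commute intro: sum.cong)
    also have "\<dots> = (\<integral>y. of_real (b y * (cmod (f L t y))\<^sup>2) - commutator L t y * cnj (f L t y) \<partial>circle)"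
      unfolding commutator_def of_real_mult complex_norm_square by (simp add: algebra_simps)
    also have "\<dots> = of_real (\<integral>y. b y * (cmod (f L t y))\<^sup>2 \<partial>circle) - Y"
      unfolding Y_def Bochner_Integration.integral_diff[OF i] integral_complex_of_real ..
    finally have sum: "(\<Sum>l\<in>?S. d l t * cnj (c l t)) = of_real (\<integral>y. b y * (cmod (f L t y))\<^sup>2 \<partial>circle) - Y" .
    have deriv: "2 * Re (c' l t * cnj (c l t)) = - (8 * pi\<^sup>2 * \<nu> * (of_int k ^ 2 + of_int l ^ 2) * (cmod (c l t))\<^sup>2)
       + 4 * pi * of_int k * Im (d l t * cnj (c l t))" for l
      unfolding c'_def cmod_power2 by (simp add: algebra_simps power2_eq_square)
    have "D = - (\<Sum>l\<in>?S. 8 * pi\<^sup>2 * \<nu> * (of_int k ^ 2 + of_int l ^ 2) * (cmod (c l t))\<^sup>2)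
       + 4 * pi * of_int k * Im (\<Sum>l\<in>?S. d l t * cnj (c l t))"
      unfolding D_def Im_sum sum_distrib_left sum_negf[symmetric] sum.distrib[symmetric]
      by (intro sum.cong refl deriv)
    also have "\<dots> \<le> 4 * pi * of_int k * Im (\<Sum>l\<in>?S. d l t * cnj (c l t))"
      using \<nu> by (simp add: sum_nonneg)
    also have "\<dots> = 4 * pi * (of_int k * - Im Y)"
      by (simp add: sum)
    also have "\<dots> \<le> 4 * pi * (\<bar>of_int k\<bar> * cmod Y)"
    proof (intro mult_left_mono)
      have "of_int k * - Im Y \<le> \<bar>of_int k\<bar> * \<bar>Im Y\<bar>"
        by (metis abs_ge_self abs_minus_cancel abs_mult)
      also have "\<dots> \<le> \<bar>of_int k\<bar> * cmod Y"
        by (intro mult_left_mono abs_Im_le_cmod) auto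
      finally show "of_int k * - Im Y \<le> \<bar>of_int k\<bar> * cmod Y" .
    qed auto
    also have "cmod Y \<le> \<epsilon> * mass t + err L t / \<epsilon>"
    proof -
      have j: "integrable circle (\<lambda>y. (cmod (f L t y))\<^sup>2)" "integrable circle (\<lambda>y. (cmod (commutator L t y))\<^sup>2)"
        by (intro integrable_circle_continuous continuous_intros continuous_f continuous_commutator)+
      have "cmod Y \<le> (\<integral>y. cmod (commutator L t y * cnj (f L t y)) \<partial>circle)"
        unfolding Y_def by (rule integral_norm_bound)
      also have "\<dots> \<le> (\<integral>y. \<epsilon> * (cmod (f L t y))\<^sup>2 + (cmod (commutator L t y))\<^sup>2 / \<epsilon> \<partial>circle)"
      proof (rule integral_mono)
        fix y
        have "0 \<le> (\<epsilon> * cmod (f L t y) - cmod (commutator L t y))\<^sup>2 / \<epsilon>" using \<epsilon> by simp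
        also have "\<dots> = \<epsilon> * (cmod (f L t y))\<^sup>2 + (cmod (commutator L t y))\<^sup>2 / \<epsilon> - 2 * (cmod (commutator L t y) * cmod (f L t y))"
          using \<epsilon> by (simp add: power2_eq_square field_simps)
        finally have "2 * (cmod (commutator L t y) * cmod (f L t y)) \<le> \<epsilon> * (cmod (f L t y))\<^sup>2 + (cmod (commutator L t y))\<^sup>2 / \<epsilon>" by simp
        moreover have "0 \<le> cmod (commutator L t y) * cmod (f L t y)" by simp
        ultimately show "cmod (commutator L t y * cnj (f L t y)) \<le> \<epsilon> * (cmod (f L t y))\<^sup>2 + (cmod (commutator L t y))\<^sup>2 / \<epsilon>"
          unfolding norm_mult complex_mod_cnj by linarith
      qed (use i j in \<open>auto simp del: norm_mult\<close>)
      also have "\<dots> = \<epsilon> * mass_trunc L t + err L t / \<epsilon>"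
        unfolding mass_trunc_eq err_def using j by simp
      also have "\<dots> \<le> \<epsilon> * mass t + err L t / \<epsilon>"
        using mass_trunc_le[OF t0] \<epsilon> by (intro add_mono mult_left_mono) auto
      finally show ?thesis .
    qed
    finally show ?thesis by (simp add: mult.assoc mult_left_mono)
  qed
  ultimately show ?thesis by blast
qed

text \<open>For fixed \<epsilon> the limit in L removes the commutator; the remaining increment is a
  multiple of \<epsilon>, which then tends to 0 from the right.\<close>

lemma mass_antimono:
  assumes st: "0 \<le> s" "s \<le> t"
  shows "mass t \<le> mass s"
proof -
  have sub: "{s..t} \<subseteq> {0..}" using st by auto
  \<comment> \<open>Monotonicity is not yet known, so the uniform bound on the mass comes from
    continuity on a compact interval.\<close>
  obtain M where M: "\<And>r. r \<in> {s..t} \<Longrightarrow> mass r \<le> M" "M \<ge> 0"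
  proof -
    have "compact (mass ` {s..t})"
      by (intro compact_continuous_image continuous_on_subset[OF continuous_mass] sub) auto
    then obtain M where "\<And>z. z \<in> mass ` {s..t} \<Longrightarrow> \<bar>z\<bar> \<le> M"
      using compact_imp_bounded bounded_iff by (metis real_norm_def)
    then have "\<And>r. r \<in> {s..t} \<Longrightarrow> mass r \<le> \<bar>M\<bar>" by fastforce
    then show ?thesis by (rule that) auto
  qed
  define A where "A = 4 * pi * \<bar>of_int k :: real\<bar>"
  have A: "A \<ge> 0" by (simp add: A_def)
  have errint: "err L integrable_on {s..t}" for L
    by (intro integrable_continuous_real continuous_on_subset[OF continuous_err] sub)
  have step: "mass_trunc L t - mass_trunc L s \<le> A * (\<epsilon> * M * (t - s) + integral {s..t} (err L) / \<epsilon>)" if \<epsilon>: "\<epsilon> > 0" for L \<epsilon>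
  proof -
    obtain D where D: "\<And>r. r \<in> {0..t} \<Longrightarrow> (mass_trunc L has_vector_derivative D r) (at r within {0..t})"
      "\<And>r \<epsilon>. r \<in> {0..t} \<Longrightarrow> \<epsilon> > 0 \<Longrightarrow> D r \<le> A * (\<epsilon> * mass r + err L r / \<epsilon>)"
      using mass_trunc_derivative[of _ t L] unfolding A_def by metis
    have 1: "(D has_integral (mass_trunc L t - mass_trunc L s)) {s..t}"
      by (rule fundamental_theorem_of_calculus[OF st(2)])
        (rule has_vector_derivative_within_subset[OF D(1)], use st in auto)
    have 2: "((\<lambda>r. A * (\<epsilon> * M + err L r / \<epsilon>)) has_integral A * ((t - s) *\<^sub>R (\<epsilon> * M) + integral {s..t} (err L) / \<epsilon>)) {s..t}"
      using has_integral_const_real[of "\<epsilon> * M" s t] st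
      by (intro has_integral_mult_right has_integral_add has_integral_divide integrable_integral errint) auto
    have "mass_trunc L t - mass_trunc L s \<le> A * ((t - s) *\<^sub>R (\<epsilon> * M) + integral {s..t} (err L) / \<epsilon>)"
    proof (rule has_integral_le[OF 1 2])
      fix r assume r: "r \<in> {s..t}"
      have "D r \<le> A * (\<epsilon> * mass r + err L r / \<epsilon>)" using D(2) r st \<epsilon> by auto
      also have "\<dots> \<le> A * (\<epsilon> * M + err L r / \<epsilon>)"
        using M(1)[OF r] A \<epsilon> by (intro mult_left_mono add_mono) auto
      finally show "D r \<le> A * (\<epsilon> * M + err L r / \<epsilon>)" .
    qed
    then show ?thesis by (simp add: mult_ac)
  qed
  have errlim: "(\<lambda>L. integral {s..t} (err L)) \<longlonglongrightarrow> integral {s..t} (\<lambda>r. 0 :: real)"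
  proof (rule dominated_convergence(2)[OF errint])
    show "(\<lambda>r. 4 * bmax\<^sup>2 * M) integrable_on {s..t}" by (rule integrable_const_ivl)
    show "norm (err L r) \<le> 4 * bmax\<^sup>2 * M" if "r \<in> {s..t}" for L r
    proof -
      have "err L r \<le> 4 * bmax\<^sup>2 * mass r" using err_bound that st by auto
      also have "\<dots> \<le> 4 * bmax\<^sup>2 * M" using M(1)[OF that] by (intro mult_left_mono) auto
      finally show ?thesis using err_nonneg[of L r] by simp
    qed
    show "(\<lambda>L. err L r) \<longlonglongrightarrow> 0" if "r \<in> {s..t}" for r
      using err_lim that st by auto
  qed
  have "mass t - mass s \<le> A * (\<epsilon> * M * (t - s))" if \<epsilon>: "\<epsilon> > 0" for \<epsilon>
  proof -
    have "(\<lambda>L. A * (\<epsilon> * M * (t - s) + integral {s..t} (err L) / \<epsilon>)) \<longlonglongrightarrow> A * (\<epsilon> * M * (t - s) + integral {s..t} (\<lambda>r. 0 :: real) / \<epsilon>)"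
      by (intro tendsto_intros errlim) (use \<epsilon> in auto)
    moreover have "(\<lambda>L. mass_trunc L t - mass_trunc L s) \<longlonglongrightarrow> mass t - mass s"
      using st by (intro tendsto_intros mass_trunc_lim) auto
    ultimately have "mass t - mass s \<le> A * (\<epsilon> * M * (t - s) + integral {s..t} (\<lambda>r. 0 :: real) / \<epsilon>)"
      using step[OF \<epsilon>] by (intro LIMSEQ_le) auto
    then show ?thesis by simp
  qed
  then have "\<forall>\<^sub>F \<epsilon> in at_right 0. mass t - mass s \<le> A * (\<epsilon> * M * (t - s))"
    by (simp add: eventually_at_filter)
  moreover have "((\<lambda>\<epsilon>. A * (\<epsilon> * M * (t - s))) \<longlongrightarrow> A * (0 * M * (t - s))) (at_right 0)"
    by (intro tendsto_intros)
  ultimately have "mass t - mass s \<le> A * (0 * M * (t - s))"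
    by (intro tendsto_lowerbound[of _ _ "at_right (0::real)"]) auto
  then show ?thesis by simp
qed

end

section \<open>From the resolvent bound to exponential decay\<close>

context shear_mode
begin

text \<open>
  Time Fourier coefficients on \<open>[s, s + \<tau>]\<close> against the window \<open>sin (\<pi> r)\<close>, \<open>r = (t - s) / \<tau>\<close>, which
  vanishes at both ends, so that no boundary terms appear.
\<close>

lemma windowed_coefficient:
  assumes s: "s \<ge> 0" and \<tau>: "\<tau> > 0"
  shows "(4 * pi\<^sup>2 * \<nu> * (of_int k ^ 2 + of_int l ^ 2) + 2 * pi * \<i> * of_int n / \<tau>)
      * fcoef (\<lambda>r. sin (pi * r) * c l (s + \<tau> * r)) n
    = fcoef (\<lambda>r. pi / \<tau> * cos (pi * r) * c l (s + \<tau> * r)) n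
      - 2 * pi * \<i> * of_int k * fcoef (\<lambda>r. sin (pi * r) * d l (s + \<tau> * r)) n"
proof -
  have pos: "s + \<tau> * r \<ge> 0" if "r \<in> {0..1}" for r using that s \<tau> by auto
  have cc: "continuous_on {0..1} (\<lambda>r. c l (s + \<tau> * r))" "continuous_on {0..1} (\<lambda>r. d l (s + \<tau> * r))"
    "continuous_on {0..1} (\<lambda>r. c' l (s + \<tau> * r))"
    by (intro continuous_on_compose2[OF continuous_c] continuous_on_compose2[OF continuous_d]
        continuous_on_compose2[OF continuous_c'] continuous_intros; use pos in force)+
  define p where "p r = sin (pi * r) * c l (s + \<tau> * r) * fchar (- n) r" for r
  define p1 where "p1 r = \<tau> * (pi / \<tau> * cos (pi * r) * c l (s + \<tau> * r) * cnj (fchar n r))" for r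
  define p2 where "p2 r = \<tau> * (sin (pi * r) * c' l (s + \<tau> * r) * cnj (fchar n r))" for r
  define p3 where "p3 r = - (2 * pi * \<i> * of_int n) * (sin (pi * r) * c l (s + \<tau> * r) * cnj (fchar n r))" for r
  have pc: "continuous_on {0..1} p1" "continuous_on {0..1} p2" "continuous_on {0..1} p3"
    unfolding p1_def p2_def p3_def by (intro continuous_intros cc)+
  have dp: "(p has_vector_derivative p1 r + p2 r + p3 r) (at r within {0..1})" if r: "r \<in> {0..1}" for r
  proof -
    have inner: "((\<lambda>r. s + \<tau> * r) has_vector_derivative \<tau>) (at r within {0..1})"
      by (auto intro!: derivative_eq_intros)
    have "((c l \<circ> (\<lambda>r. s + \<tau> * r)) has_vector_derivative \<tau> *\<^sub>R c' l (s + \<tau> * r)) (at r within {0..1})"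
    proof (rule vector_diff_chain_within[OF inner])
      have "(c l has_vector_derivative c' l (s + \<tau> * r)) (at (s + \<tau> * r) within {0..s + \<tau>})"
        using r s \<tau> by (intro has_vector_derivative_c) (auto simp: mult_left_le)
      then show "(c l has_vector_derivative c' l (s + \<tau> * r)) (at (s + \<tau> * r) within (\<lambda>r. s + \<tau> * r) ` {0..1})"
        by (rule has_vector_derivative_within_subset) (use s \<tau> in \<open>auto simp: mult_left_le\<close>)
    qed
    then have 1: "((\<lambda>r. c l (s + \<tau> * r)) has_vector_derivative \<tau> * c' l (s + \<tau> * r)) (at r within {0..1})"
      by (simp add: o_def scaleR_conv_of_real)
    have "((\<lambda>r. sin (pi * r)) has_real_derivative pi * cos (pi * r)) (at r within {0..1})"
      by (auto intro!: derivative_eq_intros)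
    then have 2: "((\<lambda>r. complex_of_real (sin (pi * r))) has_vector_derivative complex_of_real (pi * cos (pi * r))) (at r within {0..1})"
      by (intro has_vector_derivative_of_real) (simp add: has_real_derivative_iff_has_vector_derivative)
    from has_vector_derivative_mult[OF has_vector_derivative_mult[OF 2 1] has_vector_derivative_fchar[of "- n"]]
    show ?thesis
      unfolding p_def p1_def p2_def p3_def cnj_fchar
      by (rule has_vector_derivative_eq_rhs) (use \<tau> in \<open>simp add: algebra_simps\<close>)
  qed
  have i: "integrable circle p1" "integrable circle p2" "integrable circle p3"
    by (intro integrable_circle_continuous pc)+
  have "(\<integral>r. p1 r + p2 r + p3 r \<partial>circle) = p 1 - p 0"
    by (intro integral_circle_derivative continuous_intros pc dp)
  then have z: "integral\<^sup>L circle p1 + integral\<^sup>L circle p2 + integral\<^sup>L circle p3 = 0"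
    using i by (simp add: p_def)
  define U where "U = fcoef (\<lambda>r. sin (pi * r) * c l (s + \<tau> * r)) n"
  define V where "V = fcoef (\<lambda>r. pi / \<tau> * cos (pi * r) * c l (s + \<tau> * r)) n"
  define D where "D = fcoef (\<lambda>r. sin (pi * r) * d l (s + \<tau> * r)) n"
  define Q where "Q = fcoef (\<lambda>r. sin (pi * r) * c' l (s + \<tau> * r)) n"
  have p: "integral\<^sup>L circle p1 = \<tau> * V" "integral\<^sup>L circle p2 = \<tau> * Q" "integral\<^sup>L circle p3 = - (2 * pi * \<i> * of_int n) * U"
    unfolding p1_def p2_def p3_def V_def Q_def U_def fcoef_def by (simp_all only: integral_mult_right_zero)
  have sqs: "square_integrable (\<lambda>r. sin (pi * r) * c l (s + \<tau> * r))" "square_integrable (\<lambda>r. sin (pi * r) * d l (s + \<tau> * r))"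
    by (intro square_integrable_continuous continuous_intros cc)+
  have "Q = fcoef (\<lambda>r. - (4 * pi\<^sup>2 * \<nu> * (of_int k ^ 2 + of_int l ^ 2)) * (sin (pi * r) * c l (s + \<tau> * r))
      - 2 * pi * \<i> * of_int k * (sin (pi * r) * d l (s + \<tau> * r))) n"
    unfolding Q_def c'_def by (simp add: algebra_simps)
  also have "\<dots> = - (4 * pi\<^sup>2 * \<nu> * (of_int k ^ 2 + of_int l ^ 2)) * U - 2 * pi * \<i> * of_int k * D"
    unfolding U_def D_def by (subst fcoef_diff) (simp_all only: fcoef_cmult square_integrable_cmult sqs)
  finally have Q: "Q = - (4 * pi\<^sup>2 * \<nu> * (of_int k ^ 2 + of_int l ^ 2)) * U - 2 * pi * \<i> * of_int k * D" .
  have "of_real \<tau> * ((4 * pi\<^sup>2 * \<nu> * (of_int k ^ 2 + of_int l ^ 2) + 2 * pi * \<i> * of_int n / \<tau>) * U)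
     = of_real \<tau> * (V - 2 * pi * \<i> * of_int k * D)"
    using z \<tau> unfolding p Q by (simp add: algebra_simps add_eq_0_iff)
  then have "(4 * pi\<^sup>2 * \<nu> * (of_int k ^ 2 + of_int l ^ 2) + 2 * pi * \<i> * of_int n / \<tau>) * U
     = V - 2 * pi * \<i> * of_int k * D"
    using \<tau> by (simp del: of_real_mult)
  then show ?thesis unfolding U_def V_def D_def .
qed

text \<open>The right-hand side of the equation satisfied by the window times the truncated mode:
  the cosine comes from differentiating the window in t, the commutator from truncating.\<close>

definition window_source where
  "window_source s \<tau> L r y = pi / \<tau> * cos (pi * r) * f L (s + \<tau> * r) y
     + 2 * pi * \<i> * of_int k * sin (pi * r) * commutator L (s + \<tau> * r) y"

text \<open>On the n-th time mode d/dt becomes 2 pi i n / \<tau>. With \<kappa> = 2 pi k this equals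
  - i \<kappa> lam for lam = - n / (\<tau> k), so it is absorbed into the spectral
  parameter.\<close>

lemma windowed_resolvent:
  assumes s: "s \<ge> 0" and \<tau>: "\<tau> > 0" and k: "k \<noteq> 0"
  shows "shear_resolvent b \<nu> (2 * pi * of_int k) (- of_int n / (\<tau> * of_int k)) (freqs L)
      (\<lambda>l. fcoef (\<lambda>r. sin (pi * r) * c l (s + \<tau> * r)) n) y
    = fcoef (\<lambda>r. window_source s \<tau> L r y) n"
proof -
  have pos: "s + \<tau> * r \<ge> 0" if "r \<in> {0..1}" for r using that s \<tau> by auto
  have cc: "continuous_on {0..1} (\<lambda>r. c l (s + \<tau> * r))" "continuous_on {0..1} (\<lambda>r. d l (s + \<tau> * r))" for l
    by (intro continuous_on_compose2[OF continuous_c] continuous_on_compose2[OF continuous_d]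
        continuous_intros; use pos in force)+
  define U V D where "U l = fcoef (\<lambda>r. sin (pi * r) * c l (s + \<tau> * r)) n"
    and "V l = fcoef (\<lambda>r. pi / \<tau> * cos (pi * r) * c l (s + \<tau> * r)) n"
    and "D l = fcoef (\<lambda>r. sin (pi * r) * d l (s + \<tau> * r)) n" for l
  have eq: "(4 * pi\<^sup>2 * \<nu> * (of_int k ^ 2 + of_int l ^ 2) + 2 * pi * \<i> * of_int n / \<tau>) * U l
      = V l - 2 * pi * \<i> * of_int k * D l" for l
    unfolding U_def V_def D_def by (rule windowed_coefficient[OF s \<tau>])
  have "shear_resolvent b \<nu> (2 * pi * of_int k) (- of_int n / (\<tau> * of_int k)) (freqs L) U y
     = (\<Sum>l\<in>freqs L. ((4 * pi\<^sup>2 * \<nu> * (of_int k ^ 2 + of_int l ^ 2) + 2 * pi * \<i> * of_int n / \<tau>) * U l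
         + 2 * pi * \<i> * of_int k * b y * U l) * fchar l y)"
    unfolding shear_resolvent_def trig_poly_def sum_distrib_left sum.distrib[symmetric] trig_deriv_def
    using k \<tau> by (intro sum.cong refl) (simp add: field_simps power2_eq_square)
  also have "\<dots> = (\<Sum>l\<in>freqs L. (V l + 2 * pi * \<i> * of_int k * (b y * U l - D l)) * fchar l y)"
    unfolding eq by (simp add: algebra_simps)
  also have "\<dots> = fcoef (\<lambda>r. \<Sum>l\<in>freqs L. fchar l y * (pi / \<tau> * cos (pi * r) * c l (s + \<tau> * r))
      + (2 * pi * \<i> * of_int k * fchar l y) * (b y * (sin (pi * r) * c l (s + \<tau> * r)) - sin (pi * r) * d l (s + \<tau> * r))) n"
  proof -
    define A B E where "A l r = pi / \<tau> * cos (pi * r) * c l (s + \<tau> * r)"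
      and "B l r = sin (pi * r) * c l (s + \<tau> * r)" and "E l r = sin (pi * r) * d l (s + \<tau> * r)" for l r
    have sqs: "square_integrable (A l)" "square_integrable (B l)" "square_integrable (E l)" for l
      unfolding A_def B_def E_def by (intro square_integrable_continuous continuous_intros cc)+
    have UVD: "V l = fcoef (A l) n" "U l = fcoef (B l) n" "D l = fcoef (E l) n" for l
      unfolding U_def V_def D_def A_def B_def E_def by (rule refl)+
    have summand: "square_integrable (\<lambda>r. fchar l y * A l r + (2 * pi * \<i> * of_int k * fchar l y) * (b y * B l r - E l r))" for l
      by (intro square_integrable_add square_integrable_diff square_integrable_cmult sqs)
    have "fcoef (\<lambda>r. fchar l y * A l r + (2 * pi * \<i> * of_int k * fchar l y) * (b y * B l r - E l r)) n
       = (V l + 2 * pi * \<i> * of_int k * (b y * U l - D l)) * fchar l y" for l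
      unfolding UVD fcoef_add[OF square_integrable_cmult[OF sqs(1)] square_integrable_cmult[OF square_integrable_diff[OF square_integrable_cmult[OF sqs(2)] sqs(3)]]]
        fcoef_cmult fcoef_diff[OF square_integrable_cmult[OF sqs(2)] sqs(3)]
      by (simp add: algebra_simps)
    then show ?thesis
      unfolding A_def[symmetric] B_def[symmetric] E_def[symmetric] by (simp only: fcoef_sum[OF summand])
  qed
  also have "(\<lambda>r. \<Sum>l\<in>freqs L. fchar l y * (pi / \<tau> * cos (pi * r) * c l (s + \<tau> * r))
      + (2 * pi * \<i> * of_int k * fchar l y) * (b y * (sin (pi * r) * c l (s + \<tau> * r)) - sin (pi * r) * d l (s + \<tau> * r)))
      = (\<lambda>r. window_source s \<tau> L r y)"
    unfolding window_source_def commutator_def f_def trig_poly_def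
    by (auto simp: fun_eq_iff sum.distrib sum_subtractf sum_distrib_left algebra_simps intro!: sum.cong)
  finally show ?thesis unfolding U_def .
qed

lemma continuous_window_source:
  assumes "s \<ge> 0" "\<tau> > 0"
  shows "continuous_on ({0..1} \<times> A) (\<lambda>p. window_source s \<tau> L (fst p) (snd p))"
proof -
  have sub: "(\<lambda>p. (s + \<tau> * fst p, snd p)) ` ({0..1} \<times> A) \<subseteq> {0..} \<times> A"
    using assms by (auto simp: image_subset_iff)
  have "continuous_on ({0..1} \<times> A) (\<lambda>p. f L (fst (s + \<tau> * fst p, snd p)) (snd (s + \<tau> * fst p, snd p)))"
    "continuous_on ({0..1} \<times> A) (\<lambda>p. commutator L (fst (s + \<tau> * fst p, snd p)) (snd (s + \<tau> * fst p, snd p)))"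
    by (rule continuous_on_compose2[OF continuous_f_joint _ sub] continuous_on_compose2[OF continuous_commutator_joint _ sub],
        intro continuous_intros)+
  then show ?thesis
    unfolding window_source_def by (intro continuous_intros) simp_all
qed

text \<open>Monotonicity replaces the mass at the later time by that at s, so the main term no
  longer depends on r.\<close>

lemma window_source_norm:
  assumes s: "s \<ge> 0" and \<tau>: "\<tau> > 0" and r: "r \<in> {0..1}"
  shows "sqnorm (window_source s \<tau> L r) \<le> 2 * pi\<^sup>2 / \<tau>\<^sup>2 * mass s + 8 * pi\<^sup>2 * of_int k ^ 2 * err L (s + \<tau> * r)"
proof -
  define t where "t = s + \<tau> * r"
  have t: "t \<ge> s" using r \<tau> by (simp add: t_def)
  have i: "integrable circle (\<lambda>y. (cmod (f L t y))\<^sup>2)" "integrable circle (\<lambda>y. (cmod (commutator L t y))\<^sup>2)"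
    "integrable circle (\<lambda>y. (cmod (window_source s \<tau> L r y))\<^sup>2)"
    unfolding window_source_def t_def
    by (intro integrable_circle_continuous continuous_intros continuous_f continuous_commutator)+
  have "sqnorm (window_source s \<tau> L r)
     \<le> (\<integral>y. 2 * pi\<^sup>2 / \<tau>\<^sup>2 * (cmod (f L t y))\<^sup>2 + 8 * pi\<^sup>2 * of_int k ^ 2 * (cmod (commutator L t y))\<^sup>2 \<partial>circle)"
  proof (rule integral_mono)
    fix y
    have cos1: "(cos (pi * r))\<^sup>2 \<le> 1" and sin1: "(sin (pi * r))\<^sup>2 \<le> 1"
      using sin_cos_squared_add[of "pi * r"] zero_le_power2[of "sin (pi * r)"] zero_le_power2[of "cos (pi * r)"] by linarith+
    have "(cmod (complex_of_real (pi / \<tau> * cos (pi * r)) * f L t y))\<^sup>2 = pi\<^sup>2 / \<tau>\<^sup>2 * (cmod (f L t y))\<^sup>2 * (cos (pi * r))\<^sup>2"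
      unfolding norm_mult norm_of_real power_mult_distrib power2_abs power_divide by simp
    also have "\<dots> \<le> pi\<^sup>2 / \<tau>\<^sup>2 * (cmod (f L t y))\<^sup>2 * 1"
      by (intro mult_left_mono cos1) simp
    finally have 1: "(cmod (complex_of_real (pi / \<tau> * cos (pi * r)) * f L t y))\<^sup>2 \<le> pi\<^sup>2 / \<tau>\<^sup>2 * (cmod (f L t y))\<^sup>2" by simp
    have "(cmod (complex_of_real (2 * pi * of_int k * sin (pi * r)) * \<i> * commutator L t y))\<^sup>2
        = 4 * pi\<^sup>2 * of_int k ^ 2 * (cmod (commutator L t y))\<^sup>2 * (sin (pi * r))\<^sup>2"
      unfolding norm_mult norm_of_real power_mult_distrib power2_abs by simp
    also have "\<dots> \<le> 4 * pi\<^sup>2 * of_int k ^ 2 * (cmod (commutator L t y))\<^sup>2 * 1"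
      by (intro mult_left_mono sin1) simp
    finally have 2: "(cmod (complex_of_real (2 * pi * of_int k * sin (pi * r)) * \<i> * commutator L t y))\<^sup>2
        \<le> 4 * pi\<^sup>2 * of_int k ^ 2 * (cmod (commutator L t y))\<^sup>2" by simp
    have "window_source s \<tau> L r y = complex_of_real (pi / \<tau> * cos (pi * r)) * f L t y
        + complex_of_real (2 * pi * of_int k * sin (pi * r)) * \<i> * commutator L t y"
      unfolding window_source_def t_def by (simp add: mult_ac)
    then show "(cmod (window_source s \<tau> L r y))\<^sup>2 \<le> 2 * pi\<^sup>2 / \<tau>\<^sup>2 * (cmod (f L t y))\<^sup>2
        + 8 * pi\<^sup>2 * of_int k ^ 2 * (cmod (commutator L t y))\<^sup>2"
      using norm_add_sq_le2[of "complex_of_real (pi / \<tau> * cos (pi * r)) * f L t y"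
          "complex_of_real (2 * pi * of_int k * sin (pi * r)) * \<i> * commutator L t y"] 1 2 by simp
  qed (use i in auto)
  also have "\<dots> = 2 * pi\<^sup>2 / \<tau>\<^sup>2 * mass_trunc L t + 8 * pi\<^sup>2 * of_int k ^ 2 * err L t"
    unfolding mass_trunc_eq err_def using i by simp
  also have "mass_trunc L t \<le> mass s"
    using mass_trunc_le[of t L] mass_antimono[OF s t] s t by linarith
  finally show ?thesis unfolding t_def by (simp add: mult_left_mono divide_right_mono)
qed

lemma integral_circle_swap:
  fixes H :: "real \<Rightarrow> real \<Rightarrow> real"
  assumes H: "continuous_on ({0..1} \<times> {0..1}) (\<lambda>p. H (fst p) (snd p))"
  shows "(\<integral>y. (\<integral>r. H r y \<partial>circle) \<partial>circle) = integral {0..1} (\<lambda>r. \<integral>y. H r y \<partial>circle)"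
proof -
  have H': "continuous_on ({0..1} \<times> {0..1}) (\<lambda>p. H (snd p) (fst p))"
  proof -
    have "continuous_on ({0..1} \<times> {0..1}) (\<lambda>p. H (fst (snd p, fst p)) (snd (snd p, fst p)))"
      by (rule continuous_on_compose2[OF H]) (auto intro!: continuous_intros)
    then show ?thesis by simp
  qed
  have c1: "continuous_on {0..1} (\<lambda>r. H r y)" if "y \<in> {0..1}" for y
  proof -
    have "continuous_on {0..1} (\<lambda>r. H (fst (r, y)) (snd (r, y)))"
      by (rule continuous_on_compose2[OF H]) (use that in \<open>auto intro!: continuous_intros\<close>)
    then show ?thesis by simp
  qed
  have c2: "continuous_on {0..1} (H r)" if "r \<in> {0..1}" for r
  proof -
    have "continuous_on {0..1} (\<lambda>y. H (fst (r, y)) (snd (r, y)))"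
      by (rule continuous_on_compose2[OF H]) (use that in \<open>auto intro!: continuous_intros\<close>)
    then show ?thesis by simp
  qed
  have "(\<integral>y. (\<integral>r. H r y \<partial>circle) \<partial>circle) = integral {0..1} (\<lambda>y. \<integral>r. H r y \<partial>circle)"
    by (intro integral_circle_eq continuous_circle_integral H')
  also have "\<dots> = integral {0..1} (\<lambda>y. integral {0..1} (\<lambda>r. H r y))"
    by (intro integral_cong integral_circle_eq c1)
  also have "\<dots> = integral {0..1} (\<lambda>r. integral {0..1} (H r))"
    using integral_swap_continuous[of 0 0 1 1 "\<lambda>r y. H r y"] H
    by (simp add: cbox_Pair_eq case_prod_beta)
  also have "\<dots> = integral {0..1} (\<lambda>r. \<integral>y. H r y \<partial>circle)"
    by (intro integral_cong integral_circle_eq[symmetric] c2)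
  finally show ?thesis .
qed

text \<open>The resolvent bound is applied to each time mode. On the source side Bessel's inequality
  in r, for each fixed y, bounds the sum over the modes; on the solution side Parseval in r recovers
  the whole integral.\<close>

lemma window_estimate:
  assumes s: "s \<ge> 0" and \<tau>: "\<tau> > 0" and k: "k \<noteq> 0" and P: "P \<ge> 0"
    and resolvent: "\<And>lam S a. finite S \<Longrightarrow> sqnorm (trig_poly S a)
      \<le> P * sqnorm (shear_resolvent b \<nu> (2 * pi * of_int k) lam S a)"
  shows "integral {0..1} (\<lambda>r. (sin (pi * r))\<^sup>2 * mass_trunc L (s + \<tau> * r)) \<le>
    P * (2 * pi\<^sup>2 / \<tau>\<^sup>2 * mass s + 8 * pi\<^sup>2 * of_int k ^ 2 * integral {0..1} (\<lambda>r. err L (s + \<tau> * r)))"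
proof -
  have pos: "s + \<tau> * r \<ge> 0" if "r \<in> {0..1}" for r using that s \<tau> by auto
  have cc: "continuous_on {0..1} (\<lambda>r. c l (s + \<tau> * r))" for l
    by (intro continuous_on_compose2[OF continuous_c] continuous_intros) (use pos in force)
  have ec: "continuous_on {0..1} (\<lambda>r. err L (s + \<tau> * r))"
    by (intro continuous_on_compose2[OF continuous_err] continuous_intros) (use pos in force)
  let ?H = "window_source s \<tau> L"
  define u where "u l r = sin (pi * r) * c l (s + \<tau> * r)" for l r
  have uc: "continuous_on {0..1} (u l)" for l
    unfolding u_def by (intro continuous_intros cc)
  have Hc: "continuous_on ({0..1} \<times> A) (\<lambda>p. (cmod (?H (fst p) (snd p)))\<^sup>2)" for A
    by (intro continuous_intros continuous_window_source s \<tau>)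
  have Hr: "continuous_on {0..1} (\<lambda>r. ?H r y)" for y
  proof -
    have "continuous_on {0..1} (\<lambda>r. ?H (fst (r, y)) (snd (r, y)))"
      by (rule continuous_on_compose2[OF continuous_window_source[OF s \<tau>, of UNIV]]) (auto intro!: continuous_intros)
    then show ?thesis by simp
  qed
  have Hint: "integrable circle (\<lambda>y. \<integral>r. (cmod (?H r y))\<^sup>2 \<partial>circle)"
  proof -
    have "continuous_on ({0..1} \<times> {0..1}) (\<lambda>p. (cmod (?H (fst (snd p, fst p)) (snd (snd p, fst p))))\<^sup>2)"
      by (rule continuous_on_compose2[OF Hc[of "{0..1}"]]) (auto intro!: continuous_intros)
    then show ?thesis
      by (intro integrable_circle_continuous continuous_circle_integral) simp
  qed
  have step: "(\<Sum>n\<in>freqs N. \<Sum>l\<in>freqs L. (cmod (fcoef (u l) n))\<^sup>2) \<le> P * (\<integral>y. sqnorm (\<lambda>r. ?H r y) \<partial>circle)" for N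
  proof -
    \<comment> \<open>Continuity in y is read off the resolvent side, where y enters only through b
      and characters.\<close>
    have fc: "continuous_on A (\<lambda>y. fcoef (\<lambda>r. ?H r y) n)" for A n
      using continuous_on_shear_resolvent[OF b_cont] unfolding windowed_resolvent[OF s \<tau> k, symmetric] .
    have "(\<Sum>l\<in>freqs L. (cmod (fcoef (u l) n))\<^sup>2) \<le> P * sqnorm (\<lambda>y. fcoef (\<lambda>r. ?H r y) n)" for n
      using resolvent[OF finite_freqs, where lam="- of_int n / (\<tau> * of_int k)" and a="\<lambda>l. fcoef (u l) n"]
      unfolding u_def windowed_resolvent[OF s \<tau> k] by (simp add: integral_trig_poly_sq)
    then have "(\<Sum>n\<in>freqs N. \<Sum>l\<in>freqs L. (cmod (fcoef (u l) n))\<^sup>2)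
        \<le> (\<Sum>n\<in>freqs N. P * sqnorm (\<lambda>y. fcoef (\<lambda>r. ?H r y) n))"
      by (rule sum_mono)
    also have "\<dots> = P * (\<integral>y. (\<Sum>n\<in>freqs N. (cmod (fcoef (\<lambda>r. ?H r y) n))\<^sup>2) \<partial>circle)"
      unfolding sum_distrib_left[symmetric]
      by (subst Bochner_Integration.integral_sum) (auto intro!: integrable_circle_continuous continuous_intros fc)
    also have "\<dots> \<le> P * (\<integral>y. sqnorm (\<lambda>r. ?H r y) \<partial>circle)"
    proof (intro mult_left_mono integral_mono Hint P)
      show "integrable circle (\<lambda>y. \<Sum>n\<in>freqs N. (cmod (fcoef (\<lambda>r. ?H r y) n))\<^sup>2)"
        by (intro integrable_circle_continuous continuous_intros fc)
      show "(\<Sum>n\<in>freqs N. (cmod (fcoef (\<lambda>r. ?H r y) n))\<^sup>2) \<le> sqnorm (\<lambda>r. ?H r y)" for y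
        by (intro bessel square_integrable_continuous Hr) simp
    qed
    finally show ?thesis .
  qed
  \<comment> \<open>L is fixed, so only finitely many l occur and Parseval in time applies to each
    of them.\<close>
  have "(\<lambda>N. \<Sum>n\<in>freqs N. \<Sum>l\<in>freqs L. (cmod (fcoef (u l) n))\<^sup>2) \<longlonglongrightarrow> (\<Sum>l\<in>freqs L. \<integral>r. (cmod (u l r))\<^sup>2 \<partial>circle)"
    by (subst sum.swap) (intro tendsto_sum parseval square_integrable_continuous uc)
  then have "(\<Sum>l\<in>freqs L. \<integral>r. (cmod (u l r))\<^sup>2 \<partial>circle) \<le> P * (\<integral>y. sqnorm (\<lambda>r. ?H r y) \<partial>circle)"
    using step by (intro LIMSEQ_le_const2) auto
  also have "(\<integral>y. sqnorm (\<lambda>r. ?H r y) \<partial>circle) = integral {0..1} (\<lambda>r. \<integral>y. (cmod (?H r y))\<^sup>2 \<partial>circle)"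
    by (rule integral_circle_swap[OF Hc])
  also have "P * \<dots> \<le> P * integral {0..1} (\<lambda>r. 2 * pi\<^sup>2 / \<tau>\<^sup>2 * mass s + 8 * pi\<^sup>2 * of_int k ^ 2 * err L (s + \<tau> * r))"
    by (intro mult_left_mono integral_le integrable_continuous_real continuous_circle_integral Hc P
        continuous_intros ec window_source_norm s \<tau>)
  also have "\<dots> = P * (2 * pi\<^sup>2 / \<tau>\<^sup>2 * mass s + 8 * pi\<^sup>2 * of_int k ^ 2 * integral {0..1} (\<lambda>r. err L (s + \<tau> * r)))"
    using ec by (subst integral_add) (auto intro!: integrable_continuous_real continuous_intros)
  also have "(\<Sum>l\<in>freqs L. \<integral>r. (cmod (u l r))\<^sup>2 \<partial>circle) = integral {0..1} (\<lambda>r. (sin (pi * r))\<^sup>2 * mass_trunc L (s + \<tau> * r))"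
  proof -
    have "(\<Sum>l\<in>freqs L. \<integral>r. (cmod (u l r))\<^sup>2 \<partial>circle) = (\<integral>r. (\<Sum>l\<in>freqs L. (cmod (u l r))\<^sup>2) \<partial>circle)"
      by (rule Bochner_Integration.integral_sum[symmetric]) (intro integrable_circle_continuous continuous_intros uc)
    also have "\<dots> = integral {0..1} (\<lambda>r. \<Sum>l\<in>freqs L. (cmod (u l r))\<^sup>2)"
      by (intro integral_circle_eq continuous_intros uc)
    finally show ?thesis
      by (simp add: u_def mass_trunc_def norm_mult power_mult_distrib sum_distrib_left)
  qed
  finally show ?thesis .
qed

lemma integral_sin_sq: "((\<lambda>r. (sin (pi * r))\<^sup>2) has_integral 1 / 2) {0..1}"
proof -
  have "((\<lambda>r. (sin (pi * r))\<^sup>2) has_integral ((1 / 2 - sin (2 * pi * 1) / (4 * pi)) - (0 / 2 - sin (2 * pi * 0) / (4 * pi)))) {0..1}"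
  proof (rule fundamental_theorem_of_calculus)
    fix r :: real
    have "((\<lambda>r. r / 2 - sin (2 * pi * r) / (4 * pi)) has_real_derivative (1 / 2 - cos (2 * (pi * r)) / 2)) (at r within {0..1})"
      by (auto intro!: derivative_eq_intros simp: field_simps)
    also have "1 / 2 - cos (2 * (pi * r)) / 2 = (sin (pi * r))\<^sup>2"
      unfolding cos_double_sin by (simp add: diff_divide_distrib)
    finally show "((\<lambda>r. r / 2 - sin (2 * pi * r) / (4 * pi)) has_vector_derivative (sin (pi * r))\<^sup>2) (at r within {0..1})"
      by (simp add: has_real_derivative_iff_has_vector_derivative)
  qed simp
  then show ?thesis by simp
qed

text \<open>Letting L tend to infinity removes the commutator from the window estimate. The mass at
  the end of the window is then bounded by its weighted average over the window, since the mass
  decreases; the weight has mean 1/2, which doubles the constant.\<close>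

lemma mass_contraction:
  assumes s: "s \<ge> 0" and \<tau>: "\<tau> > 0" and k: "k \<noteq> 0" and P: "P \<ge> 0"
    and resolvent: "\<And>lam S a. finite S \<Longrightarrow> sqnorm (trig_poly S a)
      \<le> P * sqnorm (shear_resolvent b \<nu> (2 * pi * of_int k) lam S a)"
  shows "mass (s + \<tau>) \<le> 4 * pi\<^sup>2 * P / \<tau>\<^sup>2 * mass s"
proof -
  have pos: "s + \<tau> * r \<ge> 0" if "r \<in> {0..1}" for r using that s \<tau> by auto
  have le: "mass (s + \<tau> * r) \<le> mass s" if "r \<in> {0..1}" for r
    using that s \<tau> by (intro mass_antimono) auto
  have mc: "continuous_on {0..1} (\<lambda>r. mass_trunc L (s + \<tau> * r))" for L
    by (intro continuous_on_compose2[OF continuous_mass_trunc] continuous_intros) (use pos in force)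
  have mc': "continuous_on {0..1} (\<lambda>r. mass (s + \<tau> * r))"
    by (intro continuous_on_compose2[OF continuous_mass] continuous_intros) (use pos in force)
  have ec: "continuous_on {0..1} (\<lambda>r. err L (s + \<tau> * r))" for L
    by (intro continuous_on_compose2[OF continuous_err] continuous_intros) (use pos in force)
  have sin1: "(sin x)\<^sup>2 \<le> 1" for x :: real
    using sin_cos_squared_add[of x] zero_le_power2[of "cos x"] by linarith
  have lim1: "(\<lambda>L. integral {0..1} (\<lambda>r. (sin (pi * r))\<^sup>2 * mass_trunc L (s + \<tau> * r)))
     \<longlonglongrightarrow> integral {0..1} (\<lambda>r. (sin (pi * r))\<^sup>2 * mass (s + \<tau> * r))"
  proof (rule dominated_convergence(2))
    show "(\<lambda>r. (sin (pi * r))\<^sup>2 * mass_trunc L (s + \<tau> * r)) integrable_on {0..1}" for L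
      by (intro integrable_continuous_real continuous_intros mc)
    show "(\<lambda>r. mass s) integrable_on {0..1::real}" by (rule integrable_const_ivl)
    show "norm ((sin (pi * r))\<^sup>2 * mass_trunc L (s + \<tau> * r)) \<le> mass s" if r: "r \<in> {0..1}" for L r
    proof -
      have "(sin (pi * r))\<^sup>2 * mass_trunc L (s + \<tau> * r) \<le> 1 * mass s"
        by (intro mult_mono sin1 mass_trunc_nonneg order_trans[OF mass_trunc_le[OF pos[OF r]] le[OF r]]) auto
      then show ?thesis using mass_trunc_nonneg by simp
    qed
    show "(\<lambda>L. (sin (pi * r))\<^sup>2 * mass_trunc L (s + \<tau> * r)) \<longlonglongrightarrow> (sin (pi * r))\<^sup>2 * mass (s + \<tau> * r)" if r: "r \<in> {0..1}" for r
      by (intro tendsto_intros mass_trunc_lim pos r)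
  qed
  have lim2: "(\<lambda>L. integral {0..1} (\<lambda>r. err L (s + \<tau> * r))) \<longlonglongrightarrow> integral {0..1} (\<lambda>r::real. 0 :: real)"
  proof (rule dominated_convergence(2))
    show "(\<lambda>r. err L (s + \<tau> * r)) integrable_on {0..1}" for L
      by (intro integrable_continuous_real ec)
    show "(\<lambda>r. 4 * bmax\<^sup>2 * mass s) integrable_on {0..1::real}" by (rule integrable_const_ivl)
    show "norm (err L (s + \<tau> * r)) \<le> 4 * bmax\<^sup>2 * mass s" if r: "r \<in> {0..1}" for L r
    proof -
      have "err L (s + \<tau> * r) \<le> 4 * bmax\<^sup>2 * mass (s + \<tau> * r)" by (intro err_bound pos r)
      also have "\<dots> \<le> 4 * bmax\<^sup>2 * mass s" by (intro mult_left_mono le r) auto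
      finally show ?thesis using err_nonneg[of L] by simp
    qed
    show "(\<lambda>L. err L (s + \<tau> * r)) \<longlonglongrightarrow> 0" if r: "r \<in> {0..1}" for r
      by (intro err_lim pos r)
  qed
  have "integral {0..1} (\<lambda>r. (sin (pi * r))\<^sup>2 * mass (s + \<tau> * r)) \<le>
    P * (2 * pi\<^sup>2 / \<tau>\<^sup>2 * mass s + 8 * pi\<^sup>2 * of_int k ^ 2 * integral {0..1} (\<lambda>r::real. 0 :: real))"
    by (rule LIMSEQ_le[OF lim1 tendsto_mult[OF tendsto_const tendsto_add[OF tendsto_const tendsto_mult[OF tendsto_const lim2]]]])
      (use window_estimate[OF s \<tau> k P resolvent] in auto)
  then have "integral {0..1} (\<lambda>r. (sin (pi * r))\<^sup>2 * mass (s + \<tau> * r)) \<le> 2 * pi\<^sup>2 * P / \<tau>\<^sup>2 * mass s"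
    by (simp add: mult_ac)
  moreover have "integral {0..1} (\<lambda>r. (sin (pi * r))\<^sup>2 * mass (s + \<tau>)) \<le> integral {0..1} (\<lambda>r. (sin (pi * r))\<^sup>2 * mass (s + \<tau> * r))"
  proof (intro integral_le integrable_continuous_real continuous_intros mc' mult_left_mono)
    show "mass (s + \<tau>) \<le> mass (s + \<tau> * r)" if "r \<in> {0..1}" for r
      using that s \<tau> by (intro mass_antimono) (auto simp: mult_left_le)
  qed auto
  moreover have "integral {0..1} (\<lambda>r. (sin (pi * r))\<^sup>2 * mass (s + \<tau>)) = mass (s + \<tau>) / 2"
    using integral_unique[OF has_integral_mult_left[OF integral_sin_sq, of "mass (s + \<tau>)"]] by (simp only: mult_1 times_divide_eq_left)
  ultimately have "mass (s + \<tau>) / 2 \<le> 2 * pi\<^sup>2 * P / \<tau>\<^sup>2 * mass s"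
    by linarith
  then show ?thesis by simp
qed

text \<open>Contraction is iterated over consecutive windows, and the unfinished last one is covered
  by monotonicity of the mass.\<close>

lemma mass_decay:
  assumes k: "k \<noteq> 0" and K: "K > 0" and t: "t \<ge> 0"
    and resolvent: "\<And>lam S a. finite S \<Longrightarrow> sqnorm (trig_poly S a)
      \<le> K\<^sup>2 * sqnorm (shear_resolvent b \<nu> (2 * pi * of_int k) lam S a)"
  shows "mass t \<le> 4 * exp (- (2 * (ln 2 / (4 * pi))) * t / K) * mass 0"
proof -
  \<comment> \<open>Twice the length at which the contraction factor would be 1: the norm is halved
    and the mass quartered on each window.\<close>
  define \<tau> where "\<tau> = 4 * pi * K"
  have \<tau>: "\<tau> > 0" using K by (simp add: \<tau>_def)
  have "4 * pi\<^sup>2 * K\<^sup>2 / \<tau>\<^sup>2 = 1 / 4"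
    using K by (simp add: \<tau>_def power2_eq_square)
  then have step: "mass (s + \<tau>) \<le> 1 / 4 * mass s" if "s \<ge> 0" for s
    using mass_contraction[OF that \<tau> k zero_le_power2 resolvent] by (simp only:)
  have pow: "mass (real n * \<tau>) \<le> (1 / 4) ^ n * mass 0" for n
  proof (induction n)
    case (Suc n)
    have "mass (real (Suc n) * \<tau>) = mass (real n * \<tau> + \<tau>)" by (simp add: algebra_simps)
    also have "\<dots> \<le> 1 / 4 * mass (real n * \<tau>)" using \<tau> by (intro step) simp
    finally show ?case using Suc by simp
  qed simp
  define n where "n = nat \<lfloor>t / \<tau>\<rfloor>"
  have n: "real n \<le> t / \<tau>" "t / \<tau> \<le> real n + 1"
    using t \<tau> unfolding n_def by (auto simp: le_nat_floor)
  have "mass t \<le> mass (real n * \<tau>)"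
    using n(1) \<tau> by (intro mass_antimono) (auto simp: field_simps)
  also have "\<dots> \<le> (1 / 4) ^ n * mass 0" by (rule pow)
  \<comment> \<open>Only n + 1 \<ge> t / \<tau> is known, and raising the exponent by one accounts
    for the factor 4. The rate is ln 4 / \<tau>, written as 2 ln 2 so that it halves cleanly when
    square roots are taken.\<close>
  also have "(1 / 4 :: real) ^ n \<le> 4 * exp (- (2 * (ln 2 / (4 * pi))) * t / K)"
  proof -
    have "- (2 * ln 2) * real (Suc n) \<le> - (2 * ln 2) * (t / \<tau>)"
      using n(2) by (intro mult_left_mono_neg) auto
    also have "\<dots> = - (2 * (ln 2 / (4 * pi))) * t / K"
      by (simp add: \<tau>_def mult_ac)
    finally have "exp (- (2 * ln 2) * real (Suc n)) \<le> exp (- (2 * (ln 2 / (4 * pi))) * t / K)" by simp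
    moreover have "exp (- (2 * ln 2) * real (Suc n)) = (1 / 4 :: real) ^ Suc n"
    proof -
      have "exp (- (2 * ln 2)) = (1 / 4 :: real)"
        by (simp add: exp_minus exp_double inverse_eq_divide)
      then show ?thesis by (metis exp_of_nat2_mult)
    qed
    moreover have "(1 / 4 :: real) ^ n = 4 * (1 / 4) ^ Suc n" by simp
    ultimately show ?thesis by linarith
  qed
  finally show ?thesis using mass_nonneg[of 0] by (simp add: mult_right_mono)
qed

end

subsection \<open>Modes on the torus\<close>

interpretation circle2: pair_sigma_finite circle circle ..

interpretation torus: finite_measure torus
  unfolding torus_def by (rule finite_measure_pair_measure) unfold_locales

definition xmode :: "(real \<times> real \<Rightarrow> real) \<Rightarrow> int \<Rightarrow> real \<Rightarrow> complex" where
  "xmode F k y = fcoef (\<lambda>x. of_real (F (x, y))) k"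

lemma space_torus [simp]: "space torus = {0..<1} \<times> {0..<1}"
  by (simp add: torus_def space_pair_measure)

lemma measurable_torus_continuous:
  fixes h :: "real \<times> real \<Rightarrow> 'b::topological_space"
  assumes "continuous_on UNIV h"
  shows "h \<in> borel_measurable torus"
proof -
  have id: "(\<lambda>x. x) \<in> measurable circle borel"
    by (rule borel_measurable_circle) simp
  have "(\<lambda>p. (fst p, snd p)) \<in> measurable torus (borel \<Otimes>\<^sub>M borel)"
    unfolding torus_def
    by (intro measurable_Pair measurable_compose[OF measurable_fst id] measurable_compose[OF measurable_snd id])
  then have "(\<lambda>p. p) \<in> measurable torus borel"
    by (simp add: borel_prod)
  from measurable_compose[OF this borel_measurable_continuous_onI[OF assms]] show ?thesis .
qed

lemma in_L2_measurable: "in_L2 F \<Longrightarrow> F \<in> borel_measurable torus"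
  by (simp add: in_L2_def)

lemma in_L2_bounded_integrable:
  fixes \<psi> :: "real \<times> real \<Rightarrow> 'b::{real_normed_field, banach, second_countable_topology}"
  assumes F: "in_L2 F" and \<psi>: "\<psi> \<in> borel_measurable torus" "\<And>p. norm (\<psi> p) \<le> B"
  shows "integrable torus (\<lambda>p. of_real (F p) * \<psi> p)"
proof (rule Bochner_Integration.integrable_bound)
  show "integrable torus (\<lambda>p. (1 + (F p)\<^sup>2) * B)"
    using F by (auto simp: in_L2_def)
  show "(\<lambda>p. of_real (F p) * \<psi> p) \<in> borel_measurable torus"
    using in_L2_measurable[OF F] \<psi>(1) by simp
  show "AE p in torus. norm (of_real (F p) * \<psi> p) \<le> norm ((1 + (F p)\<^sup>2) * B)"
  proof (intro AE_I2)
    fix p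
    have "0 \<le> (\<bar>F p\<bar> - 1 / 2)\<^sup>2" by simp
    then have "\<bar>F p\<bar> \<le> 1 + (F p)\<^sup>2"
      by (simp add: power2_eq_square algebra_simps)
    then have "\<bar>F p\<bar> * norm (\<psi> p) \<le> (1 + (F p)\<^sup>2) * B"
      by (intro mult_mono \<psi>) auto
    then show "norm (of_real (F p) * \<psi> p) \<le> norm ((1 + (F p)\<^sup>2) * B)"
      by (simp add: norm_mult)
  qed
qed

lemma in_L2_diff:
  assumes "in_L2 F" "in_L2 G"
  shows "in_L2 (\<lambda>p. F p - G p)"
  unfolding in_L2_def
proof
  show m: "(\<lambda>p. F p - G p) \<in> borel_measurable torus"
    using assms by (auto simp: in_L2_def)
  show "integrable torus (\<lambda>p. (F p - G p)\<^sup>2)"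
  proof (rule Bochner_Integration.integrable_bound)
    show "integrable torus (\<lambda>p. 2 * (F p)\<^sup>2 + 2 * (G p)\<^sup>2)"
      using assms by (auto simp: in_L2_def)
    show "(\<lambda>p. (F p - G p)\<^sup>2) \<in> borel_measurable torus" using m by simp
    show "AE p in torus. norm ((F p - G p)\<^sup>2) \<le> norm (2 * (F p)\<^sup>2 + 2 * (G p)\<^sup>2)"
      using norm_diff_sq_le2[of "F p" "G p" for p] by (intro AE_I2) simp
  qed
qed

lemma in_L2_section:
  assumes F: "in_L2 F"
  shows "AE y in circle. square_integrable (\<lambda>x. of_real (F (x, y)))"
proof -
  have m: "F \<in> borel_measurable (circle \<Otimes>\<^sub>M circle)"
    using in_L2_measurable[OF F] by (simp add: torus_def)
  have "AE y in circle. integrable circle (\<lambda>x. (F (x, y))\<^sup>2)"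
    using F by (intro circle2.AE_integrable_snd) (simp add: in_L2_def torus_def case_prod_beta')
  with AE_space show ?thesis
  proof eventually_elim
    case (elim y)
    have "(\<lambda>x. F (x, y)) \<in> borel_measurable circle"
      by (rule measurable_Pair1[OF m elim(1)])
    then show ?case using elim(2) by (simp add: square_integrable_def)
  qed
qed

lemma xmode_measurable:
  assumes F: "in_L2 F"
  shows "xmode F k \<in> borel_measurable circle"
proof -
  have m: "F \<in> borel_measurable (circle \<Otimes>\<^sub>M circle)"
    using in_L2_measurable[OF F] by (simp add: torus_def)
  have "(\<lambda>p. of_real (F p) * cnj (fchar k (fst p))) \<in> borel_measurable (circle \<Otimes>\<^sub>M circle)"
  proof (intro borel_measurable_times)
    show "(\<lambda>p. complex_of_real (F p)) \<in> borel_measurable (circle \<Otimes>\<^sub>M circle)"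
      using m by simp
    show "(\<lambda>p. cnj (fchar k (fst p))) \<in> borel_measurable (circle \<Otimes>\<^sub>M circle)"
      unfolding torus_def[symmetric] by (intro measurable_torus_continuous continuous_intros)
  qed
  from measurable_compose[OF measurable_pair_swap' this]
  have "(\<lambda>(y, x). of_real (F (x, y)) * cnj (fchar k x)) \<in> borel_measurable (circle \<Otimes>\<^sub>M circle)"
    by (simp add: case_prod_beta')
  then show ?thesis
    unfolding xmode_def fcoef_def by (rule circle.borel_measurable_lebesgue_integral)
qed

lemma integral_sections:
  assumes F: "in_L2 F"
  shows "integrable circle (\<lambda>y. \<integral>x. (F (x, y))\<^sup>2 \<partial>circle)"
    and "(\<integral>y. (\<integral>x. (F (x, y))\<^sup>2 \<partial>circle) \<partial>circle) = (\<integral>p. (F p)\<^sup>2 \<partial>torus)"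
proof -
  have i: "integrable (circle \<Otimes>\<^sub>M circle) (\<lambda>(x, y). (F (x, y))\<^sup>2)"
    using F by (simp add: in_L2_def torus_def case_prod_beta')
  show "integrable circle (\<lambda>y. \<integral>x. (F (x, y))\<^sup>2 \<partial>circle)"
    by (rule circle2.integrable_snd[OF i])
  show "(\<integral>y. (\<integral>x. (F (x, y))\<^sup>2 \<partial>circle) \<partial>circle) = (\<integral>p. (F p)\<^sup>2 \<partial>torus)"
    using circle2.integral_snd[OF i] by (simp add: torus_def case_prod_beta')
qed

lemma xmode_bessel:
  assumes F: "in_L2 F" and S: "finite S"
  shows "AE y in circle. (\<Sum>k\<in>S. (cmod (xmode F k y))\<^sup>2) \<le> (\<integral>x. (F (x, y))\<^sup>2 \<partial>circle)"
  using in_L2_section[OF F]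
proof eventually_elim
  case (elim y)
  show ?case using bessel[OF elim S] by (simp add: xmode_def)
qed

lemma square_integrable_xmode:
  assumes F: "in_L2 F"
  shows "square_integrable (xmode F k)"
  unfolding square_integrable_def
proof
  show "integrable circle (\<lambda>y. (cmod (xmode F k y))\<^sup>2)"
  proof (rule Bochner_Integration.integrable_bound[OF integral_sections(1)[OF F]])
    show "AE y in circle. norm ((cmod (xmode F k y))\<^sup>2) \<le> norm (\<integral>x. (F (x, y))\<^sup>2 \<partial>circle)"
      using xmode_bessel[OF F, of "{k}"] by simp
  qed (use xmode_measurable[OF F] in simp)
qed (rule xmode_measurable[OF F])

lemma xmode_norm_le:
  assumes F: "in_L2 F"
  shows "sqnorm (xmode F k) \<le> (\<integral>p. (F p)\<^sup>2 \<partial>torus)"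
proof -
  have "sqnorm (xmode F k) \<le> (\<integral>y. (\<integral>x. (F (x, y))\<^sup>2 \<partial>circle) \<partial>circle)"
    using xmode_bessel[OF F, of "{k}"]
    by (intro integral_mono_AE square_integrable_norm square_integrable_xmode integral_sections F) simp
  then show ?thesis by (simp add: integral_sections(2)[OF F])
qed

text \<open>Parseval in x holds for almost every y, and Bessel's inequality dominates the partial
  sums when integrating over y.\<close>

lemma xmode_parseval:
  assumes F: "in_L2 F"
  shows "(\<lambda>N. \<Sum>k\<in>freqs N. \<integral>y. (cmod (xmode F k y))\<^sup>2 \<partial>circle) \<longlonglongrightarrow> (\<integral>p. (F p)\<^sup>2 \<partial>torus)"
proof -
  have "(\<lambda>N. \<integral>y. (\<Sum>k\<in>freqs N. (cmod (xmode F k y))\<^sup>2) \<partial>circle) \<longlonglongrightarrow> (\<integral>y. (\<integral>x. (F (x, y))\<^sup>2 \<partial>circle) \<partial>circle)"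
  proof (rule integral_dominated_convergence)
    show "(\<lambda>y. \<integral>x. (F (x, y))\<^sup>2 \<partial>circle) \<in> borel_measurable circle"
      by (rule borel_measurable_integrable[OF integral_sections(1)[OF F]])
    show "(\<lambda>y. \<Sum>k\<in>freqs N. (cmod (xmode F k y))\<^sup>2) \<in> borel_measurable circle" for N
      using xmode_measurable[OF F] by simp
    show "AE y in circle. (\<lambda>N. \<Sum>k\<in>freqs N. (cmod (xmode F k y))\<^sup>2) \<longlonglongrightarrow> (\<integral>x. (F (x, y))\<^sup>2 \<partial>circle)"
      using in_L2_section[OF F]
    proof eventually_elim
      case (elim y)
      show ?case using parseval[OF elim] by (simp add: xmode_def)
    qed
    show "integrable circle (\<lambda>y. \<integral>x. (F (x, y))\<^sup>2 \<partial>circle)" by (rule integral_sections(1)[OF F])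
    show "AE y in circle. norm (\<Sum>k\<in>freqs N. (cmod (xmode F k y))\<^sup>2) \<le> (\<integral>x. (F (x, y))\<^sup>2 \<partial>circle)" for N
      using xmode_bessel[OF F finite_freqs, of N] by eventually_elim (simp add: sum_nonneg)
  qed
  then show ?thesis
    by (simp add: integral_sections(2)[OF F] square_integrable_norm[OF square_integrable_xmode[OF F]])
qed

text \<open>Linearity holds only almost everywhere: on a null set of y a section may fail to be
  integrable, and there the integral is 0 by convention.\<close>

lemma xmode_diff:
  assumes "in_L2 F" "in_L2 G"
  shows "AE y in circle. xmode (\<lambda>p. F p - G p) k y = xmode F k y - xmode G k y"
  using in_L2_section[OF assms(1)] in_L2_section[OF assms(2)]
  by eventually_elim (simp add: xmode_def fcoef_diff)

definition wave :: "int \<Rightarrow> int \<Rightarrow> real \<times> real \<Rightarrow> complex" where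
  "wave k l p = cnj (fchar k (fst p)) * cnj (fchar l (snd p))"

lemma continuous_wave: "continuous_on A (wave k l)"
  unfolding wave_def by (intro continuous_intros)

lemma norm_wave [simp]: "cmod (wave k l p) = 1"
  by (simp add: wave_def norm_mult)

text \<open>Fubini, with a bounded weight so that \<beta> = 1 gives the coefficients of the mode and
  \<beta> = b those of its product with b.\<close>

lemma fcoef_xmode:
  fixes \<beta> :: "real \<Rightarrow> real"
  assumes F: "in_L2 F" and \<beta>: "continuous_on UNIV \<beta>" "\<And>y. \<bar>\<beta> y\<bar> \<le> B"
  shows "fcoef (\<lambda>y. \<beta> y * xmode F k y) l = (\<integral>p. of_real (F p) * (\<beta> (snd p) * wave k l p) \<partial>torus)"
    and "integrable torus (\<lambda>p. of_real (F p) * (\<beta> (snd p) * wave k l p))"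
proof -
  show i: "integrable torus (\<lambda>p. of_real (F p) * (\<beta> (snd p) * wave k l p))"
    by (rule in_L2_bounded_integrable[OF F, of _ B])
      (auto intro!: measurable_torus_continuous continuous_intros continuous_wave continuous_on_compose2[OF \<beta>(1)]
        simp: norm_mult \<beta>(2))
  have i': "integrable (circle \<Otimes>\<^sub>M circle) (\<lambda>(x, y). of_real (F (x, y)) * (\<beta> y * wave k l (x, y)))"
    using i by (simp add: torus_def case_prod_beta')
  have "fcoef (\<lambda>y. \<beta> y * xmode F k y) l = (\<integral>y. (\<integral>x. of_real (F (x, y)) * (\<beta> y * wave k l (x, y)) \<partial>circle) \<partial>circle)"
    unfolding fcoef_def xmode_def wave_def
  proof (intro Bochner_Integration.integral_cong refl)
    fix y
    have "of_real (\<beta> y) * (\<integral>x. of_real (F (x, y)) * cnj (fchar k x) \<partial>circle) * cnj (fchar l y)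
      = (of_real (\<beta> y) * cnj (fchar l y)) * (\<integral>x. of_real (F (x, y)) * cnj (fchar k x) \<partial>circle)"
      by (simp only: mult_ac)
    also have "\<dots> = (\<integral>x. (of_real (\<beta> y) * cnj (fchar l y)) * (of_real (F (x, y)) * cnj (fchar k x)) \<partial>circle)"
      by (rule integral_mult_right_zero[symmetric])
    also have "\<dots> = (\<integral>x. of_real (F (x, y)) * (\<beta> y * (cnj (fchar k (fst (x, y))) * cnj (fchar l (snd (x, y))))) \<partial>circle)"
      by (intro Bochner_Integration.integral_cong refl) (simp add: mult_ac)
    finally show "of_real (\<beta> y) * (\<integral>x. of_real (F (x, y)) * cnj (fchar k x) \<partial>circle) * cnj (fchar l y)
      = (\<integral>x. of_real (F (x, y)) * (\<beta> y * (cnj (fchar k (fst (x, y))) * cnj (fchar l (snd (x, y))))) \<partial>circle)" .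
  qed
  also have "\<dots> = (\<integral>p. of_real (F p) * (\<beta> (snd p) * wave k l p) \<partial>torus)"
    using circle2.integral_snd[OF i'] by (simp add: torus_def case_prod_beta')
  finally show "fcoef (\<lambda>y. \<beta> y * xmode F k y) l = (\<integral>p. of_real (F p) * (\<beta> (snd p) * wave k l p) \<partial>torus)" .
qed

subsection \<open>The weak formulation tested with plane waves\<close>

text \<open>\<open>\<alpha> = 0\<close> and \<open>\<alpha> = \<pi>/2\<close> give the derivatives of the real and imaginary part of \<open>wave k l\<close>.\<close>

definition plane_wave :: "int \<Rightarrow> int \<Rightarrow> real \<Rightarrow> nat \<Rightarrow> nat \<Rightarrow> real \<times> real \<Rightarrow> real" where
  "plane_wave k l \<alpha> m n p = (2 * pi * of_int k) ^ m * (2 * pi * of_int l) ^ n *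
     cos (2 * pi * of_int k * fst p + 2 * pi * of_int l * snd p + \<alpha> + of_nat (m + n) * (pi / 2))"

text \<open>Differentiating a cosine advances its phase by a quarter period; hence a single formula,
  with phase depending on m + n, gives all partial derivatives of a plane wave.\<close>

lemma cos_plus_quarter: "cos (z + of_nat (Suc n) * (pi / 2)) = - sin (z + of_nat n * (pi / 2))"
proof -
  have "z + of_nat (Suc n) * (pi / 2) = (z + of_nat n * (pi / 2)) + pi / 2"
    by (simp add: algebra_simps)
  then show ?thesis by (simp only: cos_add) simp
qed

lemma smooth_partials_plane_wave: "smooth_partials (plane_wave k l \<alpha>)"
  unfolding smooth_partials_def
proof (intro conjI allI)
  fix x y :: real
  have sh: "cos (z + 2 * pi * of_int j) = cos z" for z and j :: int
    by (simp add: cos_add sin_integer_2pi cos_integer_2pi)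
  show "plane_wave k l \<alpha> 0 0 (x + 1, y) = plane_wave k l \<alpha> 0 0 (x, y)"
    using sh[of "2 * pi * of_int k * x + 2 * pi * of_int l * y + \<alpha>" k]
    by (simp add: plane_wave_def algebra_simps)
  show "plane_wave k l \<alpha> 0 0 (x, y + 1) = plane_wave k l \<alpha> 0 0 (x, y)"
    using sh[of "2 * pi * of_int k * x + 2 * pi * of_int l * y + \<alpha>" l]
    by (simp add: plane_wave_def algebra_simps)
  fix m n
  show "continuous_on UNIV (plane_wave k l \<alpha> m n)"
    unfolding plane_wave_def by (intro continuous_intros)
  have "((\<lambda>s. plane_wave k l \<alpha> m n (s, y)) has_real_derivative
      (2 * pi * of_int k) ^ m * (2 * pi * of_int l) ^ n *
     (2 * pi * of_int k * - sin (2 * pi * of_int k * x + 2 * pi * of_int l * y + \<alpha> + of_nat (m + n) * (pi / 2)))) (at x)"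
    unfolding plane_wave_def by (auto intro!: derivative_eq_intros)
  then show "((\<lambda>s. plane_wave k l \<alpha> m n (s, y)) has_real_derivative plane_wave k l \<alpha> (Suc m) n (x, y)) (at x)"
    by (simp only: plane_wave_def add_Suc cos_plus_quarter fst_conv snd_conv power_Suc mult_ac)
  have "((\<lambda>s. plane_wave k l \<alpha> m n (x, s)) has_real_derivative
      (2 * pi * of_int k) ^ m * (2 * pi * of_int l) ^ n *
     (2 * pi * of_int l * - sin (2 * pi * of_int k * x + 2 * pi * of_int l * y + \<alpha> + of_nat (m + n) * (pi / 2)))) (at y)"
    unfolding plane_wave_def by (auto intro!: derivative_eq_intros)
  then show "((\<lambda>s. plane_wave k l \<alpha> m n (x, s)) has_real_derivative plane_wave k l \<alpha> m (Suc n) (x, y)) (at y)"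
    by (simp only: plane_wave_def add_Suc_right cos_plus_quarter fst_conv snd_conv power_Suc mult_ac)
qed

lemma wave_eq: "wave k l p = Complex (cos (2 * pi * of_int k * fst p + 2 * pi * of_int l * snd p))
    (- sin (2 * pi * of_int k * fst p + 2 * pi * of_int l * snd p))"
  by (simp add: wave_def cnj_fchar fchar_def cis_mult complex_eq_iff cos_add sin_add)

text \<open>Test functions are real while modes are complex. Z is the adjoint operator b d/dx +
  \<nu> \<Delta> applied to the complex wave, so the two real tests together give the complex
  coefficient equation.\<close>

lemma plane_wave_Re_Im:
  fixes k l b \<nu>
  defines "Z p \<equiv> - (4 * pi\<^sup>2 * \<nu> * (of_int k ^ 2 + of_int l ^ 2)) * wave k l p
      - 2 * pi * \<i> * of_int k * (complex_of_real (b (snd p)) * wave k l p)"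
  shows "plane_wave k l 0 0 0 p = Re (wave k l p)" "plane_wave k l (pi / 2) 0 0 p = Im (wave k l p)"
    "b (snd p) * plane_wave k l 0 1 0 p + \<nu> * (plane_wave k l 0 2 0 p + plane_wave k l 0 0 2 p) = Re (Z p)"
    "b (snd p) * plane_wave k l (pi / 2) 1 0 p + \<nu> * (plane_wave k l (pi / 2) 2 0 p + plane_wave k l (pi / 2) 0 2 p) = Im (Z p)"
proof -
  define w where "w = 2 * pi * of_int k * fst p + 2 * pi * of_int l * snd p"
  have c: "cos (w + pi / 2) = - sin w" "cos (w + pi) = - cos w" "cos (w + pi / 2 + pi / 2) = - cos w"
    by (simp_all add: cos_add sin_add)
  have "cos (w + pi * 3 / 2) = cos ((w + pi / 2) + pi)"
    by (rule arg_cong[where f=cos]) simp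
  then have c4: "cos (w + pi * 3 / 2) = sin w"
    unfolding cos_periodic_pi by (simp add: cos_add)
  show "plane_wave k l 0 0 0 p = Re (wave k l p)" "plane_wave k l (pi / 2) 0 0 p = Im (wave k l p)"
    "b (snd p) * plane_wave k l 0 1 0 p + \<nu> * (plane_wave k l 0 2 0 p + plane_wave k l 0 0 2 p) = Re (Z p)"
    "b (snd p) * plane_wave k l (pi / 2) 1 0 p + \<nu> * (plane_wave k l (pi / 2) 2 0 p + plane_wave k l (pi / 2) 0 2 p) = Im (Z p)"
    unfolding plane_wave_def Z_def wave_eq w_def[symmetric]
    by (simp_all add: c c4 power2_eq_square algebra_simps)
qed

lemma has_integral_complexI:
  assumes "((\<lambda>s. Re (X s)) has_integral Re I) A" "((\<lambda>s. Im (X s)) has_integral Im I) A"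
  shows "(X has_integral I) A"
proof -
  have "((of_real \<circ> (\<lambda>s. Re (X s))) has_integral complex_of_real (Re I)) A"
    "((of_real \<circ> (\<lambda>s. Im (X s))) has_integral complex_of_real (Im I)) A"
    by (rule has_integral_linear[OF assms(1) bounded_linear_of_real] has_integral_linear[OF assms(2) bounded_linear_of_real])+
  then have "((\<lambda>s. of_real (Re (X s)) + \<i> * of_real (Im (X s))) has_integral (of_real (Re I) + \<i> * of_real (Im I))) A"
    unfolding o_def by (intro has_integral_add has_integral_mult_right)
  then show ?thesis by (simp add: complex_eq[symmetric])
qed

lemma norm_L2_sq: "(norm_L2 F)\<^sup>2 = (\<integral>p. (F p)\<^sup>2 \<partial>torus)"
  unfolding norm_L2_def by (rule real_sqrt_pow2) simp

text \<open>Continuity in time passes to the mode because taking an x-mode does not increase the L^2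
  norm; the coefficient equations come from testing with the plane waves of frequency (k,
  l).\<close>

lemma solution_mode:
  assumes b: "continuous_on UNIV b" "periodic1 b" and \<nu>: "\<nu> > 0" and f0: "in_L2 f0"
    and sol: "advection_diffusion_solution b \<nu> f0 f"
  shows "shear_mode b \<nu> k (\<lambda>t. xmode (f t) k)"
proof
  have L2: "in_L2 (f t)" if "t \<ge> 0" for t
    using sol that unfolding advection_diffusion_solution_def by blast
  obtain B where B: "\<And>y. \<bar>b y\<bar> \<le> B"
    using periodic1_bounded[OF b(2,1)] by (metis real_norm_def)
  show "square_integrable (xmode (f t) k)" if "t \<ge> 0" for t
    by (rule square_integrable_xmode[OF L2[OF that]])
  show "((\<lambda>s. \<integral>y. (cmod (xmode (f s) k y - xmode (f t) k y))\<^sup>2 \<partial>circle) \<longlongrightarrow> 0) (at t within {0..})" if t: "t \<ge> 0" for t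
  proof (rule tendsto_sandwich[OF _ _ tendsto_const])
    have "((\<lambda>s. norm_L2 (\<lambda>p. f s p - f t p)) \<longlongrightarrow> 0) (at t within {0..})"
      using sol t unfolding advection_diffusion_solution_def by blast
    from tendsto_power[OF this, of 2]
    show "((\<lambda>s. (norm_L2 (\<lambda>p. f s p - f t p))\<^sup>2) \<longlongrightarrow> 0) (at t within {0..})" by simp
    have "sqnorm (\<lambda>y. xmode (f s) k y - xmode (f t) k y) \<le> (norm_L2 (\<lambda>p. f s p - f t p))\<^sup>2" if s: "s \<ge> 0" for s
    proof -
      note d = in_L2_diff[OF L2[OF s] L2[OF t]]
      have "sqnorm (\<lambda>y. xmode (f s) k y - xmode (f t) k y)
         = sqnorm (xmode (\<lambda>p. f s p - f t p) k)"
      proof (rule integral_cong_AE)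
        show "AE y in circle. (cmod (xmode (f s) k y - xmode (f t) k y))\<^sup>2 = (cmod (xmode (\<lambda>p. f s p - f t p) k y))\<^sup>2"
          using xmode_diff[OF L2[OF s] L2[OF t], of k] by eventually_elim simp
      qed (use xmode_measurable[OF L2[OF s]] xmode_measurable[OF L2[OF t]] xmode_measurable[OF d] in auto)
      also have "\<dots> \<le> (\<integral>p. (f s p - f t p)\<^sup>2 \<partial>torus)"
        by (rule xmode_norm_le[OF d])
      finally show ?thesis by (simp add: norm_L2_sq)
    qed
    then show "\<forall>\<^sub>F s in at t within {0..}. sqnorm (\<lambda>y. xmode (f s) k y - xmode (f t) k y) \<le> (norm_L2 (\<lambda>p. f s p - f t p))\<^sup>2"
      by (auto simp: eventually_at_filter)
  qed auto
  show "((\<lambda>s. - (4 * pi\<^sup>2 * \<nu> * (of_int k ^ 2 + of_int l ^ 2)) * fcoef (xmode (f s) k) l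
         - 2 * pi * \<i> * of_int k * fcoef (\<lambda>y. b y * xmode (f s) k y) l)
       has_integral (fcoef (xmode (f t) k) l - fcoef (xmode (f 0) k) l)) {0..t}" if t: "t \<ge> 0" for l t
  proof -
    define Z where "Z p = - (4 * pi\<^sup>2 * \<nu> * (of_int k ^ 2 + of_int l ^ 2)) * wave k l p
      - 2 * pi * \<i> * of_int k * (complex_of_real (b (snd p)) * wave k l p)" for p
    define X where "X s = (\<integral>p. of_real (f s p) * Z p \<partial>torus)" for s
    have c1: "fcoef (xmode F k) l = (\<integral>p. of_real (F p) * wave k l p \<partial>torus)"
      "integrable torus (\<lambda>p. of_real (F p) * wave k l p)" if "in_L2 F" for F
      using fcoef_xmode[OF that, of "\<lambda>_. 1" 1 k l] by auto
    note cb = fcoef_xmode[OF _ b(1) B, of _ k l]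
    have XZ: "X s = - (4 * pi\<^sup>2 * \<nu> * (of_int k ^ 2 + of_int l ^ 2)) * fcoef (xmode (f s) k) l
         - 2 * pi * \<i> * of_int k * fcoef (\<lambda>y. b y * xmode (f s) k y) l"
      and Xi: "integrable torus (\<lambda>p. of_real (f s p) * Z p)" if s: "s \<ge> 0" for s
    proof -
      have eq: "of_real (f s p) * Z p = - (4 * pi\<^sup>2 * \<nu> * (of_int k ^ 2 + of_int l ^ 2)) * (of_real (f s p) * wave k l p)
         - 2 * pi * \<i> * of_int k * (of_real (f s p) * (complex_of_real (b (snd p)) * wave k l p))" for p
        unfolding Z_def by (simp add: algebra_simps)
      show "integrable torus (\<lambda>p. of_real (f s p) * Z p)"
        unfolding eq by (intro Bochner_Integration.integrable_diff integrable_mult_right c1(2) cb(2) L2 s)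
      show "X s = - (4 * pi\<^sup>2 * \<nu> * (of_int k ^ 2 + of_int l ^ 2)) * fcoef (xmode (f s) k) l
         - 2 * pi * \<i> * of_int k * fcoef (\<lambda>y. b y * xmode (f s) k y) l"
        unfolding X_def eq c1(1)[OF L2[OF s]] cb(1)[OF L2[OF s]]
        by (subst Bochner_Integration.integral_diff)
          (auto simp only: integral_mult_right_zero intro!: integrable_mult_right c1(2) cb(2) L2 s)
    qed
    \<comment> \<open>The weak equation starts from \<open>f0\<close>, the mode from
      \<open>f 0\<close>; they agree almost everywhere, which suffices under integrals.\<close>
    have I0: "(\<integral>p. f0 p * h p \<partial>torus) = (\<integral>p. f 0 p * h p \<partial>torus)" if "continuous_on UNIV h" for h :: "real \<times> real \<Rightarrow> real"
    proof (rule integral_cong_AE)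
      show "AE p in torus. f0 p * h p = f 0 p * h p"
        using sol unfolding advection_diffusion_solution_def by (auto elim: AE_mp)
    qed (use in_L2_measurable[OF f0] in_L2_measurable[OF L2[of 0]] measurable_torus_continuous[OF that] in auto)
    have weak: "((\<lambda>s. \<integral>p. f s p * (b (snd p) * plane_wave k l \<alpha> 1 0 p + \<nu> * (plane_wave k l \<alpha> 2 0 p + plane_wave k l \<alpha> 0 2 p)) \<partial>torus)
          has_integral ((\<integral>p. f t p * plane_wave k l \<alpha> 0 0 p \<partial>torus) - (\<integral>p. f 0 p * plane_wave k l \<alpha> 0 0 p \<partial>torus))) {0..t}" for \<alpha>
    proof -
      have c: "continuous_on UNIV (plane_wave k l \<alpha> 0 0)"
        using smooth_partials_plane_wave unfolding smooth_partials_def by blast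
      have "\<forall>D. smooth_partials D \<longrightarrow> (\<forall>t\<ge>0.
        ((\<lambda>s. \<integral>p. f s p * (b (snd p) * D 1 0 p + \<nu> * (D 2 0 p + D 0 2 p)) \<partial>torus)
          has_integral
         ((\<integral>p. f t p * D 0 0 p \<partial>torus) - (\<integral>p. f0 p * D 0 0 p \<partial>torus))) {0..t})"
        using sol unfolding advection_diffusion_solution_def by blast
      from this[rule_format, OF smooth_partials_plane_wave[of k l \<alpha>] t] show ?thesis
        unfolding I0[OF c] .
    qed
    have reim: "Re (\<integral>p. of_real (F p) * W p \<partial>torus) = (\<integral>p. F p * Re (W p) \<partial>torus)"
        "Im (\<integral>p. of_real (F p) * W p \<partial>torus) = (\<integral>p. F p * Im (W p) \<partial>torus)"
      if "integrable torus (\<lambda>p. of_real (F p) * W p)" for F :: "real \<times> real \<Rightarrow> real" and W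
      using integral_Re[OF that] integral_Im[OF that] by auto
    have "(X has_integral (fcoef (xmode (f t) k) l - fcoef (xmode (f 0) k) l)) {0..t}"
    proof (rule has_integral_complexI)
      have "((\<lambda>s. \<integral>p. f s p * Re (Z p) \<partial>torus) has_integral Re (fcoef (xmode (f t) k) l - fcoef (xmode (f 0) k) l)) {0..t}"
        using weak[of 0] reim(1)[OF c1(2)[OF L2[OF t]]] reim(1)[OF c1(2)[OF L2[of 0]]]
        unfolding plane_wave_Re_Im Z_def[symmetric] by (simp add: c1(1) L2 t)
      then show "((\<lambda>s. Re (X s)) has_integral Re (fcoef (xmode (f t) k) l - fcoef (xmode (f 0) k) l)) {0..t}"
        by (rule has_integral_eq[rotated]) (simp add: X_def reim(1)[OF Xi])
      have "((\<lambda>s. \<integral>p. f s p * Im (Z p) \<partial>torus) has_integral Im (fcoef (xmode (f t) k) l - fcoef (xmode (f 0) k) l)) {0..t}"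
        using weak[of "pi / 2"] reim(2)[OF c1(2)[OF L2[OF t]]] reim(2)[OF c1(2)[OF L2[of 0]]]
        unfolding plane_wave_Re_Im Z_def[symmetric] by (simp add: c1(1) L2 t)
      then show "((\<lambda>s. Im (X s)) has_integral Im (fcoef (xmode (f t) k) l - fcoef (xmode (f 0) k) l)) {0..t}"
        by (rule has_integral_eq[rotated]) (simp add: X_def reim(2)[OF Xi])
    qed
    then show ?thesis
      by (rule has_integral_eq[rotated]) (simp add: XZ)
  qed
qed (use b \<nu> in auto)

lemma mean_zero_mode:
  assumes "in_L2 f0" and mean: "AE y in circle. (\<integral>x. f0 (x, y) \<partial>circle) = 0"
  shows "AE y in circle. xmode f0 0 y = 0"
  using mean by eventually_elim (simp add: xmode_def fcoef_def integral_complex_of_real)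

text \<open>Arguing through the difference avoids a discussion of sections: its L^2 norm on the
  torus is 0, hence so is that of its mode.\<close>

lemma xmode_cong_AE:
  assumes F: "in_L2 F" and G: "in_L2 G" and eq: "AE p in torus. F p = G p"
  shows "sqnorm (xmode F k) = sqnorm (xmode G k)"
proof -
  have d: "in_L2 (\<lambda>p. F p - G p)" by (rule in_L2_diff[OF F G])
  have "(\<integral>p. (F p - G p)\<^sup>2 \<partial>torus) = (\<integral>p. 0 \<partial>torus)"
    using d eq by (intro integral_cong_AE) (auto simp: in_L2_def elim: AE_mp)
  then have "sqnorm (xmode (\<lambda>p. F p - G p) k) = 0"
    using xmode_norm_le[OF d, of k] by (simp add: antisym)
  then have "AE y in circle. (cmod (xmode (\<lambda>p. F p - G p) k y))\<^sup>2 = 0"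
    using integral_nonneg_eq_0_iff_AE[OF square_integrable_norm[OF square_integrable_xmode[OF d]]] by simp
  then have "AE y in circle. xmode F k y = xmode G k y"
    using xmode_diff[OF F G, of k] by eventually_elim simp
  then show ?thesis
    using xmode_measurable[OF F] xmode_measurable[OF G] by (intro integral_cong_AE) (auto elim: AE_mp)
qed

text \<open>All nonzero modes decay with the same constants, so Parseval in x transfers the bound to
  the solution. The factor 4 and the doubled rate belong to squared norms.\<close>

lemma solution_decay:
  assumes b: "continuous_on UNIV b" "periodic1 b" and \<nu>: "\<nu> > 0" and K: "K > 0"
    and resolvent: "\<And>\<kappa> lam S a. \<bar>\<kappa>\<bar> \<ge> 1 \<Longrightarrow> finite S \<Longrightarrow> sqnorm (trig_poly S a)
      \<le> K\<^sup>2 * sqnorm (shear_resolvent b \<nu> \<kappa> lam S a)"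
    and f0: "in_L2 f0" and mean: "AE y in circle. (\<integral>x. f0 (x, y) \<partial>circle) = 0"
    and sol: "advection_diffusion_solution b \<nu> f0 f" and t: "t \<ge> 0"
  shows "norm_L2 (f t) \<le> 2 * exp (- (ln 2 / (4 * pi)) * t / K) * norm_L2 f0"
proof -
  have L2: "in_L2 (f t)" if "t \<ge> 0" for t
    using sol that unfolding advection_diffusion_solution_def by blast
  have eq0: "AE p in torus. f 0 p = f0 p"
    using sol unfolding advection_diffusion_solution_def by blast
  define m where "m k t = sqnorm (xmode (f t) k)" for k t
  define q where "q = 4 * exp (- (2 * (ln 2 / (4 * pi))) * t / K)"
  have q: "q \<ge> 0" by (simp add: q_def)
  have bound: "m k t \<le> q * m k 0" for k
  proof -
    interpret shear_mode b \<nu> k "\<lambda>t. xmode (f t) k"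
      by (rule solution_mode[OF b \<nu> f0 sol])
    have mass: "mass s = m k s" for s by (simp add: mass_def m_def)
    show ?thesis
    proof (cases "k = 0")
      \<comment> \<open>The mean-zero mode is absent initially, and monotonicity of the mass keeps
        it absent.\<close>
      case True
      have "m k 0 = sqnorm (xmode f0 k)"
        unfolding m_def by (rule xmode_cong_AE[OF L2 f0 eq0]) simp
      also have "\<dots> = (\<integral>y. 0 \<partial>circle)"
        using mean_zero_mode[OF f0 mean] xmode_measurable[OF f0] True
        by (intro integral_cong_AE) (auto elim: AE_mp)
      finally show ?thesis
        using mass_antimono[of 0 t] t by (simp add: mass)
    next
      case False
      have "1 \<le> \<bar>2 * pi * real_of_int k\<bar>"
      proof -
        have "1 * 1 \<le> (2 * pi) * \<bar>real_of_int k\<bar>"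
          using False pi_ge_two by (intro mult_mono) auto
        then show ?thesis by (simp add: abs_mult)
      qed
      then show ?thesis
        using mass_decay[OF False K t resolvent] unfolding mass q_def by blast
    qed
  qed
  have "(\<integral>p. (f t p)\<^sup>2 \<partial>torus) \<le> q * (\<integral>p. (f 0 p)\<^sup>2 \<partial>torus)"
  proof (rule LIMSEQ_le)
    show "(\<lambda>N. \<Sum>k\<in>freqs N. m k t) \<longlonglongrightarrow> (\<integral>p. (f t p)\<^sup>2 \<partial>torus)"
      unfolding m_def by (rule xmode_parseval[OF L2[OF t]])
    show "(\<lambda>N. q * (\<Sum>k\<in>freqs N. m k 0)) \<longlonglongrightarrow> q * (\<integral>p. (f 0 p)\<^sup>2 \<partial>torus)"
      unfolding m_def by (intro tendsto_intros xmode_parseval L2) simp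
    show "\<exists>N. \<forall>n\<ge>N. (\<Sum>k\<in>freqs n. m k t) \<le> q * (\<Sum>k\<in>freqs n. m k 0)"
      unfolding sum_distrib_left by (intro exI allI impI sum_mono bound)
  qed
  also have "(\<integral>p. (f 0 p)\<^sup>2 \<partial>torus) = (\<integral>p. (f0 p)\<^sup>2 \<partial>torus)"
    using eq0 in_L2_measurable[OF f0] in_L2_measurable[OF L2[of 0]]
    by (intro integral_cong_AE) (auto elim: AE_mp)
  also have "q = (2 * exp (- (ln 2 / (4 * pi)) * t / K))\<^sup>2"
    unfolding q_def power_mult_distrib exp_double[symmetric] by (simp add: mult_ac)
  finally have "(norm_L2 (f t))\<^sup>2 \<le> (2 * exp (- (ln 2 / (4 * pi)) * t / K) * norm_L2 f0)\<^sup>2"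
    by (simp add: norm_L2_sq power_mult_distrib)
  then show ?thesis
    by (rule power2_le_imp_le) (simp add: norm_L2_def)
qed

subsection \<open>The dissipation time\<close>

text \<open>The intermediate value theorem makes the level set nonempty; it is closed and bounded
  below, so the infimum is attained and satisfies the equation itself.\<close>

lemma enhanced_time_props:
  assumes h0: "h0 > 0" and c: "continuous_on {0..h0} \<phi>" and mono: "strict_mono_on {0..h0} \<phi>"
    and \<phi>0: "\<phi> 0 = 0" and \<nu>: "\<nu> > 0"
  shows "enhanced_time h0 \<phi> \<nu> > 0"
    and "enhanced_time h0 \<phi> \<nu> * \<phi> (min h0 (sqrt (\<nu> * enhanced_time h0 \<phi> \<nu>))) = 1"
proof -
  define G where "G t = t * \<phi> (min h0 (sqrt (\<nu> * t)))" for t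
  define S where "S = {t. t \<ge> 0 \<and> G t = 1}"
  have pos: "\<phi> h0 > 0"
    using strict_mono_onD[OF mono, of 0 h0] h0 \<phi>0 by simp
  have Gc: "continuous_on {0..} G"
    unfolding G_def
    by (intro continuous_intros continuous_on_compose2[OF c]) (use h0 \<nu> in auto)
  \<comment> \<open>The first entry forces the minimum to equal \<open>h0\<close>, the second then
    makes the product at least 1.\<close>
  define t1 where "t1 = max (h0\<^sup>2 / \<nu>) (1 / \<phi> h0)"
  have t1: "t1 \<ge> 0" "\<nu> * t1 \<ge> h0\<^sup>2" "t1 * \<phi> h0 \<ge> 1"
    using \<nu> pos h0 unfolding t1_def by (auto simp: field_simps max_def)
  have "sqrt (\<nu> * t1) \<ge> h0"
    using t1(2) h0 by (intro real_le_rsqrt) auto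
  then have "G t1 \<ge> 1" using t1(3) by (simp add: G_def min_def)
  moreover have "G 0 = 0" by (simp add: G_def)
  ultimately have "\<exists>t. 0 \<le> t \<and> t \<le> t1 \<and> G t = 1"
    using t1(1) by (intro IVT' continuous_on_subset[OF Gc]) auto
  then have "S \<noteq> {}" by (auto simp: S_def)
  moreover have "closed S"
  proof -
    have "closed ({0..} \<inter> G -` {1})"
      by (rule continuous_closed_preimage[OF Gc]) auto
    then show ?thesis by (simp add: S_def Int_def vimage_def)
  qed
  moreover have "bdd_below S" by (intro bdd_belowI[of _ 0]) (simp add: S_def)
  ultimately have "Inf S \<in> S" by (intro closed_contains_Inf)
  moreover have "enhanced_time h0 \<phi> \<nu> = Inf S"
    by (simp add: enhanced_time_def S_def G_def)
  ultimately have *: "enhanced_time h0 \<phi> \<nu> \<ge> 0" "G (enhanced_time h0 \<phi> \<nu>) = 1"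
    by (auto simp: S_def)
  then show "enhanced_time h0 \<phi> \<nu> * \<phi> (min h0 (sqrt (\<nu> * enhanced_time h0 \<phi> \<nu>))) = 1"
    by (simp add: G_def)
  show "enhanced_time h0 \<phi> \<nu> > 0"
    using * by (cases "enhanced_time h0 \<phi> \<nu> = 0") (auto simp: G_def)
qed

text \<open>If \<nu> T \<ge> e, then \<phi> in the defining equation is at least \<phi>(d), so T
  \<phi>(d) \<le> 1 and e \<phi>(d) \<le> \<nu> T \<phi>(d) \<le> \<nu>, impossible for small
  \<nu>.\<close>

lemma enhanced_time_diffusive_limit:
  assumes h0: "h0 > 0" and c: "continuous_on {0..h0} \<phi>" and mono: "strict_mono_on {0..h0} \<phi>" and \<phi>0: "\<phi> 0 = 0"
  shows "((\<lambda>\<nu>. \<nu> * enhanced_time h0 \<phi> \<nu>) \<longlongrightarrow> 0) (at_right 0)"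
proof (rule order_tendstoI)
  fix e :: real assume "e < 0"
  then have "e < \<nu> * enhanced_time h0 \<phi> \<nu>" if "\<nu> > 0" for \<nu>
    using enhanced_time_props(1)[OF assms that] that by (smt (verit) mult_pos_pos)
  then show "\<forall>\<^sub>F \<nu> in at_right 0. e < \<nu> * enhanced_time h0 \<phi> \<nu>"
    by (auto simp: eventually_at_filter)
next
  fix e :: real assume e: "0 < e"
  define d where "d = min (sqrt e) h0"
  have d: "0 < d" "d \<le> h0" "d \<le> sqrt e" using e h0 by (auto simp: d_def)
  have pd: "\<phi> d > 0" using strict_mono_onD[OF mono, of 0 d] d \<phi>0 by simp
  have "\<nu> * enhanced_time h0 \<phi> \<nu> < e" if \<nu>: "\<nu> > 0" "\<nu> < e * \<phi> d" for \<nu>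
  proof (rule ccontr)
    let ?T = "enhanced_time h0 \<phi> \<nu>"
    assume "\<not> \<nu> * ?T < e"
    then have "sqrt e \<le> sqrt (\<nu> * ?T)" by simp
    then have "d \<le> sqrt (\<nu> * ?T)" using d(3) by (rule order_trans[rotated])
    then have "d \<le> min h0 (sqrt (\<nu> * ?T))" using d(2) by simp
    then have "\<phi> d \<le> \<phi> (min h0 (sqrt (\<nu> * ?T)))"
      using d \<nu>(1) enhanced_time_props(1)[OF assms \<nu>(1)]
      by (intro monotone_onD[OF strict_mono_on_imp_mono_on[OF mono]]) auto
    then have "?T * \<phi> d \<le> 1"
      using enhanced_time_props[OF assms \<nu>(1)] mult_left_mono[of "\<phi> d" "\<phi> (min h0 (sqrt (\<nu> * ?T)))" ?T] by simp
    then have "\<nu> * (?T * \<phi> d) \<le> \<nu> * 1" using \<nu> by (intro mult_left_mono) auto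
    then have "\<nu> * ?T * \<phi> d \<le> \<nu>" by (simp only: mult.assoc mult_1_right)
    moreover have "e * \<phi> d \<le> \<nu> * ?T * \<phi> d"
      using \<open>\<not> \<nu> * ?T < e\<close> pd by (intro mult_right_mono) auto
    ultimately show False using \<nu>(2) by linarith
  qed
  then have less: "\<nu> * enhanced_time h0 \<phi> \<nu> < e" if "\<nu> \<in> {0<..<e * \<phi> d}" for \<nu>
    using that by simp
  have "\<forall>\<^sub>F \<nu> in at_right 0. \<nu> \<in> {0<..<e * \<phi> d}"
    using e pd by (intro eventually_at_right_real) simp
  then show "\<forall>\<^sub>F \<nu> in at_right 0. \<nu> * enhanced_time h0 \<phi> \<nu> < e"
    by (rule eventually_mono) (rule less)
qed

section \<open>The resolvent bound for the given profile, and the conclusion\<close>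

lemma admissible_direction_inj:
  assumes b: "admissible_profile b Y" and dir: "admissible_direction b Y h0 \<iota>"
  shows "inj_on (\<lambda>r. b (y + \<iota> y * r)) {0..h0}"
proof (rule linorder_inj_onI)
  fix r1 r2 assume r: "r1 < r2" "r1 \<in> {0..h0}" "r2 \<in> {0..h0}"
  let ?B = "\<lambda>r. b (y + \<iota> y * r)"
  have "\<iota> y \<in> {1, -1}" using dir unfolding admissible_direction_def by blast
  then have \<iota>: "\<iota> y \<noteq> 0" by auto
  have cb: "continuous_on UNIV b" using b unfolding admissible_profile_def by blast
  \<comment> \<open>Only interior points of the segment avoid \<open>Y\<close> and the critical
    points; Rolle's theorem asks for no derivative at the ends.\<close>
  have db: "(b has_real_derivative deriv b (y + \<iota> y * r)) (at (y + \<iota> y * r))"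
    and nz: "deriv b (y + \<iota> y * r) \<noteq> 0" if r': "r1 < r" "r < r2" for r
  proof -
    have r0: "r \<in> {0<..<h0}" using r r' by auto
    then have "frac (y + \<iota> y * r) \<notin> Y" and nc: "\<not> critical_point b (y + \<iota> y * r)"
      using dir unfolding admissible_direction_def by auto
    then have "(deriv ^^ 0) b differentiable (at (y + \<iota> y * r))"
      using b unfolding admissible_profile_def by blast
    then show "(b has_real_derivative deriv b (y + \<iota> y * r)) (at (y + \<iota> y * r))"
      by (simp add: DERIV_deriv_iff_real_differentiable)
    with nc show "deriv b (y + \<iota> y * r) \<noteq> 0" by (auto simp: critical_point_def)
  qed
  have dB: "(?B has_real_derivative deriv b (y + \<iota> y * r) * \<iota> y) (at r)" if "r1 < r" "r < r2" for r
  proof -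
    have "((\<lambda>r. y + \<iota> y * r) has_real_derivative \<iota> y) (at r)"
      by (auto intro!: derivative_eq_intros)
    from DERIV_chain'[OF this db[OF that]] show ?thesis .
  qed
  show "?B r1 \<noteq> ?B r2"
  proof
    assume "?B r1 = ?B r2"
    then have "\<exists>z. r1 < z \<and> z < r2 \<and> (?B has_real_derivative 0) (at z)"
    proof (rule Rolle[OF r(1)])
      show "continuous_on {r1..r2} ?B"
        by (intro continuous_on_compose2[OF cb] continuous_intros) auto
      show "?B differentiable (at r)" if "r1 < r" "r < r2" for r
        using dB[OF that] by (auto simp: real_differentiable_def)
    qed
    then obtain z where z: "r1 < z" "z < r2" "(?B has_real_derivative 0) (at z)"
      by blast
    then show False
      using DERIV_unique[OF dB[OF z(1,2)] z(3)] nz[OF z(1,2)] \<iota> by simp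
  qed
qed auto

text \<open>The constant is a sum so that it dominates both regimes: 532 when the covering argument
  has room, 36 / \<open>h0\<^sup>2\<close> when diffusion in x alone is strong enough.\<close>

lemma shear_resolvent_bound:
  assumes b: "admissible_profile b Y" and h0: "h0 > 0" and dir: "admissible_direction b Y h0 \<iota>"
    and c: "continuous_on {0..h0} \<phi>" and mono: "strict_mono_on {0..h0} \<phi>" and \<phi>0: "\<phi> 0 = 0"
    and incr: "\<And>y h. h \<in> {0..h0} \<Longrightarrow> \<bar>b (y + \<iota> y * h) - b y\<bar> \<ge> \<phi> h"
    and \<nu>: "\<nu> > 0" and \<kappa>: "\<bar>\<kappa>\<bar> \<ge> 1" and S: "finite S"
  shows "sqnorm (trig_poly S a)
    \<le> ((532 + 36 / h0\<^sup>2) * enhanced_time h0 \<phi> \<nu>)\<^sup>2 * sqnorm (shear_resolvent b \<nu> \<kappa> lam S a)"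
    (is "?X \<le> (?K * ?T)\<^sup>2 * ?R")
proof -
  have cb: "continuous_on UNIV b" "periodic1 b" using b unfolding admissible_profile_def by blast+
  have T: "?T > 0" "?T * \<phi> (min h0 (sqrt (\<nu> * ?T))) = 1"
    by (rule enhanced_time_props[OF h0 c mono \<phi>0 \<nu>])+
  have R: "?R \<ge> 0" by simp
  show ?thesis
  proof (cases "6 * sqrt (\<nu> * ?T) \<le> h0")
    case True
    define h where "h = sqrt (\<nu> * ?T)"
    have h: "h > 0" "h\<^sup>2 = \<nu> * ?T" "6 * h \<le> h0" using T(1) \<nu> True by (auto simp: h_def)
    have "min h0 (sqrt (\<nu> * ?T)) = h"
      unfolding h_def[symmetric] by (rule min_absorb2) (use h in linarith)
    then have \<phi>h: "\<phi> h = 1 / ?T" using T by (simp add: field_simps)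
    have near: "\<exists>j\<in>shifts. \<bar>b (y + j * h) - lam\<bar> \<ge> 1 / (2 * ?T) \<and> (\<forall>z. b z = lam \<longrightarrow> \<bar>y + j * h - z\<bar> \<ge> h)" for y lam
    proof -
      have "\<exists>j\<in>shifts. \<bar>b (y + j * h) - lam\<bar> \<ge> (1 / ?T) / 2 \<and> (\<forall>z. b z = lam \<longrightarrow> \<bar>y + j * h - z\<bar> \<ge> h)"
      proof (rule near_large_values[OF cb(1)])
        show "\<iota> y \<in> {1, -1}" for y using dir unfolding admissible_direction_def by blast
        show "inj_on (\<lambda>r. b (y + \<iota> y * r)) {0..6 * h}" for y
          by (rule inj_on_subset[OF admissible_direction_inj[OF b dir]]) (use h in auto)
        show "1 / ?T \<le> \<bar>b (y + \<iota> y * h) - b y\<bar>" for y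
          using incr[of h y] h \<phi>h by simp
      qed (use h T in auto)
      then show ?thesis by (simp add: mult.commute)
    qed
    have "?X \<le> 282752 * ?T\<^sup>2 * ?R"
      by (rule resolvent_bound[OF cb S \<nu> \<kappa> T(1) h(1,2) near])
    also have "\<dots> \<le> (?K * ?T)\<^sup>2 * ?R"
    proof (intro mult_right_mono R)
      \<comment> \<open>532 is the least integer whose square, 283024, exceeds 282752.\<close>
      have "(532 :: real)\<^sup>2 \<le> ?K\<^sup>2" by (intro power_mono) auto
      then have "282752 \<le> ?K\<^sup>2" by simp
      then have "282752 * ?T\<^sup>2 \<le> ?K\<^sup>2 * ?T\<^sup>2" by (intro mult_right_mono) auto
      then show "282752 * ?T\<^sup>2 \<le> (?K * ?T)\<^sup>2" by (simp only: power_mult_distrib)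
    qed
    finally show ?thesis .
  next
    case False
    \<comment> \<open>The 36 is the square of the 6 in the case distinction; it makes \<nu> at least
      a multiple of 1 / T.\<close>
    have "h0 < sqrt (36 * (\<nu> * ?T))"
      using False by (simp add: real_sqrt_mult)
    then have "h0\<^sup>2 < (sqrt (36 * (\<nu> * ?T)))\<^sup>2"
      using h0 by (intro power_strict_mono) auto
    then have "h0\<^sup>2 < 36 * (\<nu> * ?T)"
      using \<nu> T by simp
    then have "1 \<le> 36 / h0\<^sup>2 * (\<nu> * ?T)" using h0 by (simp add: field_simps)
    also have "\<dots> \<le> ?K * (\<nu> * ?T)" using \<nu> T by (intro mult_right_mono) auto
    finally have "1 \<le> (\<nu> * (?K * ?T))\<^sup>2" by (simp add: mult_ac one_le_power)
    then have "?X \<le> (\<nu> * (?K * ?T))\<^sup>2 * ?X"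
      using mult_right_mono[of 1 _ ?X] by simp
    also have "\<dots> = (?K * ?T)\<^sup>2 * (\<nu>\<^sup>2 * ?X)" by (simp add: power_mult_distrib)
    also have "\<dots> \<le> (?K * ?T)\<^sup>2 * ?R"
      by (intro mult_left_mono resolvent_poincare[OF cb(1) S \<nu> \<kappa>]) simp
    finally show ?thesis .
  qed
qed

theorem theorem1:
  fixes b \<iota> \<phi> :: "real \<Rightarrow> real" and Y :: "real set" and h0 :: real
  assumes "admissible_profile b Y"
    and "h0 > 0"
    and "admissible_direction b Y h0 \<iota>"
    and "continuous_on {0..h0} \<phi>"
    and "strict_mono_on {0..h0} \<phi>"
    and "\<phi> 0 = 0"
    and "\<And>y h. h \<in> {0..h0} \<Longrightarrow> \<bar>b (y + \<iota> y * h) - b y\<bar> \<ge> \<phi> h"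
  shows "dissipation_enhancing b (\<lambda>\<nu>. inverse (enhanced_time h0 \<phi> \<nu>))"
proof -
  let ?T = "enhanced_time h0 \<phi>"
  define K where "K = 532 + 36 / h0\<^sup>2"
  have K: "K > 0" using assms(2) by (auto simp: K_def intro!: add_pos_nonneg)
  \<comment> \<open>The rate depends on \<open>h0\<close> only, so one pair of constants serves all
    \<nu>.\<close>
  define c where "c = ln 2 / (4 * pi) / K"
  have c: "c > 0" using K by (simp add: c_def)
  have cb: "continuous_on UNIV b" "periodic1 b" using assms(1) unfolding admissible_profile_def by blast+
  note T = enhanced_time_props(1)[OF assms(2,4,5,6)]
  show ?thesis
    unfolding dissipation_enhancing_def
  proof (intro conjI ballI)
    show "inverse (?T \<nu>) > 0" if "\<nu> \<in> {0<..<1}" for \<nu>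
      using T that by simp
    show "((\<lambda>\<nu>. \<nu> / inverse (?T \<nu>)) \<longlongrightarrow> 0) (at_right 0)"
      using enhanced_time_diffusive_limit[OF assms(2,4,5,6)] by (simp add: divide_inverse)
    have decay: "norm_L2 (f t) \<le> 2 * exp (- c * inverse (?T \<nu>) * t) * norm_L2 f0"
      if \<nu>: "\<nu> \<in> {0<..<1}" and f: "in_L2 f0" "AE y in circle. (\<integral>x. f0 (x, y) \<partial>circle) = 0"
        "advection_diffusion_solution b \<nu> f0 f" and t: "t \<ge> 0" for \<nu> f0 f t
    proof -
      have \<nu>0: "\<nu> > 0" using \<nu> by simp
      have "norm_L2 (f t) \<le> 2 * exp (- (ln 2 / (4 * pi)) * t / (K * ?T \<nu>)) * norm_L2 f0"
      proof (rule solution_decay[OF cb \<nu>0 _ _ f t])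
        show "K * ?T \<nu> > 0" using K T[OF \<nu>0] by simp
        show "sqnorm (trig_poly S a)
            \<le> (K * ?T \<nu>)\<^sup>2 * sqnorm (shear_resolvent b \<nu> \<kappa> lam S a)"
          if "\<bar>\<kappa>\<bar> \<ge> 1" "finite S" for \<kappa> lam S a
          unfolding K_def by (rule shear_resolvent_bound[OF assms \<nu>0 that])
      qed
      also have "- (ln 2 / (4 * pi)) * t / (K * ?T \<nu>) = - c * inverse (?T \<nu>) * t"
        by (simp add: c_def field_simps)
      finally show ?thesis .
    qed
    then show "\<exists>C>0. \<exists>c>0. \<forall>\<nu>\<in>{0<..<1}. \<forall>f0 f.
        in_L2 f0 \<and> (AE y in circle. (\<integral>x. f0 (x, y) \<partial>circle) = 0) \<and>
        advection_diffusion_solution b \<nu> f0 f \<longrightarrow>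
        (\<forall>t\<ge>0. norm_L2 (f t) \<le> C * exp (- c * inverse (?T \<nu>) * t) * norm_L2 f0)"
      using c by (intro exI[of _ 2] exI[of _ c]) auto
  qed
qed

end
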